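(* The psi-calculus $\mathbf{PPI}$ is a complete representation of the (unsorted) polyadic pi-calculus.
   Context: **Names, nominal sets.** In what follows there is one countably infinite set $\mathcal N$ of names, all of sort $\mathtt{chan}$. A tilde denotes a finite tuple (or the set of its entries). $\mathrm n(T)$ is the (finite) support of $T$, i.e. its free names; $a\#T$ means $a\notin\mathrm n(T)$. Equivariant means preserved by all name swappings. **The sorted psi-calculus PPI.** Sorts $\mathtt{chan},\mathtt{tup}$. Terms: $\mathbf T=\mathcal N\cup\{\langle\tilde a\rangle:\tilde a\in\mathcal N^*\}$; names have sort $\mathtt{chan}$, tuples have sort $\mathtt{tup}$. Conditions: $\mathbf C=\{\top,\bot\}\cup\{a=b: a,b\in\mathcal N\}$. Assertions: $\mathbf A=\{\mathbf 1\}$, $\mathbf 1\otimes\mathbf 1=\mathbf 1$. Entailment: $\mathbf 1\vdash\top$; $\mathbf 1\vdash a=b$ iff $a$ and $b$ are the same name; $\mathbf 1\not\vdash\bot$. Channel equivalence: $a\leftrightarrow b$ is the condition $a=b$ for names $a,b$, and $M\leftrightarrow N$ is $\bot$ if $M,N$ are not both names. Patterns: $\mathbf X=\{\langle\tilde a\rangle:\tilde a\in\mathcal N^*\text{ with distinct entries}\}$, of sort $\mathtt{tup}$; $\mathrm{vars}(\langle\tilde a\rangle)=\{\tilde a\}$ (all names of the pattern must be bound). $\mathrm{Match}(\langle\tilde a\rangle,\tilde x,\langle\tilde y\rangle)=\{\tilde c\}$ if $\{\tilde x\}=\{\tilde y\}$ and $\langle\tilde y\rangle[\tilde x:=\tilde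 c]=\langle\tilde a\rangle$; $\mathrm{Match}$ is $\emptyset$ otherwise. Only names can be substituted for names; substitution $[\tilde a:=\tilde b]$ on terms and conditions is the usual simultaneous one (patterns are unaffected, all their names being bound). Names of sort $\mathtt{chan}$ may be restricted; a term of sort $\mathtt{chan}$ can send terms of, and receive with patterns of, sort $\mathtt{tup}$ only. **Agents.** $\overline M\,N.P$ (well-formed only if $M$ is a name and $N$ a tuple); $\underline M(\lambda\tilde x)X.P$ (well-formed only if $M$ is a name and $\tilde x$ is a tuple of distinct names listing exactly the names of $X$; $\tilde x$ binds in $X$ and $P$); $\mathbf{case}\ \varphi_1:P_1[]\cdots[]\varphi_n:P_n$ (the empty case is $\mathbf 0$); $(\nu a)P$; $P\mid Q$; $!P$; $(\!|\Psi|\!)$. Agents are identified up to alpha-equivalence. An assertion is unguarded if not inside an input or output; well-formed agents must have no unguarded assertions inside the body of a replication or inside a branch of a case. Only well-formed agents are considered. Substitution on agents is capture-avoiding. **Transitions of PPI** (the only assertion being $\mathbf 1$, it is omitted). Actions: $\overline M(\nu\tilde a)N$ with $\tilde a\subseteq\mathrm n(N)$ (bound names $\tilde a$; written $\overline M\,N$ if $\tilde a$ is empty), $\underline M\,N$, $\tau$. Bound names bind into object and derivative. - In: $\underline M(\lambda\tilde y)X.P\xrightarrow{\underline K\,N}P[\tilde y:=\tilde L]$ if $\mathbf 1\vdash M\leftrightarrow K$ and $\tilde L\in\mathrm{Match}(N,\tilde y,X)$. - Out: $\overline M\,N.P\xrightarrow{\overline K\,N}P$ if $\mathbf 1\vdash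 M\leftrightarrow K$. - Com: if $P\xrightarrow{\overline M(\nu\tilde a)N}P'$, $Q\xrightarrow{\underline K\,N}Q'$, $\mathbf 1\vdash M\leftrightarrow K$, $\tilde a\#Q$, then $P\mid Q\xrightarrow\tau(\nu\tilde a)(P'\mid Q')$ (and symmetrically). - Par: if $P\xrightarrow\alpha P'$ and $\mathrm{bn}(\alpha)\#Q$ then $P\mid Q\xrightarrow\alpha P'\mid Q$ (and symmetrically). - Case: if $P_i\xrightarrow\alpha P'$ and $\mathbf 1\vdash\varphi_i$ then $\mathbf{case}\ \tilde\varphi:\tilde P\xrightarrow\alpha P'$. - Rep: if $P\mid{!P}\xrightarrow\alpha P'$ then $!P\xrightarrow\alpha P'$. - Scope: if $P\xrightarrow\alpha P'$ and $b\#\alpha$ then $(\nu b)P\xrightarrow\alpha(\nu b)P'$. - Open: if $P\xrightarrow{\overline M(\nu\tilde a)N}P'$, $b\#\tilde a,M$, $b\in\mathrm n(N)$, then $(\nu b)P\xrightarrow{\overline M(\nu\tilde a\cup\{b\})N}P'$, where $\tilde a\cup\{b\}$ is $\tilde a$ with $b$ inserted anywhere. **Strong bisimulation congruence.** Since $\mathbf A=\{\mathbf 1\}$, a strong bisimulation is a symmetric relation $\mathcal R$ on agents whose related agents have frames entailing the same conditions (automatic here) and such that if $P\,\mathcal R\,Q$, $\mathrm{bn}(\alpha)\#Q$ and $P\xrightarrow\alpha P'$ then $Q\xrightarrow\alpha Q'$ with $P'\,\mathcal R\,Q'$ for some $Q'$; $\dot\sim$ is the largest one. $P\sim Q$ iff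 $P\tilde\sigma\mathrel{\dot\sim}Q\tilde\sigma$ for all finite sequences $\tilde\sigma$ of substitutions. **Structural congruence of psi-agents.** $\equiv$ is the smallest equivalence relation on agents closed under all agent constructors satisfying, whenever $a\#Q,\tilde x,M,N,X,\tilde\varphi$: $\mathbf{case}\ \varphi_1:(\nu a)P_1[]\cdots[]\varphi_n:(\nu a)P_n\equiv(\nu a)\mathbf{case}\ \tilde\varphi:\tilde P$; $\underline M(\lambda\tilde x)X.(\nu a)P\equiv(\nu a)\underline M(\lambda\tilde x)X.P$; $\overline M\,N.(\nu a)P\equiv(\nu a)\overline M\,N.P$; $Q\mid(\nu a)P\equiv(\nu a)(Q\mid P)$; $(\nu b)(\nu a)P\equiv(\nu a)(\nu b)P$; $!P\equiv P\mid{!P}$; $P\mid(Q\mid R)\equiv(P\mid Q)\mid R$; $P\mid Q\equiv Q\mid P$; $P\equiv P\mid\mathbf 0$; $(\nu a)\mathbf 0\equiv\mathbf 0$. **Representation.** A context $C$ of arity $k$ is a (raw) psi-calculus process term with $k$ occurrences of $\mathbf 0$ replaced by holes, and $C[P_1,\dots,P_k]$ fills the holes from left to right (possibly capturing names). A psi-calculus is a representation of a process calculus with processes $\mathcal P$ and labelled transition system $\to\;\subseteq\mathcal P\times\mathcal A\times\mathcal P$ if there exist an equivariant map $[\![\cdot]\!]$ from $\mathcal P$ to psi-calculus processes and an equivariant relation $\approxeq$ between $\mathcal A$ and psi-calculus actions such that: (1) for each process constructor $f$ of $\mathcal P$ there is an equivariant psi-calculus context $C$ (depending equivariantly on the name parameters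 of $f$, such as $x,\tilde y$ in $x(\tilde y).[\,]$) such that $[\![f(P_1,\dots,P_n)]\!]=C[[\![P_1]\!],\dots,[\![P_n]\!]]$; (2a) whenever $P\xrightarrow\beta P'$ there are $\alpha,Q$ with $[\![P]\!]\xrightarrow\alpha Q$, $[\![P']\!]\equiv Q$ and $\beta\approxeq\alpha$; (2b) whenever $[\![P]\!]\xrightarrow\alpha Q$ there are $\beta,P'$ with $P\xrightarrow\beta P'$, $[\![P']\!]\equiv Q$ and $\beta\approxeq\alpha$. It is complete if moreover (3) for each psi process $P$ there is $Q\in\mathcal P$ with $P\sim[\![Q]\!]$. **Polyadic pi-calculus.** $P,Q::=\mathbf 0\mid x(\tilde y).P\mid\overline x\langle\tilde y\rangle.P\mid[a=b]P\mid\nu x\,P\mid{!P}\mid P\mid Q\mid P+Q$, where in $x(\tilde y).P$ the names $\tilde y$ are distinct and bind in $P$, $\nu x$ binds $x$, processes are up to alpha-equivalence, and $\mathrm{fn}$ denotes free names. Actions: $(\nu\tilde y')\overline z\langle\tilde y\rangle$ with $\tilde y'\subseteq\tilde y$ distinct and $z\notin\tilde y'$ (the order of the bound names $\tilde y'$ is immaterial), $x\langle\tilde z\rangle$, $\tau$. Rules (symmetric ones included): $\overline x\langle\tilde y\rangle.P\xrightarrow{\overline x\langle\tilde y\rangle}P$; $x(\tilde y).P\xrightarrow{x\langle\tilde z\rangle}P\{\tilde z/\tilde y\}$ if $\tilde z,\tilde y$ have the same length; $P\xrightarrow\beta P'$ implies $P+Q\xrightarrow\beta P'$, $[x=x]P\xrightarrow\beta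 P'$, $P\mid Q\xrightarrow\beta P'\mid Q$ if $\mathrm{bn}(\beta)\cap\mathrm{fn}(Q)=\emptyset$, and $\nu x\,P\xrightarrow\beta\nu x\,P'$ if $x\notin\mathrm n(\beta)$; $P\mid{!P}\xrightarrow\beta P'$ implies $!P\xrightarrow\beta P'$; $P\xrightarrow{(\nu\tilde y')\overline x\langle\tilde y\rangle}P'$ and $Q\xrightarrow{x\langle\tilde y\rangle}Q'$ with $\tilde y'\cap\mathrm{fn}(Q)=\emptyset$ imply $P\mid Q\xrightarrow\tau\nu\tilde y'(P'\mid Q')$; $P\xrightarrow{(\nu\tilde y')\overline z\langle\tilde y\rangle}P'$ with $x\ne z$, $x\in\tilde y\setminus\tilde y'$ implies $\nu x\,P\xrightarrow{(\nu x,\tilde y')\overline z\langle\tilde y\rangle}P'$. *)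

theory Defs
  imports "HOL-Combinatorics.Transposition"
begin

section \<open>Names and name substitutions\<close>

text \<open>Only countable infiniteness of the set of names is used; the order and the arithmetic of
  \<^typ>\<open>nat\<close> play no role.\<close>

type_synonym name = nat

abbreviation swp :: "name \<Rightarrow> name \<Rightarrow> name \<Rightarrow> name" where
  "swp a b \<equiv> Transposition.transpose a b"

text \<open>\<open>upd \<sigma> xs cs\<close> is the simultaneous update of \<open>\<sigma>\<close> at the entries of \<open>xs\<close>.\<close>

definition upd :: "(name \<Rightarrow> name) \<Rightarrow> name list \<Rightarrow> name list \<Rightarrow> name \<Rightarrow> name" where
  "upd \<sigma> xs cs x = (case map_of (zip xs cs) x of None \<Rightarrow> \<sigma> x | Some c \<Rightarrow> c)"

text \<open>The substitution \<open>[xs := cs]\<close> as a function on names; meaningful for distinct \<open>xs\<close> and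
  \<open>cs\<close> of the same length.\<close>

abbreviation nsub :: "name list \<Rightarrow> name list \<Rightarrow> name \<Rightarrow> name" where
  "nsub \<equiv> upd (\<lambda>x. x)"

text \<open>Some \<open>n\<close> distinct names outside \<open>A\<close>; the choice depends on \<open>n\<close> and \<open>A\<close> only.\<close>

definition freshs :: "nat \<Rightarrow> name set \<Rightarrow> name list" where
  "freshs n A = (SOME cs. length cs = n \<and> distinct cs \<and> set cs \<inter> A = {})"

definition fresh :: "name set \<Rightarrow> name" where
  "fresh A = (SOME c. c \<notin> A)"

lemma upd_map_inj:
  assumes "inj \<pi>"
  shows "upd \<sigma> (map \<pi> xs) cs (\<pi> x) = upd (\<sigma> \<circ> \<pi>) xs cs x"
proof (induction xs arbitrary: cs)
  case Nil
  then show ?case by (simp add: upd_def)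
next
  case (Cons y ys)
  then show ?case using assms by (cases cs) (auto simp: upd_def inj_eq)
qed

lemma distinct_map_inj: "inj \<pi> \<Longrightarrow> distinct (map \<pi> xs) = distinct xs"
  using inj_on_subset[of \<pi> UNIV "set xs"] by (simp add: distinct_map)

lemma upd_cong:
  assumes "x \<notin> set xs \<Longrightarrow> \<sigma> x = \<tau> x" "length cs = length xs"
  shows "upd \<sigma> xs cs x = upd \<tau> xs cs x"
proof (cases "x \<in> set xs")
  case True
  then have "x \<in> dom (map_of (zip xs cs))" using assms(2) by simp
  then show ?thesis by (auto simp: upd_def)
next
  case False
  then have "map_of (zip xs cs) x = None" using assms(2) by simp
  then show ?thesis using False assms(1) by (simp add: upd_def)
qed

lemma freshs_props:
  assumes "finite A"
  shows "length (freshs n A) = n \<and> distinct (freshs n A) \<and> set (freshs n A) \<inter> A = {}"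
proof -
  have "infinite (- A)" using assms by (simp add: Compl_eq_Diff_UNIV)
  then obtain B where B: "finite B" "card B = n" "B \<subseteq> - A" using infinite_arbitrarily_large by blast
  obtain cs where "set cs = B" "distinct cs" using finite_distinct_list B(1) by blast
  then have "length cs = n \<and> distinct cs \<and> set cs \<inter> A = {}" using B distinct_card by force
  then show ?thesis unfolding freshs_def by (rule someI)
qed

lemma fresh_prop: "finite A \<Longrightarrow> fresh A \<notin> A"
  unfolding fresh_def by (rule someI_ex) (metis ex_new_if_finite infinite_UNIV_nat)

section \<open>Parameters of PPI\<close>

datatype sort = Chan | Tuple

datatype (names_trm: 'n) trm = Nm 'n | Tup "'n list" for map: ren_trm
datatype (names_cond: 'n) cond = CTop | CBot | CEq 'n 'n for map: ren_cond
datatype (names_pat: 'n) pat = PTup "'n list" for map: ren_pat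
datatype assertion = One

fun sort_trm :: "'n trm \<Rightarrow> sort" where
  "sort_trm (Nm a) = Chan"
| "sort_trm (Tup as) = Tuple"

fun sort_pat :: "'n pat \<Rightarrow> sort" where
  "sort_pat (PTup as) = Tuple"

definition can_send :: "sort \<Rightarrow> sort \<Rightarrow> bool" where
  "can_send s t \<longleftrightarrow> s = Chan \<and> t = Tuple"

definition can_receive :: "sort \<Rightarrow> sort \<Rightarrow> bool" where
  "can_receive s t \<longleftrightarrow> s = Chan \<and> t = Tuple"

fun wf_pat :: "'n pat \<Rightarrow> bool" where
  "wf_pat (PTup as) = distinct as"

fun compose :: "assertion \<Rightarrow> assertion \<Rightarrow> assertion" where
  "compose One One = One"

fun entails :: "assertion \<Rightarrow> name cond \<Rightarrow> bool" where
  "entails One CTop = True"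
| "entails One CBot = False"
| "entails One (CEq a b) = (a = b)"

fun chan_eq :: "name trm \<Rightarrow> name trm \<Rightarrow> name cond" where
  "chan_eq (Nm a) (Nm b) = CEq a b"
| "chan_eq _ _ = CBot"

fun matches :: "name trm \<Rightarrow> name list \<Rightarrow> name pat \<Rightarrow> name list set" where
  "matches (Tup as) xs (PTup ys) =
     {cs. distinct xs \<and> length cs = length xs \<and> set xs = set ys \<and> map (nsub xs cs) ys = as}"
| "matches (Nm a) xs X = {}"

section \<open>Agents\<close>

text \<open>In raw agents every name argument is a value of the type parameter, so that
  \<open>ren_raw \<pi>\<close> renames all names, binding occurrences included.\<close>

datatype (all_names: 'n) raw =
    ROut "'n trm" "'n trm" "'n raw"
  | RIn "'n trm" "'n list" "'n pat" "'n raw"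
  | RCase "('n cond \<times> 'n raw) list"
  | RRes 'n "'n raw"
  | RPar "'n raw" "'n raw"
  | RBang "'n raw"
  | RAssert assertion
  for map: ren_raw

fun fn_raw :: "name raw \<Rightarrow> name set" where
  "fn_raw (ROut M N P) = names_trm M \<union> names_trm N \<union> fn_raw P"
| "fn_raw (RIn M xs X P) = names_trm M \<union> (names_pat X \<union> fn_raw P - set xs)"
| "fn_raw (RCase bs) = (\<Union>(\<phi>, P) \<in> set bs. names_cond \<phi> \<union> fn_raw P)"
| "fn_raw (RRes a P) = fn_raw P - {a}"
| "fn_raw (RPar P Q) = fn_raw P \<union> fn_raw Q"
| "fn_raw (RBang P) = fn_raw P"
| "fn_raw (RAssert \<Psi>) = {}"

text \<open>Binders are renamed one bound name at a time; simultaneous renamings of the names bound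
  by an input arise by transitivity.\<close>

inductive alpha :: "name raw \<Rightarrow> name raw \<Rightarrow> bool" where
  alpha_refl: "alpha P P"
| alpha_sym: "alpha P Q \<Longrightarrow> alpha Q P"
| alpha_trans: "alpha P Q \<Longrightarrow> alpha Q R \<Longrightarrow> alpha P R"
| alpha_ren_res: "b \<notin> fn_raw P \<Longrightarrow> alpha (RRes a P) (RRes b (ren_raw (swp a b) P))"
| alpha_ren_in: "a \<in> set xs \<Longrightarrow> b \<notin> set xs \<union> names_pat X \<union> fn_raw P \<Longrightarrow>
    alpha (RIn M xs X P) (RIn M (map (swp a b) xs) (ren_pat (swp a b) X) (ren_raw (swp a b) P))"
| alpha_out: "alpha P Q \<Longrightarrow> alpha (ROut M N P) (ROut M N Q)"
| alpha_in: "alpha P Q \<Longrightarrow> alpha (RIn M xs X P) (RIn M xs X Q)"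
| alpha_case: "list_all2 (rel_prod (=) alpha) bs cs \<Longrightarrow> alpha (RCase bs) (RCase cs)"
| alpha_res: "alpha P Q \<Longrightarrow> alpha (RRes a P) (RRes a Q)"
| alpha_par: "alpha P P' \<Longrightarrow> alpha Q Q' \<Longrightarrow> alpha (RPar P Q) (RPar P' Q')"
| alpha_bang: "alpha P Q \<Longrightarrow> alpha (RBang P) (RBang Q)"

text \<open>No assertion occurs outside the inputs and outputs of the agent.\<close>

fun noassert_raw :: "name raw \<Rightarrow> bool" where
  "noassert_raw (ROut M N P) = True"
| "noassert_raw (RIn M xs X P) = True"
| "noassert_raw (RCase bs) = (\<forall>(\<phi>, P) \<in> set bs. noassert_raw P)"
| "noassert_raw (RRes a P) = noassert_raw P"
| "noassert_raw (RPar P Q) = (noassert_raw P \<and> noassert_raw Q)"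
| "noassert_raw (RBang P) = noassert_raw P"
| "noassert_raw (RAssert \<Psi>) = False"

fun wf_raw :: "name raw \<Rightarrow> bool" where
  "wf_raw (ROut M N P) = (can_send (sort_trm M) (sort_trm N) \<and> wf_raw P)"
| "wf_raw (RIn M xs X P) = (can_receive (sort_trm M) (sort_pat X) \<and> wf_pat X \<and>
     distinct xs \<and> set xs = names_pat X \<and> wf_raw P)"
| "wf_raw (RCase bs) = (\<forall>(\<phi>, P) \<in> set bs. wf_raw P \<and> noassert_raw P)"
| "wf_raw (RRes a P) = wf_raw P"
| "wf_raw (RPar P Q) = (wf_raw P \<and> wf_raw Q)"
| "wf_raw (RBang P) = (wf_raw P \<and> noassert_raw P)"
| "wf_raw (RAssert \<Psi>) = True"

text \<open>The name binders of a frame are left out: the only assertion contains no names.\<close>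

fun frame_raw :: "name raw \<Rightarrow> assertion" where
  "frame_raw (RRes a P) = frame_raw P"
| "frame_raw (RPar P Q) = compose (frame_raw P) (frame_raw Q)"
| "frame_raw (RAssert \<Psi>) = \<Psi>"
| "frame_raw _ = One"

text \<open>Simultaneous capture-avoiding substitution: every binder is replaced by names that are
  fresh for the image of the free names in its scope.\<close>

fun sub_raw :: "(name \<Rightarrow> name) \<Rightarrow> name raw \<Rightarrow> name raw" where
  "sub_raw \<sigma> (ROut M N P) = ROut (ren_trm \<sigma> M) (ren_trm \<sigma> N) (sub_raw \<sigma> P)"
| "sub_raw \<sigma> (RIn M xs X P) =
     (let cs = freshs (length xs) (\<sigma> ` (names_pat X \<union> fn_raw P - set xs));
          \<tau> = upd \<sigma> xs cs
      in RIn (ren_trm \<sigma> M) (map \<tau> xs) (ren_pat \<tau> X) (sub_raw \<tau> P))"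
| "sub_raw \<sigma> (RCase bs) = RCase (map (\<lambda>(\<phi>, P). (ren_cond \<sigma> \<phi>, sub_raw \<sigma> P)) bs)"
| "sub_raw \<sigma> (RRes a P) = (let c = fresh (\<sigma> ` (fn_raw P - {a})) in RRes c (sub_raw (\<sigma>(a := c)) P))"
| "sub_raw \<sigma> (RPar P Q) = RPar (sub_raw \<sigma> P) (sub_raw \<sigma> Q)"
| "sub_raw \<sigma> (RBang P) = RBang (sub_raw \<sigma> P)"
| "sub_raw \<sigma> (RAssert \<Psi>) = RAssert \<Psi>"

lemma finite_names_trm[simp]: "finite (names_trm M)"
  by (cases M) auto

lemma finite_names_cond[simp]: "finite (names_cond \<phi>)"
  by (cases \<phi>) auto

lemma finite_names_pat[simp]: "finite (names_pat X)"
  by (cases X) auto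

lemma finite_fn_raw[simp]: "finite (fn_raw P)"
  by (induction P) auto

lemma fn_raw_ren: "inj \<pi> \<Longrightarrow> fn_raw (ren_raw \<pi> P) = \<pi> ` fn_raw P"
proof (induction P)
  case (RIn M xs X P)
  then show ?case
    by (simp add: trm.set_map pat.set_map image_Un image_set_diff)
next
  case (RCase bs)
  then show ?case by (auto simp: cond.set_map split_beta) force+
next
  case (RRes a P)
  then show ?case by (simp add: image_set_diff)
qed (auto simp: trm.set_map)

lemma inj_swp[simp]: "inj (swp a b)"
  by (rule injI) (metis Transposition.transpose_involutory)

lemma swp_image_fresh: "b \<notin> A \<Longrightarrow> swp a b ` A - {b} = A - {a}"
  by (force simp: Transposition.transpose_def)

lemma swp_image_fresh2:
  assumes "a \<in> S" "b \<notin> S \<union> A"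
  shows "swp a b ` A - swp a b ` S = A - S"
proof -
  have "swp a b ` A - swp a b ` S = swp a b ` (A - S)" by (simp add: image_set_diff)
  also have "\<dots> = (\<lambda>x. x) ` (A - S)"
    using assms by (intro image_cong) (auto simp: Transposition.transpose_def)
  finally show ?thesis by simp
qed

lemma fn_raw_alpha: "alpha P Q \<Longrightarrow> fn_raw P = fn_raw Q"
proof (induction rule: alpha.induct)
  case (alpha_ren_res b P a)
  then show ?case by (simp add: fn_raw_ren swp_image_fresh)
next
  case (alpha_ren_in a xs b X P M)
  then show ?case
    using swp_image_fresh2[of a "set xs" b "names_pat X \<union> fn_raw P"]
    by (simp add: fn_raw_ren pat.set_map image_Un)
next
  case (alpha_case bs cs)
  then show ?case
    by (induction rule: list_all2_induct) (auto simp: rel_prod_sel)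
qed auto

lemma noassert_ren: "noassert_raw (ren_raw \<pi> P) = noassert_raw P"
  by (induction P) (fastforce simp: split_beta)+

lemma sort_ren[simp]: "sort_trm (ren_trm \<pi> M) = sort_trm M" "sort_pat (ren_pat \<pi> X) = sort_pat X"
  by (cases M; simp) (cases X; simp)

lemma wf_pat_ren[simp]: "inj \<pi> \<Longrightarrow> wf_pat (ren_pat \<pi> X) = wf_pat X"
  by (cases X) (simp add: distinct_map_inj)

lemma wf_raw_ren: "inj \<pi> \<Longrightarrow> wf_raw (ren_raw \<pi> P) = wf_raw P"
proof (induction P)
  case (RIn M xs X P)
  then show ?case
    by (simp add: pat.set_map distinct_map_inj inj_image_eq_iff)
next
  case (RCase bs)
  then show ?case by (fastforce simp: split_beta noassert_ren)
qed (auto simp: noassert_ren)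

lemma noassert_alpha: "alpha P Q \<Longrightarrow> noassert_raw P = noassert_raw Q"
proof (induction rule: alpha.induct)
  case (alpha_case bs cs)
  then show ?case by (induction rule: list_all2_induct) (auto simp: rel_prod_sel)
qed (auto simp: noassert_ren)

lemma wf_raw_alpha: "alpha P Q \<Longrightarrow> wf_raw P = wf_raw Q"
proof (induction rule: alpha.induct)
  case (alpha_ren_in a xs b X P M)
  have "wf_raw (ren_raw (swp a b) P) = wf_raw P" by (simp add: wf_raw_ren)
  then show ?case
    by (simp add: pat.set_map distinct_map_inj inj_image_eq_iff)
next
  case (alpha_case bs cs)
  then show ?case
    by (induction rule: list_all2_induct) (auto simp: rel_prod_sel noassert_alpha)
qed (auto simp: wf_raw_ren noassert_alpha)

lemma frame_raw_eq: "frame_raw P = One"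
  by (metis assertion.exhaust)

lemma swp_comp: "swp c d \<circ> swp a b = swp (swp c d a) (swp c d b) \<circ> swp c d"
  by (auto simp: fun_eq_iff Transposition.transpose_def)

lemma ren_raw_swp_comp:
  "ren_raw (swp c d) (ren_raw (swp a b) P) =
   ren_raw (swp (swp c d a) (swp c d b)) (ren_raw (swp c d) P)"
  by (simp add: raw.map_comp swp_comp[of c d a b])

lemma ren_pat_swp_comp:
  "ren_pat (swp c d) (ren_pat (swp a b) P) =
   ren_pat (swp (swp c d a) (swp c d b)) (ren_pat (swp c d) P)"
  by (simp add: pat.map_comp swp_comp[of c d a b])

lemma map_swp_comp:
  "map (swp c d) (map (swp a b) xs) = map (swp (swp c d a) (swp c d b)) (map (swp c d) xs)"
  by (simp only: map_map swp_comp[of c d a b])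

lemma alpha_swp: "alpha P Q \<Longrightarrow> alpha (ren_raw (swp c d) P) (ren_raw (swp c d) Q)"
proof (induction rule: alpha.induct)
  case (alpha_sym P Q)
  then show ?case by (meson alpha.alpha_sym)
next
  case (alpha_trans P Q R)
  then show ?case by (meson alpha.alpha_trans)
next
  case (alpha_ren_res b P a)
  then show ?case
    using alpha.alpha_ren_res[of "swp c d b" "ren_raw (swp c d) P" "swp c d a"]
    by (simp add: ren_raw_swp_comp[of c d a b] fn_raw_ren inj_image_mem_iff)
next
  case (alpha_ren_in a xs b X P M)
  then show ?case
    using alpha.alpha_ren_in[of "swp c d a" "map (swp c d) xs" "swp c d b"
        "ren_pat (swp c d) X" "ren_raw (swp c d) P" "ren_trm (swp c d) M"]
    by (simp add: ren_raw_swp_comp[of c d a b] ren_pat_swp_comp[of c d a b] map_swp_comp[of c d a b]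
        fn_raw_ren inj_image_mem_iff pat.set_map del: map_map)
next
  case (alpha_case bs cs)
  then show ?case
    by (auto intro!: alpha.alpha_case simp: list.rel_map rel_prod_sel elim!: list_all2_mono)
next
  case (alpha_refl P)
  then show ?case by (simp add: alpha.alpha_refl)
next
  case (alpha_out P Q M N)
  then show ?case by (simp add: alpha.alpha_out)
next
  case (alpha_in P Q M xs X)
  then show ?case by (simp add: alpha.alpha_in)
next
  case (alpha_res P Q a)
  then show ?case by (simp add: alpha.alpha_res)
next
  case (alpha_par P P' Q Q')
  then show ?case by (simp add: alpha.alpha_par)
next
  case (alpha_bang P Q)
  then show ?case by (simp add: alpha.alpha_bang)
qed

lemma sub_raw_cong: "(\<And>x. x \<in> fn_raw P \<Longrightarrow> \<sigma> x = \<tau> x) \<Longrightarrow> sub_raw \<sigma> P = sub_raw \<tau> P"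
proof (induction P arbitrary: \<sigma> \<tau>)
  case (ROut M N P)
  have "sub_raw \<sigma> P = sub_raw \<tau> P" by (rule ROut.IH) (simp add: ROut.prems)
  moreover have "ren_trm \<sigma> M = ren_trm \<tau> M" "ren_trm \<sigma> N = ren_trm \<tau> N"
    by (rule trm.map_cong0, simp add: ROut.prems)+
  ultimately show ?case by simp
next
  case (RIn M xs X P)
  let ?A = "names_pat X \<union> fn_raw P - set xs"
  have A: "\<sigma> ` ?A = \<tau> ` ?A" using RIn.prems by (intro image_cong) auto
  define cs where "cs = freshs (length xs) (\<tau> ` ?A)"
  have len: "length cs = length xs" unfolding cs_def by (simp add: freshs_props)
  have u: "upd \<sigma> xs cs x = upd \<tau> xs cs x" if "x \<in> names_pat X \<union> fn_raw P \<union> set xs" for x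
    using that RIn.prems by (intro upd_cong) (auto simp: len)
  have "sub_raw (upd \<sigma> xs cs) P = sub_raw (upd \<tau> xs cs) P" by (rule RIn.IH) (simp add: u)
  moreover have "ren_pat (upd \<sigma> xs cs) X = ren_pat (upd \<tau> xs cs) X"
    by (rule pat.map_cong0) (simp add: u)
  moreover have "ren_trm \<sigma> M = ren_trm \<tau> M" by (rule trm.map_cong0) (simp add: RIn.prems)
  moreover have "map (upd \<sigma> xs cs) xs = map (upd \<tau> xs cs) xs" by (simp add: u)
  ultimately show ?case by (simp add: A Let_def flip: cs_def)
next
  case (RCase bs)
  have "(ren_cond \<sigma> \<phi>, sub_raw \<sigma> P) = (ren_cond \<tau> \<phi>, sub_raw \<tau> P)" if "(\<phi>, P) \<in> set bs" for \<phi> P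
  proof -
    have "ren_cond \<sigma> \<phi> = ren_cond \<tau> \<phi>"
      using that by (intro cond.map_cong0 RCase.prems) force
    moreover have "sub_raw \<sigma> P = sub_raw \<tau> P"
      by (rule RCase.IH[OF that]) (use that in \<open>auto intro!: RCase.prems bexI[of _ "(\<phi>, P)"]\<close>)
    ultimately show ?thesis by simp
  qed
  then show ?case by (auto simp del: prod.inject)
next
  case (RRes a P)
  have A: "\<sigma> ` (fn_raw P - {a}) = \<tau> ` (fn_raw P - {a})"
    using RRes.prems by (intro image_cong) auto
  have "sub_raw (\<sigma>(a := c)) P = sub_raw (\<tau>(a := c)) P" for c
    by (rule RRes.IH) (use RRes.prems in auto)
  then show ?case by (simp add: A Let_def)
next
  case (RPar P Q)
  have "sub_raw \<sigma> P = sub_raw \<tau> P" by (rule RPar.IH(1)) (simp add: RPar.prems)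
  moreover have "sub_raw \<sigma> Q = sub_raw \<tau> Q" by (rule RPar.IH(2)) (simp add: RPar.prems)
  ultimately show ?case by simp
next
  case (RBang P)
  have "sub_raw \<sigma> P = sub_raw \<tau> P" by (rule RBang.IH) (simp add: RBang.prems)
  then show ?case by simp
qed simp

lemma sub_raw_ren: "inj \<pi> \<Longrightarrow> sub_raw \<sigma> (ren_raw \<pi> P) = sub_raw (\<sigma> \<circ> \<pi>) P"
proof (induction P arbitrary: \<sigma>)
  case (ROut M N P)
  then show ?case by (simp add: trm.map_comp comp_def)
next
  case (RIn M xs X P)
  have "\<sigma> ` (names_pat (ren_pat \<pi> X) \<union> fn_raw (ren_raw \<pi> P) - set (map \<pi> xs))
      = (\<sigma> \<circ> \<pi>) ` (names_pat X \<union> fn_raw P - set xs)"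
    using RIn.prems
    by (simp add: fn_raw_ren pat.set_map image_Un[symmetric] image_set_diff[symmetric]
        image_image)
  moreover have "upd \<sigma> (map \<pi> xs) cs (\<pi> z) = upd (\<lambda>a. \<sigma> (\<pi> a)) xs cs z" for cs z
    using RIn.prems by (simp add: upd_map_inj comp_def)
  ultimately show ?case using RIn
    by (simp add: Let_def trm.map_comp pat.map_comp comp_def)
next
  case (RCase bs)
  then show ?case by (auto simp: cond.map_comp comp_def)
next
  case (RRes a P)
  have "\<sigma> ` (fn_raw (ren_raw \<pi> P) - {\<pi> a}) = (\<sigma> \<circ> \<pi>) ` (fn_raw P - {a})"
    using image_set_diff[OF RRes.prems, of "fn_raw P" "{a}"]
    by (simp only: fn_raw_ren[OF RRes.prems] image_insert image_empty flip: image_comp)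
  moreover have "\<sigma>(\<pi> a := c) \<circ> \<pi> = (\<sigma> \<circ> \<pi>)(a := c)" for c
    using RRes.prems by (auto simp: fun_eq_iff inj_eq)
  ultimately show ?case
    by (simp only: raw.map sub_raw.simps Let_def RRes.IH[OF RRes.prems])
qed auto

lemma sub_raw_alpha: "alpha P Q \<Longrightarrow> alpha (sub_raw \<sigma> P) (sub_raw \<sigma> Q)"
proof (induction arbitrary: \<sigma> rule: alpha.induct)
  case (alpha_sym P Q)
  then show ?case by (meson alpha.alpha_sym)
next
  case (alpha_trans P Q R)
  then show ?case by (meson alpha.alpha_trans)
next
  case (alpha_ren_res b P a)
  have "sub_raw (\<sigma>(b := c)) (ren_raw (swp a b) P) = sub_raw (\<sigma>(a := c)) P" for c
    unfolding sub_raw_ren[OF inj_swp]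
    using alpha_ren_res by (intro sub_raw_cong) (auto simp: Transposition.transpose_def)
  moreover have "fn_raw (ren_raw (swp a b) P) - {b} = fn_raw P - {a}"
    using alpha_ren_res by (simp add: fn_raw_ren swp_image_fresh)
  ultimately show ?case by (simp add: Let_def alpha.alpha_refl)
next
  case (alpha_ren_in a xs b X P M)
  let ?\<pi> = "swp a b" and ?A = "names_pat X \<union> fn_raw P"
  have A: "names_pat (ren_pat ?\<pi> X) \<union> fn_raw (ren_raw ?\<pi> P) - ?\<pi> ` set xs = ?A - set xs"
    using alpha_ren_in swp_image_fresh2[of a "set xs" b ?A]
    by (simp add: fn_raw_ren pat.set_map image_Un)
  define cs where "cs = freshs (length xs) (\<sigma> ` (?A - set xs))"
  have len: "length cs = length xs" unfolding cs_def by (simp add: freshs_props)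
  have u: "upd \<sigma> (map ?\<pi> xs) cs (?\<pi> x) = upd \<sigma> xs cs x" if "x \<in> ?A \<union> set xs" for x
    unfolding upd_map_inj[OF inj_swp] using that alpha_ren_in.hyps
    by (intro upd_cong) (auto simp: len Transposition.transpose_def)
  have "sub_raw (upd \<sigma> (map ?\<pi> xs) cs) (ren_raw ?\<pi> P) = sub_raw (upd \<sigma> xs cs) P"
    unfolding sub_raw_ren[OF inj_swp] by (rule sub_raw_cong) (simp add: u)
  moreover have "ren_pat (upd \<sigma> (map ?\<pi> xs) cs) (ren_pat ?\<pi> X) = ren_pat (upd \<sigma> xs cs) X"
    unfolding pat.map_comp by (rule pat.map_cong0) (simp add: u)
  moreover have "map (upd \<sigma> (map ?\<pi> xs) cs) (map ?\<pi> xs) = map (upd \<sigma> xs cs) xs"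
    by (simp add: u)
  ultimately have "sub_raw \<sigma> (RIn M (map ?\<pi> xs) (ren_pat ?\<pi> X) (ren_raw ?\<pi> P))
      = sub_raw \<sigma> (RIn M xs X P)"
    by (simp only: sub_raw.simps Let_def length_map set_map A flip: cs_def)
  then show ?case by (simp only: alpha.alpha_refl)
next
  case (alpha_case bs cs)
  then show ?case
    by (auto intro!: alpha.alpha_case simp: list.rel_map rel_prod_sel split_beta
        elim!: list_all2_mono)
next
  case (alpha_refl P)
  then show ?case by (simp add: alpha.alpha_refl)
next
  case (alpha_out P Q M N)
  then show ?case by (simp add: alpha.alpha_out)
next
  case (alpha_in P Q M xs X)
  then show ?case by (simp add: alpha.alpha_in Let_def fn_raw_alpha)
next
  case (alpha_res P Q a)
  then show ?case by (simp add: alpha.alpha_res Let_def fn_raw_alpha)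
next
  case (alpha_par P P' Q Q')
  then show ?case by (simp add: alpha.alpha_par)
next
  case (alpha_bang P Q)
  then show ?case by (simp add: alpha.alpha_bang)
qed

lemma equivp_alpha: "equivp alpha"
proof (rule equivpI)
  show "reflp alpha" by (rule reflpI) (rule alpha_refl)
  show "symp alpha" by (rule sympI) (rule alpha_sym)
  show "transp alpha" by (rule transpI) (rule alpha_trans)
qed

quotient_type agent = "name raw" / alpha
  by (rule equivp_alpha)

lift_definition Out :: "name trm \<Rightarrow> name trm \<Rightarrow> agent \<Rightarrow> agent" is ROut
  by (rule alpha_out)
lift_definition In :: "name trm \<Rightarrow> name list \<Rightarrow> name pat \<Rightarrow> agent \<Rightarrow> agent" is RIn
  by (rule alpha_in)
lift_definition Case :: "(name cond \<times> agent) list \<Rightarrow> agent" is RCase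
  by (rule alpha_case)
lift_definition Res :: "name \<Rightarrow> agent \<Rightarrow> agent" is RRes
  by (rule alpha_res)
lift_definition Par :: "agent \<Rightarrow> agent \<Rightarrow> agent" is RPar
  by (rule alpha_par)
lift_definition Bang :: "agent \<Rightarrow> agent" is RBang
  by (rule alpha_bang)
lift_definition Assert :: "assertion \<Rightarrow> agent" is RAssert .

abbreviation Nil0 :: agent where "Nil0 \<equiv> Case []"

definition Ress :: "name list \<Rightarrow> agent \<Rightarrow> agent" where
  "Ress as P = foldr Res as P"

lift_definition fn :: "agent \<Rightarrow> name set" is fn_raw
  by (rule fn_raw_alpha)
lift_definition wf_agent :: "agent \<Rightarrow> bool" is wf_raw
  by (rule wf_raw_alpha)
lift_definition frame :: "agent \<Rightarrow> assertion" is frame_raw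
  by (simp add: frame_raw_eq)
lift_definition swap_agent :: "name \<Rightarrow> name \<Rightarrow> agent \<Rightarrow> agent" is "\<lambda>a b. ren_raw (swp a b)"
  by (rule alpha_swp)
lift_definition sub :: "(name \<Rightarrow> name) \<Rightarrow> agent \<Rightarrow> agent" is sub_raw
  by (rule sub_raw_alpha)

section \<open>Transitions of PPI\<close>

datatype (names_act: 'n) act =
    OutA "'n trm" "'n list" "'n trm"
  | InA "'n trm" "'n trm"
  | TauA
  for map: ren_act

fun bn :: "name act \<Rightarrow> name set" where
  "bn (OutA M as N) = set as"
| "bn (InA M N) = {}"
| "bn TauA = {}"

text \<open>The rule \<open>Alpha\<close> identifies action-derivative pairs up to renaming of the bound names of
  the action, which bind into the object and the derivative. The subject is outside the scope of
  these names, and as usual the bound names are kept apart from it.\<close>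

inductive psi_trans :: "agent \<Rightarrow> name act \<Rightarrow> agent \<Rightarrow> bool" where
  In: "entails One (chan_eq M K) \<Longrightarrow> Ls \<in> matches N ys X \<Longrightarrow>
    psi_trans (In M ys X P) (InA K N) (sub (nsub ys Ls) P)"
| Out: "entails One (chan_eq M K) \<Longrightarrow> psi_trans (Out M N P) (OutA K [] N) P"
| ComL: "psi_trans P (OutA M as N) P' \<Longrightarrow> psi_trans Q (InA K N) Q' \<Longrightarrow> entails One (chan_eq M K) \<Longrightarrow>
    set as \<inter> fn Q = {} \<Longrightarrow> psi_trans (Par P Q) TauA (Ress as (Par P' Q'))"
| ComR: "psi_trans P (InA K N) P' \<Longrightarrow> psi_trans Q (OutA M as N) Q' \<Longrightarrow> entails One (chan_eq M K) \<Longrightarrow>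
    set as \<inter> fn P = {} \<Longrightarrow> psi_trans (Par P Q) TauA (Ress as (Par P' Q'))"
| ParL: "psi_trans P \<alpha> P' \<Longrightarrow> bn \<alpha> \<inter> fn Q = {} \<Longrightarrow> psi_trans (Par P Q) \<alpha> (Par P' Q)"
| ParR: "psi_trans Q \<alpha> Q' \<Longrightarrow> bn \<alpha> \<inter> fn P = {} \<Longrightarrow> psi_trans (Par P Q) \<alpha> (Par P Q')"
| Case: "(\<phi>, P) \<in> set bs \<Longrightarrow> psi_trans P \<alpha> P' \<Longrightarrow> entails One \<phi> \<Longrightarrow> psi_trans (Case bs) \<alpha> P'"
| Rep: "psi_trans (Par P (Bang P)) \<alpha> P' \<Longrightarrow> psi_trans (Bang P) \<alpha> P'"
| Scope: "psi_trans P \<alpha> P' \<Longrightarrow> b \<notin> names_act \<alpha> \<Longrightarrow> psi_trans (Res b P) \<alpha> (Res b P')"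
| Open: "psi_trans P (OutA M (as @ as') N) P' \<Longrightarrow> b \<notin> set as \<union> set as' \<union> names_trm M \<Longrightarrow>
    b \<in> names_trm N \<Longrightarrow> psi_trans (Res b P) (OutA M (as @ b # as') N) P'"
| Alpha: "psi_trans P (OutA M as N) P' \<Longrightarrow> length bs = length as \<Longrightarrow> distinct bs \<Longrightarrow>
    set bs \<inter> (names_trm M \<union> (names_trm N \<union> fn P' - set as)) = {} \<Longrightarrow>
    psi_trans P (OutA M bs (ren_trm (nsub as bs) N)) (sub (nsub as bs) P')"

section \<open>Strong bisimulation and its congruence\<close>

definition bisimulation :: "(agent \<Rightarrow> agent \<Rightarrow> bool) \<Rightarrow> bool" where
  "bisimulation R \<longleftrightarrow>
     (\<forall>P Q. R P Q \<longrightarrow> wf_agent P \<and> wf_agent Q \<and> R Q P \<and>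
        (\<forall>\<phi>. entails (frame P) \<phi> \<longleftrightarrow> entails (frame Q) \<phi>) \<and>
        (\<forall>\<alpha> P'. bn \<alpha> \<inter> fn Q = {} \<longrightarrow> psi_trans P \<alpha> P' \<longrightarrow> (\<exists>Q'. psi_trans Q \<alpha> Q' \<and> R P' Q')))"

definition bisimilar :: "agent \<Rightarrow> agent \<Rightarrow> bool" where
  "bisimilar P Q \<longleftrightarrow> (\<exists>R. bisimulation R \<and> R P Q)"

definition sub_seq :: "(name list \<times> name list) list \<Rightarrow> agent \<Rightarrow> agent" where
  "sub_seq \<sigma>s P = fold (\<lambda>(as, bs). sub (nsub as bs)) \<sigma>s P"

definition bisim_cong :: "agent \<Rightarrow> agent \<Rightarrow> bool" where
  "bisim_cong P Q \<longleftrightarrow>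
     (\<forall>\<sigma>s. (\<forall>(as, bs) \<in> set \<sigma>s. distinct as \<and> length as = length bs) \<longrightarrow>
        bisimilar (sub_seq \<sigma>s P) (sub_seq \<sigma>s Q))"

section \<open>Structural congruence\<close>

text \<open>The premises on well-formedness restrict the relation to well-formed agents.\<close>

inductive scong :: "agent \<Rightarrow> agent \<Rightarrow> bool" where
  sc_refl: "wf_agent P \<Longrightarrow> scong P P"
| sc_sym: "scong P Q \<Longrightarrow> scong Q P"
| sc_trans: "scong P Q \<Longrightarrow> scong Q R \<Longrightarrow> scong P R"
| sc_Out: "scong P Q \<Longrightarrow> wf_agent (Out M N P) \<Longrightarrow> wf_agent (Out M N Q) \<Longrightarrow>
    scong (Out M N P) (Out M N Q)"
| sc_In: "scong P Q \<Longrightarrow> wf_agent (In M xs X P) \<Longrightarrow> wf_agent (In M xs X Q) \<Longrightarrow>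
    scong (In M xs X P) (In M xs X Q)"
| sc_Case: "list_all2 (rel_prod (=) scong) bs cs \<Longrightarrow> wf_agent (Case bs) \<Longrightarrow> wf_agent (Case cs) \<Longrightarrow>
    scong (Case bs) (Case cs)"
| sc_Res: "scong P Q \<Longrightarrow> scong (Res a P) (Res a Q)"
| sc_Par: "scong P P' \<Longrightarrow> scong Q Q' \<Longrightarrow> scong (Par P Q) (Par P' Q')"
| sc_Bang: "scong P Q \<Longrightarrow> wf_agent (Bang P) \<Longrightarrow> wf_agent (Bang Q) \<Longrightarrow> scong (Bang P) (Bang Q)"
| sc_Case_Res: "wf_agent (Case bs) \<Longrightarrow> a \<notin> (\<Union>(\<phi>, P) \<in> set bs. names_cond \<phi>) \<Longrightarrow>
    scong (Case (map (\<lambda>(\<phi>, P). (\<phi>, Res a P)) bs)) (Res a (Case bs))"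
| sc_In_Res: "wf_agent (In M xs X P) \<Longrightarrow> a \<notin> set xs \<union> names_trm M \<union> names_pat X \<Longrightarrow>
    scong (In M xs X (Res a P)) (Res a (In M xs X P))"
| sc_Out_Res: "wf_agent (Out M N P) \<Longrightarrow> a \<notin> names_trm M \<union> names_trm N \<Longrightarrow>
    scong (Out M N (Res a P)) (Res a (Out M N P))"
| sc_Par_Res: "wf_agent (Par Q P) \<Longrightarrow> a \<notin> fn Q \<Longrightarrow> scong (Par Q (Res a P)) (Res a (Par Q P))"
| sc_Res_Res: "wf_agent P \<Longrightarrow> scong (Res b (Res a P)) (Res a (Res b P))"
| sc_Unfold: "wf_agent (Bang P) \<Longrightarrow> scong (Bang P) (Par P (Bang P))"
| sc_Assoc: "wf_agent (Par P (Par Q R)) \<Longrightarrow> scong (Par P (Par Q R)) (Par (Par P Q) R)"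
| sc_Comm: "wf_agent (Par P Q) \<Longrightarrow> scong (Par P Q) (Par Q P)"
| sc_Nil: "wf_agent P \<Longrightarrow> scong P (Par P Nil0)"
| sc_Res_Nil: "scong (Res a Nil0) Nil0"

section \<open>Contexts\<close>

text \<open>Contexts are not identified up to alpha-equivalence; their binders capture names of the
  agents put into the holes.\<close>

datatype 'n ctx =
    Hole
  | COut "'n trm" "'n trm" "'n ctx"
  | CIn "'n trm" "'n list" "'n pat" "'n ctx"
  | CCase "('n cond \<times> 'n ctx) list"
  | CRes 'n "'n ctx"
  | CPar "'n ctx" "'n ctx"
  | CBang "'n ctx"
  | CAssert assertion
  for map: ren_ctx

fun holes :: "'n ctx \<Rightarrow> nat" where
  "holes Hole = 1"
| "holes (COut M N C) = holes C"
| "holes (CIn M xs X C) = holes C"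
| "holes (CCase bs) = sum_list (map (\<lambda>(\<phi>, C). holes C) bs)"
| "holes (CRes a C) = holes C"
| "holes (CPar C D) = holes C + holes D"
| "holes (CBang C) = holes C"
| "holes (CAssert \<Psi>) = 0"

text \<open>Meaningful if the number of agents is the number of holes.\<close>

fun fill :: "name ctx \<Rightarrow> agent list \<Rightarrow> agent"
and fill_branches :: "(name cond \<times> name ctx) list \<Rightarrow> agent list \<Rightarrow> (name cond \<times> agent) list" where
  "fill Hole Ps = hd Ps"
| "fill (COut M N C) Ps = Out M N (fill C Ps)"
| "fill (CIn M xs X C) Ps = In M xs X (fill C Ps)"
| "fill (CCase bs) Ps = Case (fill_branches bs Ps)"
| "fill (CRes a C) Ps = Res a (fill C Ps)"
| "fill (CPar C D) Ps = Par (fill C (take (holes C) Ps)) (fill D (drop (holes C) Ps))"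
| "fill (CBang C) Ps = Bang (fill C Ps)"
| "fill (CAssert \<Psi>) Ps = Assert \<Psi>"
| "fill_branches [] Ps = []"
| "fill_branches ((\<phi>, C) # bs) Ps =
     (\<phi>, fill C (take (holes C) Ps)) # fill_branches bs (drop (holes C) Ps)"

definition context_of_arity :: "nat \<Rightarrow> name ctx \<Rightarrow> bool" where
  "context_of_arity k C \<longleftrightarrow> holes C = k \<and> wf_agent (fill C (replicate k Nil0))"

section \<open>Representation of a process calculus in PPI\<close>

text \<open>An element of \<open>constrs\<close> is a process constructor together with its name parameters (for
  instance \<open>x(ys).[]\<close> for given \<open>x\<close> and \<open>ys\<close>). The three swap functions give the action of the
  name swapping on processes, actions and constructors.\<close>

record ('p, 'a, 'f) process_calculus =
  procs :: "'p set"
  swap_proc :: "name \<Rightarrow> name \<Rightarrow> 'p \<Rightarrow> 'p"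
  swap_act :: "name \<Rightarrow> name \<Rightarrow> 'a \<Rightarrow> 'a"
  step :: "'p \<Rightarrow> 'a \<Rightarrow> 'p \<Rightarrow> bool"
  constrs :: "'f set"
  swap_constr :: "name \<Rightarrow> name \<Rightarrow> 'f \<Rightarrow> 'f"
  arity :: "'f \<Rightarrow> nat"
  build :: "'f \<Rightarrow> 'p list \<Rightarrow> 'p"

definition representation_by ::
  "('p, 'a, 'f) process_calculus \<Rightarrow> ('p \<Rightarrow> agent) \<Rightarrow> ('a \<Rightarrow> name act \<Rightarrow> bool) \<Rightarrow> bool" where
  "representation_by K enc rel \<longleftrightarrow>
     (\<forall>P \<in> procs K. wf_agent (enc P)) \<and>
     (\<forall>a b. \<forall>P \<in> procs K. enc (swap_proc K a b P) = swap_agent a b (enc P)) \<and>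
     (\<forall>a b \<beta> \<alpha>. rel \<beta> \<alpha> \<longrightarrow> rel (swap_act K a b \<beta>) (ren_act (swp a b) \<alpha>)) \<and>
     (\<exists>C. (\<forall>f \<in> constrs K. context_of_arity (arity K f) (C f) \<and>
             (\<forall>a b. C (swap_constr K a b f) = ren_ctx (swp a b) (C f)) \<and>
             (\<forall>Ps. length Ps = arity K f \<longrightarrow> set Ps \<subseteq> procs K \<longrightarrow>
                enc (build K f Ps) = fill (C f) (map enc Ps)))) \<and>
     (\<forall>P \<in> procs K. \<forall>\<beta>. \<forall>P' \<in> procs K. step K P \<beta> P' \<longrightarrow>
        (\<exists>\<alpha> Q. psi_trans (enc P) \<alpha> Q \<and> scong (enc P') Q \<and> rel \<beta> \<alpha>)) \<and>
     (\<forall>P \<in> procs K. \<forall>\<alpha> Q. psi_trans (enc P) \<alpha> Q \<longrightarrow>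
        (\<exists>\<beta>. \<exists>P' \<in> procs K. step K P \<beta> P' \<and> scong (enc P') Q \<and> rel \<beta> \<alpha>))"

definition PPI_completely_represents :: "('p, 'a, 'f) process_calculus \<Rightarrow> bool" where
  "PPI_completely_represents K \<longleftrightarrow>
     (\<exists>enc rel. representation_by K enc rel \<and>
        (\<forall>P. wf_agent P \<longrightarrow> (\<exists>Q \<in> procs K. bisim_cong P (enc Q))))"

section \<open>The polyadic pi-calculus\<close>

datatype 'n praw =
    QNil
  | QIn 'n "'n list" "'n praw"
  | QOut 'n "'n list" "'n praw"
  | QMatch 'n 'n "'n praw"
  | QRes 'n "'n praw"
  | QBang "'n praw"
  | QPar "'n praw" "'n praw"
  | QSum "'n praw" "'n praw"
  for map: ren_praw

fun fn_praw :: "name praw \<Rightarrow> name set" where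
  "fn_praw QNil = {}"
| "fn_praw (QIn x ys P) = {x} \<union> (fn_praw P - set ys)"
| "fn_praw (QOut x ys P) = {x} \<union> set ys \<union> fn_praw P"
| "fn_praw (QMatch a b P) = {a, b} \<union> fn_praw P"
| "fn_praw (QRes x P) = fn_praw P - {x}"
| "fn_praw (QBang P) = fn_praw P"
| "fn_praw (QPar P Q) = fn_praw P \<union> fn_praw Q"
| "fn_praw (QSum P Q) = fn_praw P \<union> fn_praw Q"

inductive palpha :: "name praw \<Rightarrow> name praw \<Rightarrow> bool" where
  palpha_refl: "palpha P P"
| palpha_sym: "palpha P Q \<Longrightarrow> palpha Q P"
| palpha_trans: "palpha P Q \<Longrightarrow> palpha Q R \<Longrightarrow> palpha P R"
| palpha_ren_res: "b \<notin> fn_praw P \<Longrightarrow> palpha (QRes a P) (QRes b (ren_praw (swp a b) P))"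
| palpha_ren_in: "a \<in> set ys \<Longrightarrow> b \<notin> set ys \<union> fn_praw P \<Longrightarrow>
    palpha (QIn x ys P) (QIn x (map (swp a b) ys) (ren_praw (swp a b) P))"
| palpha_in: "palpha P Q \<Longrightarrow> palpha (QIn x ys P) (QIn x ys Q)"
| palpha_out: "palpha P Q \<Longrightarrow> palpha (QOut x ys P) (QOut x ys Q)"
| palpha_match: "palpha P Q \<Longrightarrow> palpha (QMatch a b P) (QMatch a b Q)"
| palpha_res: "palpha P Q \<Longrightarrow> palpha (QRes x P) (QRes x Q)"
| palpha_bang: "palpha P Q \<Longrightarrow> palpha (QBang P) (QBang Q)"
| palpha_par: "palpha P P' \<Longrightarrow> palpha Q Q' \<Longrightarrow> palpha (QPar P Q) (QPar P' Q')"
| palpha_sum: "palpha P P' \<Longrightarrow> palpha Q Q' \<Longrightarrow> palpha (QSum P Q) (QSum P' Q')"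

fun wf_praw :: "name praw \<Rightarrow> bool" where
  "wf_praw QNil = True"
| "wf_praw (QIn x ys P) = (distinct ys \<and> wf_praw P)"
| "wf_praw (QOut x ys P) = wf_praw P"
| "wf_praw (QMatch a b P) = wf_praw P"
| "wf_praw (QRes x P) = wf_praw P"
| "wf_praw (QBang P) = wf_praw P"
| "wf_praw (QPar P Q) = (wf_praw P \<and> wf_praw Q)"
| "wf_praw (QSum P Q) = (wf_praw P \<and> wf_praw Q)"

fun sub_praw :: "(name \<Rightarrow> name) \<Rightarrow> name praw \<Rightarrow> name praw" where
  "sub_praw \<sigma> QNil = QNil"
| "sub_praw \<sigma> (QIn x ys P) =
     (let cs = freshs (length ys) (\<sigma> ` (fn_praw P - set ys)); \<tau> = upd \<sigma> ys cs
      in QIn (\<sigma> x) (map \<tau> ys) (sub_praw \<tau> P))"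
| "sub_praw \<sigma> (QOut x ys P) = QOut (\<sigma> x) (map \<sigma> ys) (sub_praw \<sigma> P)"
| "sub_praw \<sigma> (QMatch a b P) = QMatch (\<sigma> a) (\<sigma> b) (sub_praw \<sigma> P)"
| "sub_praw \<sigma> (QRes x P) =
     (let c = fresh (\<sigma> ` (fn_praw P - {x})) in QRes c (sub_praw (\<sigma>(x := c)) P))"
| "sub_praw \<sigma> (QBang P) = QBang (sub_praw \<sigma> P)"
| "sub_praw \<sigma> (QPar P Q) = QPar (sub_praw \<sigma> P) (sub_praw \<sigma> Q)"
| "sub_praw \<sigma> (QSum P Q) = QSum (sub_praw \<sigma> P) (sub_praw \<sigma> Q)"

lemma finite_fn_praw[simp]: "finite (fn_praw P)"
  by (induction P) auto

lemma fn_praw_ren: "inj \<pi> \<Longrightarrow> fn_praw (ren_praw \<pi> P) = \<pi> ` fn_praw P"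
  by (induction P) (simp_all add: image_Un image_set_diff)

lemma fn_praw_palpha: "palpha P Q \<Longrightarrow> fn_praw P = fn_praw Q"
proof (induction rule: palpha.induct)
  case (palpha_ren_res b P a)
  then show ?case by (simp add: fn_praw_ren swp_image_fresh)
next
  case (palpha_ren_in a ys b P x)
  then show ?case
    using swp_image_fresh2[of a "set ys" b "fn_praw P"] by (simp add: fn_praw_ren)
qed auto

lemma wf_praw_ren: "inj \<pi> \<Longrightarrow> wf_praw (ren_praw \<pi> P) = wf_praw P"
  by (induction P) (simp_all add: distinct_map_inj)

lemma wf_praw_palpha: "palpha P Q \<Longrightarrow> wf_praw P = wf_praw Q"
  by (induction rule: palpha.induct)
    (auto simp: wf_praw_ren distinct_map_inj)

lemma ren_praw_swp_comp:
  "ren_praw (swp c d) (ren_praw (swp a b) P) =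
   ren_praw (swp (swp c d a) (swp c d b)) (ren_praw (swp c d) P)"
  by (simp add: praw.map_comp swp_comp[of c d a b])

lemma palpha_swp: "palpha P Q \<Longrightarrow> palpha (ren_praw (swp c d) P) (ren_praw (swp c d) Q)"
proof (induction rule: palpha.induct)
  case (palpha_sym P Q)
  then show ?case by (meson palpha.palpha_sym)
next
  case (palpha_trans P Q R)
  then show ?case by (meson palpha.palpha_trans)
next
  case (palpha_ren_res b P a)
  then show ?case
    using palpha.palpha_ren_res[of "swp c d b" "ren_praw (swp c d) P" "swp c d a"]
    by (simp add: ren_praw_swp_comp[of c d a b] fn_praw_ren inj_image_mem_iff)
next
  case (palpha_ren_in a ys b P x)
  then show ?case
    using palpha.palpha_ren_in[of "swp c d a" "map (swp c d) ys" "swp c d b"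
        "ren_praw (swp c d) P" "swp c d x"]
    by (simp add: ren_praw_swp_comp[of c d a b] map_swp_comp[of c d a b] fn_praw_ren
        inj_image_mem_iff del: map_map)
next
  case (palpha_refl P)
  then show ?case by (simp add: palpha.palpha_refl)
next
  case (palpha_in P Q x ys)
  then show ?case by (simp add: palpha.palpha_in)
next
  case (palpha_out P Q x ys)
  then show ?case by (simp add: palpha.palpha_out)
next
  case (palpha_match P Q a b)
  then show ?case by (simp add: palpha.palpha_match)
next
  case (palpha_res P Q x)
  then show ?case by (simp add: palpha.palpha_res)
next
  case (palpha_bang P Q)
  then show ?case by (simp add: palpha.palpha_bang)
next
  case (palpha_par P P' Q Q')
  then show ?case by (simp add: palpha.palpha_par)
next
  case (palpha_sum P P' Q Q')
  then show ?case by (simp add: palpha.palpha_sum)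
qed

lemma sub_praw_cong: "(\<And>x. x \<in> fn_praw P \<Longrightarrow> \<sigma> x = \<tau> x) \<Longrightarrow> sub_praw \<sigma> P = sub_praw \<tau> P"
proof (induction P arbitrary: \<sigma> \<tau>)
  case (QIn x ys P)
  let ?A = "fn_praw P - set ys"
  have A: "\<sigma> ` ?A = \<tau> ` ?A" using QIn.prems by (intro image_cong) auto
  define cs where "cs = freshs (length ys) (\<tau> ` ?A)"
  have len: "length cs = length ys" unfolding cs_def by (simp add: freshs_props)
  have u: "upd \<sigma> ys cs z = upd \<tau> ys cs z" if "z \<in> fn_praw P \<union> set ys" for z
    using that QIn.prems by (intro upd_cong) (auto simp: len)
  have "sub_praw (upd \<sigma> ys cs) P = sub_praw (upd \<tau> ys cs) P" by (rule QIn.IH) (simp add: u)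
  moreover have "map (upd \<sigma> ys cs) ys = map (upd \<tau> ys cs) ys" by (simp add: u)
  ultimately show ?case using QIn.prems[of x] by (simp add: A Let_def flip: cs_def)
next
  case (QRes a P)
  have A: "\<sigma> ` (fn_praw P - {a}) = \<tau> ` (fn_praw P - {a})"
    using QRes.prems by (intro image_cong) auto
  have "sub_praw (\<sigma>(a := c)) P = sub_praw (\<tau>(a := c)) P" for c
    by (rule QRes.IH) (use QRes.prems in auto)
  then show ?case by (simp add: A Let_def)
next
  case (QOut x ys P)
  have "sub_praw \<sigma> P = sub_praw \<tau> P" by (rule QOut.IH) (simp add: QOut.prems)
  then show ?case by (simp add: QOut.prems)
next
  case (QMatch a b P)
  have "sub_praw \<sigma> P = sub_praw \<tau> P" by (rule QMatch.IH) (simp add: QMatch.prems)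
  then show ?case by (simp add: QMatch.prems)
next
  case (QBang P)
  have "sub_praw \<sigma> P = sub_praw \<tau> P" by (rule QBang.IH) (simp add: QBang.prems)
  then show ?case by (simp add: QBang.prems)
next
  case (QPar P Q)
  have "sub_praw \<sigma> P = sub_praw \<tau> P" by (rule QPar.IH(1)) (simp add: QPar.prems)
  moreover have "sub_praw \<sigma> Q = sub_praw \<tau> Q" by (rule QPar.IH(2)) (simp add: QPar.prems)
  ultimately show ?case by simp
next
  case (QSum P Q)
  have "sub_praw \<sigma> P = sub_praw \<tau> P" by (rule QSum.IH(1)) (simp add: QSum.prems)
  moreover have "sub_praw \<sigma> Q = sub_praw \<tau> Q" by (rule QSum.IH(2)) (simp add: QSum.prems)
  ultimately show ?case by simp
qed simp

lemma sub_praw_ren: "inj \<pi> \<Longrightarrow> sub_praw \<sigma> (ren_praw \<pi> P) = sub_praw (\<sigma> \<circ> \<pi>) P"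
proof (induction P arbitrary: \<sigma>)
  case (QIn x ys P)
  have "\<sigma> ` (fn_praw (ren_praw \<pi> P) - set (map \<pi> ys)) = (\<sigma> \<circ> \<pi>) ` (fn_praw P - set ys)"
    using QIn.prems
    by (simp add: fn_praw_ren image_set_diff[symmetric] image_image)
  moreover have "upd \<sigma> (map \<pi> ys) cs (\<pi> z) = upd (\<lambda>a. \<sigma> (\<pi> a)) ys cs z" for cs z
    using QIn.prems by (simp add: upd_map_inj comp_def)
  ultimately show ?case using QIn by (simp add: Let_def comp_def)
next
  case (QRes a P)
  have "\<sigma> ` (fn_praw (ren_praw \<pi> P) - {\<pi> a}) = (\<sigma> \<circ> \<pi>) ` (fn_praw P - {a})"
    using image_set_diff[OF QRes.prems, of "fn_praw P" "{a}"]
    by (simp only: fn_praw_ren[OF QRes.prems] image_insert image_empty flip: image_comp)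
  moreover have "\<sigma>(\<pi> a := c) \<circ> \<pi> = (\<sigma> \<circ> \<pi>)(a := c)" for c
    using QRes.prems by (auto simp: fun_eq_iff inj_eq)
  ultimately show ?case
    by (simp only: praw.map sub_praw.simps Let_def QRes.IH[OF QRes.prems])
qed auto

lemma sub_praw_palpha: "palpha P Q \<Longrightarrow> palpha (sub_praw \<sigma> P) (sub_praw \<sigma> Q)"
proof (induction arbitrary: \<sigma> rule: palpha.induct)
  case (palpha_sym P Q)
  then show ?case by (meson palpha.palpha_sym)
next
  case (palpha_trans P Q R)
  then show ?case by (meson palpha.palpha_trans)
next
  case (palpha_ren_res b P a)
  have "sub_praw (\<sigma>(b := c)) (ren_praw (swp a b) P) = sub_praw (\<sigma>(a := c)) P" for c
    unfolding sub_praw_ren[OF inj_swp]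
    using palpha_ren_res by (intro sub_praw_cong) (auto simp: Transposition.transpose_def)
  moreover have "fn_praw (ren_praw (swp a b) P) - {b} = fn_praw P - {a}"
    using palpha_ren_res by (simp add: fn_praw_ren swp_image_fresh)
  ultimately show ?case by (simp add: Let_def palpha.palpha_refl)
next
  case (palpha_ren_in a ys b P x)
  let ?\<pi> = "swp a b" and ?A = "fn_praw P"
  have A: "fn_praw (ren_praw ?\<pi> P) - ?\<pi> ` set ys = ?A - set ys"
    using palpha_ren_in swp_image_fresh2[of a "set ys" b ?A] by (simp add: fn_praw_ren)
  define cs where "cs = freshs (length ys) (\<sigma> ` (?A - set ys))"
  have len: "length cs = length ys" unfolding cs_def by (simp add: freshs_props)
  have u: "upd \<sigma> (map ?\<pi> ys) cs (?\<pi> z) = upd \<sigma> ys cs z" if "z \<in> ?A \<union> set ys" for z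
    unfolding upd_map_inj[OF inj_swp] using that palpha_ren_in.hyps
    by (intro upd_cong) (auto simp: len Transposition.transpose_def)
  have "sub_praw (upd \<sigma> (map ?\<pi> ys) cs) (ren_praw ?\<pi> P) = sub_praw (upd \<sigma> ys cs) P"
    unfolding sub_praw_ren[OF inj_swp] by (rule sub_praw_cong) (simp add: u)
  moreover have "map (upd \<sigma> (map ?\<pi> ys) cs) (map ?\<pi> ys) = map (upd \<sigma> ys cs) ys"
    by (simp add: u)
  ultimately have "sub_praw \<sigma> (QIn x (map ?\<pi> ys) (ren_praw ?\<pi> P)) = sub_praw \<sigma> (QIn x ys P)"
    by (simp only: sub_praw.simps Let_def length_map set_map A flip: cs_def)
  then show ?case by (simp only: palpha.palpha_refl)
next
  case (palpha_refl P)
  then show ?case by (simp add: palpha.palpha_refl)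
next
  case (palpha_in P Q x ys)
  then show ?case by (simp add: palpha.palpha_in Let_def fn_praw_palpha)
next
  case (palpha_out P Q x ys)
  then show ?case by (simp add: palpha.palpha_out)
next
  case (palpha_match P Q a b)
  then show ?case by (simp add: palpha.palpha_match)
next
  case (palpha_res P Q x)
  then show ?case by (simp add: palpha.palpha_res Let_def fn_praw_palpha)
next
  case (palpha_bang P Q)
  then show ?case by (simp add: palpha.palpha_bang)
next
  case (palpha_par P P' Q Q')
  then show ?case by (simp add: palpha.palpha_par)
next
  case (palpha_sum P P' Q Q')
  then show ?case by (simp add: palpha.palpha_sum)
qed

lemma equivp_palpha: "equivp palpha"
proof (rule equivpI)
  show "reflp palpha" by (rule reflpI) (rule palpha_refl)
  show "symp palpha" by (rule sympI) (rule palpha_sym)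
  show "transp palpha" by (rule transpI) (rule palpha_trans)
qed

quotient_type pi = "name praw" / palpha
  by (rule equivp_palpha)

lift_definition PNil :: pi is QNil .
lift_definition PIn :: "name \<Rightarrow> name list \<Rightarrow> pi \<Rightarrow> pi" is QIn
  by (rule palpha_in)
lift_definition POut :: "name \<Rightarrow> name list \<Rightarrow> pi \<Rightarrow> pi" is QOut
  by (rule palpha_out)
lift_definition PMatch :: "name \<Rightarrow> name \<Rightarrow> pi \<Rightarrow> pi" is QMatch
  by (rule palpha_match)
lift_definition PRes :: "name \<Rightarrow> pi \<Rightarrow> pi" is QRes
  by (rule palpha_res)
lift_definition PBang :: "pi \<Rightarrow> pi" is QBang
  by (rule palpha_bang)
lift_definition PPar :: "pi \<Rightarrow> pi \<Rightarrow> pi" is QPar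
  by (rule palpha_par)
lift_definition PSum :: "pi \<Rightarrow> pi \<Rightarrow> pi" is QSum
  by (rule palpha_sum)

definition PRess :: "name list \<Rightarrow> pi \<Rightarrow> pi" where
  "PRess xs P = foldr PRes xs P"

lift_definition fn_pi :: "pi \<Rightarrow> name set" is fn_praw
  by (rule fn_praw_palpha)
lift_definition wf_pi :: "pi \<Rightarrow> bool" is wf_praw
  by (rule wf_praw_palpha)
lift_definition swap_pi :: "name \<Rightarrow> name \<Rightarrow> pi \<Rightarrow> pi" is "\<lambda>a b. ren_praw (swp a b)"
  by (rule palpha_swp)
lift_definition sub_pi :: "(name \<Rightarrow> name) \<Rightarrow> pi \<Rightarrow> pi" is sub_praw
  by (rule sub_praw_palpha)

text \<open>\<open>POutA Y z ys\<close> is the output of \<open>ys\<close> on \<open>z\<close> with the set \<open>Y\<close> of bound names, whose order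
  is immaterial.\<close>

datatype pi_act = POutA "name set" name "name list" | PInA name "name list" | PTauA

fun bn_pi :: "pi_act \<Rightarrow> name set" where
  "bn_pi (POutA Y z ys) = Y"
| "bn_pi (PInA x zs) = {}"
| "bn_pi PTauA = {}"

fun names_pi_act :: "pi_act \<Rightarrow> name set" where
  "names_pi_act (POutA Y z ys) = Y \<union> {z} \<union> set ys"
| "names_pi_act (PInA x zs) = {x} \<union> set zs"
| "names_pi_act PTauA = {}"

fun swap_pi_act :: "name \<Rightarrow> name \<Rightarrow> pi_act \<Rightarrow> pi_act" where
  "swap_pi_act a b (POutA Y z ys) = POutA (swp a b ` Y) (swp a b z) (map (swp a b) ys)"
| "swap_pi_act a b (PInA x zs) = PInA (swp a b x) (map (swp a b) zs)"
| "swap_pi_act a b PTauA = PTauA"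

text \<open>As for PPI, the rule \<open>PAlpha\<close> identifies action-derivative pairs up to renaming of the
  bound names of the action, which stay different from the subject.\<close>

inductive pi_trans :: "pi \<Rightarrow> pi_act \<Rightarrow> pi \<Rightarrow> bool" where
  POut: "pi_trans (POut x ys P) (POutA {} x ys) P"
| PIn: "distinct ys \<Longrightarrow> length zs = length ys \<Longrightarrow>
    pi_trans (PIn x ys P) (PInA x zs) (sub_pi (nsub ys zs) P)"
| PSumL: "pi_trans P \<beta> P' \<Longrightarrow> pi_trans (PSum P Q) \<beta> P'"
| PSumR: "pi_trans Q \<beta> Q' \<Longrightarrow> pi_trans (PSum P Q) \<beta> Q'"
| PMatch: "pi_trans P \<beta> P' \<Longrightarrow> pi_trans (PMatch x x P) \<beta> P'"
| PParL: "pi_trans P \<beta> P' \<Longrightarrow> bn_pi \<beta> \<inter> fn_pi Q = {} \<Longrightarrow> pi_trans (PPar P Q) \<beta> (PPar P' Q)"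
| PParR: "pi_trans Q \<beta> Q' \<Longrightarrow> bn_pi \<beta> \<inter> fn_pi P = {} \<Longrightarrow> pi_trans (PPar P Q) \<beta> (PPar P Q')"
| PScope: "pi_trans P \<beta> P' \<Longrightarrow> x \<notin> names_pi_act \<beta> \<Longrightarrow> pi_trans (PRes x P) \<beta> (PRes x P')"
| PRep: "pi_trans (PPar P (PBang P)) \<beta> P' \<Longrightarrow> pi_trans (PBang P) \<beta> P'"
| PComL: "pi_trans P (POutA Y x ys) P' \<Longrightarrow> pi_trans Q (PInA x ys) Q' \<Longrightarrow> Y \<inter> fn_pi Q = {} \<Longrightarrow>
    distinct as \<Longrightarrow> set as = Y \<Longrightarrow> pi_trans (PPar P Q) PTauA (PRess as (PPar P' Q'))"
| PComR: "pi_trans P (PInA x ys) P' \<Longrightarrow> pi_trans Q (POutA Y x ys) Q' \<Longrightarrow> Y \<inter> fn_pi P = {} \<Longrightarrow>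
    distinct as \<Longrightarrow> set as = Y \<Longrightarrow> pi_trans (PPar P Q) PTauA (PRess as (PPar P' Q'))"
| POpen: "pi_trans P (POutA Y z ys) P' \<Longrightarrow> x \<noteq> z \<Longrightarrow> x \<in> set ys - Y \<Longrightarrow>
    pi_trans (PRes x P) (POutA (insert x Y) z ys) P'"
| PAlpha: "pi_trans P (POutA Y z ys) P' \<Longrightarrow> distinct as \<Longrightarrow> set as = Y \<Longrightarrow>
    length bs = length as \<Longrightarrow> distinct bs \<Longrightarrow> set bs \<inter> ({z} \<union> (set ys \<union> fn_pi P' - Y)) = {} \<Longrightarrow>
    pi_trans P (POutA (set bs) z (map (nsub as bs) ys)) (sub_pi (nsub as bs) P')"

datatype 'n pi_constr =
  KNil | KIn 'n "'n list" | KOut 'n "'n list" | KMatch 'n 'n | KRes 'n | KBang | KPar | KSum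
  for map: ren_pi_constr

fun wf_pi_constr :: "name pi_constr \<Rightarrow> bool" where
  "wf_pi_constr (KIn x ys) = distinct ys"
| "wf_pi_constr _ = True"

fun arity_pi :: "name pi_constr \<Rightarrow> nat" where
  "arity_pi KNil = 0"
| "arity_pi (KIn x ys) = 1"
| "arity_pi (KOut x ys) = 1"
| "arity_pi (KMatch a b) = 1"
| "arity_pi (KRes x) = 1"
| "arity_pi KBang = 1"
| "arity_pi KPar = 2"
| "arity_pi KSum = 2"

fun build_pi :: "name pi_constr \<Rightarrow> pi list \<Rightarrow> pi" where
  "build_pi KNil [] = PNil"
| "build_pi (KIn x ys) [P] = PIn x ys P"
| "build_pi (KOut x ys) [P] = POut x ys P"
| "build_pi (KMatch a b) [P] = PMatch a b P"
| "build_pi (KRes x) [P] = PRes x P"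
| "build_pi KBang [P] = PBang P"
| "build_pi KPar [P, Q] = PPar P Q"
| "build_pi KSum [P, Q] = PSum P Q"
| "build_pi _ _ = undefined"

definition polyadic_pi :: "(pi, pi_act, name pi_constr) process_calculus" where
  "polyadic_pi = \<lparr> procs = {P. wf_pi P}, swap_proc = swap_pi, swap_act = swap_pi_act,
     step = pi_trans, constrs = {f. wf_pi_constr f}, swap_constr = (\<lambda>a b. ren_pi_constr (swp a b)),
     arity = arity_pi, build = build_pi \<rparr>"

end

theory Submission
  imports Defs
begin

text \<open>The encoding is homomorphic, with \<open>P + Q\<close> encoded as a case with two true branches and a match
  as a case with one branch. It commutes with substitution, and transitions correspond exactly, so
  that structural congruence is only used reflexively. For completeness every agent is turned into a
  normal form in the range of the encoding: assertions become \<open>0\<close>, the names bound by an input are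
  listed in the order of the pattern, an n-ary case becomes nested binary ones, and a branch that is
  never enabled becomes a deadlocked agent with the same free names. An agent and its normal form have
  literally the same actions, with derivatives that are again an agent and its normal form; since
  normalisation commutes with substitution, this gives bisimulation congruence.

  All reasoning about alpha-equivalence rests on one observation: capture-avoiding substitution on raw
  agents chooses bound names as a function of the free names only, hence it maps alpha-equivalent
  agents to equal ones, and the identity substitution computes canonical representatives.\<close>

text \<open>Agents are alpha-classes, so a premise such as \<open>enc P = Par A B\<close> or
  \<open>norm P = Res a A\<close>, met in an induction on transitions, cannot be inverted by
  datatype injectivity. For the encoding, inversion rests on the range of \<open>enc_raw\<close>
  being closed under alpha-equivalence; for normal forms, on comparing canonical representatives.
  The rule \<open>Alpha\<close> adds a case to each simulation argument, which passes because both
  translations commute with substitution.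

  Free names must be preserved exactly, since the parallel and communication rules compare bound
  names with the free names of the other component and both directions of simulation are needed.
  This is why a branch guarded by \<open>CBot\<close> is not simply deleted. It becomes an output on
  a fresh restricted channel: the body can only act with that channel as subject, and neither
  \<open>Scope\<close> nor \<open>Open\<close> lets such an action through. A match between two free
  names would not do, because a substitution can identify them.\<close>

section \<open>Simultaneous updates of name substitutions\<close>

lemma upd_notin: "x \<notin> set xs \<Longrightarrow> upd \<sigma> xs cs x = \<sigma> x"
  by (auto simp: upd_def split: option.splits dest: map_of_SomeD set_zip_leftD)

lemma upd_nth:
  assumes "distinct xs" "length cs = length xs" "i < length xs"
  shows "upd \<sigma> xs cs (xs ! i) = cs ! i"
  using assms by (simp add: upd_def map_of_zip_nth)

lemma map_upd: "distinct xs \<Longrightarrow> length cs = length xs \<Longrightarrow> map (upd \<sigma> xs cs) xs = cs"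
  by (auto intro!: nth_equalityI simp: upd_nth)

lemma upd_in: "x \<in> set xs \<Longrightarrow> length cs = length xs \<Longrightarrow> upd \<sigma> xs cs x \<in> set cs"
proof -
  assume a: "x \<in> set xs" "length cs = length xs"
  then have "x \<in> dom (map_of (zip xs cs))" by simp
  then obtain c where c: "map_of (zip xs cs) x = Some c" by blast
  then have "c \<in> set cs" by (blast dest: map_of_SomeD set_zip_rightD)
  then show ?thesis by (simp add: upd_def c)
qed

lemma inj_on_upd:
  assumes "distinct cs" "length cs = length xs"
  shows "inj_on (upd \<sigma> xs cs) (set xs)"
proof (rule inj_onI)
  fix x y assume "x \<in> set xs" "y \<in> set xs" and e: "upd \<sigma> xs cs x = upd \<sigma> xs cs y"
  then obtain c where "map_of (zip xs cs) x = Some c" "map_of (zip xs cs) y = Some c"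
    using assms(2) map_of_zip_is_None[of xs cs] by (fastforce simp: upd_def split: option.splits)
  then have "(x, c) \<in> set (zip xs cs)" "(y, c) \<in> set (zip xs cs)" by (auto dest: map_of_SomeD)
  then show "x = y" using assms by (auto simp: set_zip nth_eq_iff_index_eq)
qed

text \<open>Injectivity is asked on the updated names only, because a capture-avoiding renaming is
  injective on its binders but not globally. The base functions may differ, since \<open>x\<close>
  is among the updated names.\<close>

lemma upd_map_inj_on:
  "inj_on \<tau> (set xs) \<Longrightarrow> x \<in> set xs \<Longrightarrow> length cs = length xs \<Longrightarrow>
    upd \<sigma> (map \<tau> xs) cs (\<tau> x) = upd \<sigma>' xs cs x"
proof (induction xs arbitrary: cs)
  case Nil
  then show ?case by simp
next
  case (Cons y ys)
  then obtain d ds where cs: "cs = d # ds" by (cases cs) auto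
  show ?case
  proof (cases "x = y")
    case True
    then show ?thesis by (simp add: cs upd_def)
  next
    case False
    with Cons.prems have "\<tau> x \<noteq> \<tau> y" "x \<in> set ys" unfolding inj_on_def by auto
    then show ?thesis using False Cons by (simp add: cs upd_def)
  qed
qed

text \<open>New binders that avoid the images of the free names capture none of them. This is the
  free-name computation for an input under substitution.\<close>

lemma image_upd_fresh:
  assumes "length cs = length xs" "set cs \<inter> \<sigma> ` (A - set xs) = {}"
  shows "upd \<sigma> xs cs ` A - upd \<sigma> xs cs ` set xs = \<sigma> ` (A - set xs)"
  using assms upd_in[of _ xs cs \<sigma>] by (force simp: upd_notin)

section \<open>Substitution computes canonical representatives\<close>

lemma fn_sub_raw: "fn_raw (sub_raw \<sigma> P) = \<sigma> ` fn_raw P"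
proof (induction P arbitrary: \<sigma>)
  case (RIn M xs X P)
  define cs where "cs = freshs (length xs) (\<sigma> ` (names_pat X \<union> fn_raw P - set xs))"
  have "length cs = length xs" "set cs \<inter> \<sigma> ` (names_pat X \<union> fn_raw P - set xs) = {}"
    unfolding cs_def using freshs_props[of "\<sigma> ` (names_pat X \<union> fn_raw P - set xs)"] by auto
  from image_upd_fresh[OF this] show ?case
    by (simp add: Let_def RIn trm.set_map pat.set_map image_Un flip: cs_def)
next
  case (RCase bs)
  have "names_cond (ren_cond \<sigma> \<phi>) \<union> fn_raw (sub_raw \<sigma> P) = \<sigma> ` (names_cond \<phi> \<union> fn_raw P)"
    if "(\<phi>, P) \<in> set bs" for \<phi> P
    using RCase[OF that] by (simp add: cond.set_map image_Un)
  then show ?case by (simp add: split_beta image_UN)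
next
  case (RRes a P)
  define c where "c = fresh (\<sigma> ` (fn_raw P - {a}))"
  have "c \<notin> \<sigma> ` (fn_raw P - {a})" unfolding c_def by (rule fresh_prop) simp
  then show ?case by (auto simp: Let_def RRes simp flip: c_def)
qed (auto simp: trm.set_map)

text \<open>This is an equality, not just alpha-equivalence: the binders chosen by the outer pass
  depend only on the image of the free names under \<open>\<sigma> \<circ> \<tau>\<close>, and they
  overwrite the intermediate ones, which are injectively chosen and clash with no free name.\<close>

lemma sub_raw_comp: "sub_raw \<sigma> (sub_raw \<tau> P) = sub_raw (\<sigma> \<circ> \<tau>) P"
proof (induction P arbitrary: \<sigma> \<tau>)
  case (RIn M xs X P)
  let ?A = "names_pat X \<union> fn_raw P"
  define cs where "cs = freshs (length xs) (\<tau> ` (?A - set xs))"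
  have cs: "length cs = length xs" "distinct cs" "set cs \<inter> \<tau> ` (?A - set xs) = {}"
    unfolding cs_def using freshs_props[of "\<tau> ` (?A - set xs)"] by auto
  let ?\<tau> = "upd \<tau> xs cs"
  have A: "?\<tau> ` names_pat X \<union> ?\<tau> ` fn_raw P - ?\<tau> ` set xs = \<tau> ` (?A - set xs)"
    using image_upd_fresh[OF cs(1,3)] by (simp add: image_Un)
  define ds where "ds = freshs (length xs) ((\<sigma> \<circ> \<tau>) ` (?A - set xs))"
  have ds: "length ds = length xs" unfolding ds_def by (simp add: freshs_props)
  let ?\<sigma> = "upd \<sigma> (map ?\<tau> xs) ds"
  have u: "?\<sigma> (?\<tau> x) = upd (\<sigma> \<circ> \<tau>) xs ds x" if "x \<in> ?A \<union> set xs" for x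
  proof (cases "x \<in> set xs")
    case True
    then show ?thesis using inj_on_upd[OF cs(2,1), of \<tau>] ds by (simp add: upd_map_inj_on)
  next
    case False
    then have "\<tau> x \<notin> set cs" using that cs(3) by auto
    then have "\<tau> x \<notin> set (map ?\<tau> xs)" using upd_in[OF _ cs(1)] by auto
    then show ?thesis using False by (simp add: upd_notin)
  qed
  have 1: "sub_raw ?\<sigma> (sub_raw ?\<tau> P) = sub_raw (upd (\<sigma> \<circ> \<tau>) xs ds) P"
    unfolding RIn by (rule sub_raw_cong) (simp add: u)
  have 2: "ren_pat ?\<sigma> (ren_pat ?\<tau> X) = ren_pat (upd (\<sigma> \<circ> \<tau>) xs ds) X"
    unfolding pat.map_comp by (rule pat.map_cong0) (simp add: u)
  have 3: "map ?\<sigma> (map ?\<tau> xs) = map (upd (\<sigma> \<circ> \<tau>) xs ds) xs" by (simp add: u)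
  have E: "sub_raw \<tau> (RIn M xs X P) = RIn (ren_trm \<tau> M) (map ?\<tau> xs) (ren_pat ?\<tau> X) (sub_raw ?\<tau> P)"
    by (simp add: Let_def flip: cs_def)
  have "sub_raw \<sigma> (sub_raw \<tau> (RIn M xs X P)) = RIn (ren_trm \<sigma> (ren_trm \<tau> M)) (map ?\<sigma> (map ?\<tau> xs))
      (ren_pat ?\<sigma> (ren_pat ?\<tau> X)) (sub_raw ?\<sigma> (sub_raw ?\<tau> P))"
    unfolding E by (simp add: Let_def fn_sub_raw pat.set_map A ds_def image_comp)
  also have "\<dots> = sub_raw (\<sigma> \<circ> \<tau>) (RIn M xs X P)"
    by (simp only: 1 2 3 sub_raw.simps Let_def trm.map_comp flip: ds_def)
  finally show ?case .
next
  case (RRes a P)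
  define c where "c = fresh (\<tau> ` (fn_raw P - {a}))"
  have c: "c \<notin> \<tau> ` (fn_raw P - {a})" unfolding c_def by (rule fresh_prop) simp
  have A: "\<tau>(a := c) ` fn_raw P - {c} = \<tau> ` (fn_raw P - {a})" using c by auto
  define d where "d = fresh (\<sigma> ` \<tau> ` (fn_raw P - {a}))"
  have "sub_raw (\<sigma>(c := d)) (sub_raw (\<tau>(a := c)) P) = sub_raw ((\<sigma> \<circ> \<tau>)(a := d)) P"
    unfolding RRes by (rule sub_raw_cong) (use c in auto)
  moreover have "d = fresh ((\<sigma> \<circ> \<tau>) ` (fn_raw P - {a}))" by (simp add: d_def image_comp)
  ultimately show ?case by (simp only: sub_raw.simps Let_def fn_sub_raw A flip: c_def d_def)
qed (auto simp: trm.map_comp cond.map_comp comp_def)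

lemma sub_raw_alpha_eq: "alpha P Q \<Longrightarrow> sub_raw \<sigma> P = sub_raw \<sigma> Q"
proof (induction arbitrary: \<sigma> rule: alpha.induct)
  case (alpha_ren_res b P a)
  have "sub_raw (\<sigma>(b := c)) (ren_raw (swp a b) P) = sub_raw (\<sigma>(a := c)) P" for c
    unfolding sub_raw_ren[OF inj_swp]
    using alpha_ren_res by (intro sub_raw_cong) (auto simp: Transposition.transpose_def)
  moreover have "fn_raw (ren_raw (swp a b) P) - {b} = fn_raw P - {a}"
    using alpha_ren_res by (simp add: fn_raw_ren swp_image_fresh)
  ultimately show ?case by (simp add: Let_def)
next
  case (alpha_ren_in a xs b X P M)
  let ?\<pi> = "swp a b" and ?A = "names_pat X \<union> fn_raw P"
  have A: "names_pat (ren_pat ?\<pi> X) \<union> fn_raw (ren_raw ?\<pi> P) - ?\<pi> ` set xs = ?A - set xs"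
    using alpha_ren_in swp_image_fresh2[of a "set xs" b ?A]
    by (simp add: fn_raw_ren pat.set_map image_Un)
  define cs where "cs = freshs (length xs) (\<sigma> ` (?A - set xs))"
  have len: "length cs = length xs" unfolding cs_def by (simp add: freshs_props)
  have u: "upd \<sigma> (map ?\<pi> xs) cs (?\<pi> x) = upd \<sigma> xs cs x" if "x \<in> ?A \<union> set xs" for x
    unfolding upd_map_inj[OF inj_swp] using that alpha_ren_in.hyps
    by (intro upd_cong) (auto simp: len Transposition.transpose_def)
  have "sub_raw (upd \<sigma> (map ?\<pi> xs) cs) (ren_raw ?\<pi> P) = sub_raw (upd \<sigma> xs cs) P"
    unfolding sub_raw_ren[OF inj_swp] by (rule sub_raw_cong) (simp add: u)
  moreover have "ren_pat (upd \<sigma> (map ?\<pi> xs) cs) (ren_pat ?\<pi> X) = ren_pat (upd \<sigma> xs cs) X"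
    unfolding pat.map_comp by (rule pat.map_cong0) (simp add: u)
  moreover have "map (upd \<sigma> (map ?\<pi> xs) cs) (map ?\<pi> xs) = map (upd \<sigma> xs cs) xs"
    by (simp add: u)
  ultimately show ?case
    by (simp only: sub_raw.simps Let_def length_map set_map A flip: cs_def)
next
  case (alpha_case bs cs)
  then show ?case by (induction rule: list_all2_induct) (auto simp: rel_prod_sel split_beta)
qed (auto simp: Let_def fn_raw_alpha)

text \<open>Measure for showing that the identity substitution stays within the alpha-class. The
  induction hypothesis is applied there to renamed and substituted copies of a body, and both
  operations preserve \<open>height\<close>.\<close>

fun height :: "'n raw \<Rightarrow> nat" where
  "height (ROut M N P) = Suc (height P)"
| "height (RIn M xs X P) = Suc (height P)"
| "height (RCase bs) = Suc (\<Sum>(\<phi>, P) \<leftarrow> bs. height P)"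
| "height (RRes a P) = Suc (height P)"
| "height (RPar P Q) = Suc (height P + height Q)"
| "height (RBang P) = Suc (height P)"
| "height (RAssert \<Psi>) = 0"

lemma height_ren[simp]: "height (ren_raw \<pi> P) = height P"
  by (induction P) (auto simp: split_beta comp_def intro!: arg_cong[where f = sum_list])

lemma height_sub[simp]: "height (sub_raw \<sigma> P) = height P"
  by (induction P arbitrary: \<sigma>)
    (auto simp: Let_def split_beta comp_def intro!: arg_cong[where f = sum_list])

text \<open>The new names avoid the old ones, so that the single renamings provided by
  alpha-equivalence do not interfere.\<close>

lemma alpha_in_rename:
  assumes "distinct as" "set as \<subseteq> set xs" "length ds = length as" "distinct ds"
    "set ds \<inter> (set xs \<union> names_pat X \<union> fn_raw P) = {}"
  obtains \<rho> where "inj \<rho>" "map \<rho> as = ds" "\<And>x. x \<notin> set as \<union> set ds \<Longrightarrow> \<rho> x = x"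
    "alpha (RIn M xs X P) (RIn M (map \<rho> xs) (ren_pat \<rho> X) (ren_raw \<rho> P))"
  using assms
proof (induction as arbitrary: thesis ds xs X P)
  case Nil
  show ?case by (rule Nil(1)[of "\<lambda>x. x"]) (use Nil in \<open>auto simp: pat.map_ident raw.map_ident alpha_refl\<close>)
next
  case (Cons a as)
  from Cons.prems(4) obtain d ds' where ds: "ds = d # ds'" by (cases ds) auto
  let ?\<pi> = "swp a d"
  have ne: "a \<noteq> d" using Cons.prems ds by auto
  have fixed: "map ?\<pi> as = as" "map ?\<pi> ds' = ds'"
    using Cons.prems ds by (auto simp: Transposition.transpose_def intro!: map_idI)
  have disj: "set ds' \<inter> ?\<pi> ` (set xs \<union> names_pat X \<union> fn_raw P) = {}"
    using Cons.prems unfolding ds by (auto simp: Transposition.transpose_def)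
  have sub: "set as \<subseteq> ?\<pi> ` set xs"
    using Cons.prems(3) fixed(1) by (metis image_mono list.set_map set_subset_Cons subset_trans)
  obtain \<rho> where \<rho>: "inj \<rho>" "map \<rho> as = ds'" "\<And>x. x \<notin> set as \<union> set ds' \<Longrightarrow> \<rho> x = x"
    "alpha (RIn M (map ?\<pi> xs) (ren_pat ?\<pi> X) (ren_raw ?\<pi> P)) (RIn M (map \<rho> (map ?\<pi> xs))
      (ren_pat \<rho> (ren_pat ?\<pi> X)) (ren_raw \<rho> (ren_raw ?\<pi> P)))"
    by (rule Cons.IH[of ds' "map ?\<pi> xs" "ren_pat ?\<pi> X" "ren_raw ?\<pi> P"])
      (use Cons.prems(2,4,5) ds disj sub in \<open>simp_all add: fn_raw_ren pat.set_map image_Un\<close>)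
  have 1: "alpha (RIn M xs X P) (RIn M (map ?\<pi> xs) (ren_pat ?\<pi> X) (ren_raw ?\<pi> P))"
    by (rule alpha_ren_in) (use Cons.prems ds in auto)
  have d: "\<rho> d = d" using \<rho>(3) Cons.prems ds by auto
  show ?case
  proof (rule Cons.prems(1))
    show "inj (\<rho> \<circ> ?\<pi>)" using \<rho>(1) by (simp add: inj_compose)
    show "map (\<rho> \<circ> ?\<pi>) (a # as) = ds" using \<rho>(2) d fixed(1) ds by (simp flip: map_map)
    show "(\<rho> \<circ> ?\<pi>) x = x" if "x \<notin> set (a # as) \<union> set ds" for x
      using that \<rho>(3) ds by (auto simp: Transposition.transpose_def)
    show "alpha (RIn M xs X P)
      (RIn M (map (\<rho> \<circ> ?\<pi>) xs) (ren_pat (\<rho> \<circ> ?\<pi>) X) (ren_raw (\<rho> \<circ> ?\<pi>) P))"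
      using alpha_trans[OF 1 \<rho>(4)] by (simp add: pat.map_comp raw.map_comp)
  qed
qed

text \<open>The chosen names \<open>cs\<close> may overlap the old binders \<open>xs\<close>, so
  \<open>xs\<close> cannot be renamed to \<open>cs\<close> directly. Both inputs are instead renamed
  to a third list \<open>ds\<close> that avoids all names in sight; the induction hypothesis then
  connects the two bodies.\<close>

lemma alpha_sub_id: "alpha P (sub_raw (\<lambda>x. x) P)"
proof (induction P rule: measure_induct_rule[where f = height])
  case (less P)
  show ?case
  proof (cases P)
    case (RIn M xs X Q)
    let ?A = "names_pat X \<union> fn_raw Q"
    define cs where "cs = freshs (length xs) (?A - set xs)"
    have cs: "length cs = length xs" "distinct cs" "set cs \<inter> (?A - set xs) = {}"
      unfolding cs_def using freshs_props[of "?A - set xs"] by auto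
    define \<tau> where "\<tau> = nsub xs cs"
    have inj: "inj_on \<tau> (set xs)" unfolding \<tau>_def by (rule inj_on_upd[OF cs(2,1)])
    have \<tau>: "\<tau> x = x" if "x \<notin> set xs" for x using that by (simp add: \<tau>_def upd_notin)
    have \<tau>x: "\<tau> ` set xs \<subseteq> set cs" using upd_in[OF _ cs(1)] by (auto simp: \<tau>_def)
    have sub: "sub_raw (\<lambda>x. x) P = RIn M (map \<tau> xs) (ren_pat \<tau> X) (sub_raw \<tau> Q)"
      by (simp add: RIn Let_def \<tau>_def cs_def trm.map_ident)
    \<comment> \<open>A raw input may repeat a binder, while the renaming to \<open>ds\<close> needs
      each binder once.\<close>
    define as where "as = remdups xs"
    define ds where "ds = freshs (length as) (set xs \<union> ?A \<union> set cs)"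
    have ds: "length ds = length as" "distinct ds" "set ds \<inter> (set xs \<union> ?A \<union> set cs) = {}"
      unfolding ds_def using freshs_props[of "set xs \<union> ?A \<union> set cs"] by auto
    obtain \<rho> where \<rho>: "inj \<rho>" "map \<rho> as = ds" "\<And>x. x \<notin> set as \<union> set ds \<Longrightarrow> \<rho> x = x"
      "alpha (RIn M xs X Q) (RIn M (map \<rho> xs) (ren_pat \<rho> X) (ren_raw \<rho> Q))"
      by (rule alpha_in_rename[of as xs ds X Q M]) (use ds in \<open>auto simp: as_def\<close>)
    have "\<tau> ` ?A \<subseteq> set cs \<union> ?A" using \<tau> \<tau>x by force
    then have disj: "set ds \<inter> (\<tau> ` set xs \<union> \<tau> ` ?A) = {}" using ds(3) \<tau>x by blast
    then obtain \<kappa> where \<kappa>: "inj \<kappa>" "map \<kappa> (map \<tau> as) = ds"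
        "\<And>x. x \<notin> set (map \<tau> as) \<union> set ds \<Longrightarrow> \<kappa> x = x"
      "alpha (RIn M (map \<tau> xs) (ren_pat \<tau> X) (sub_raw \<tau> Q)) (RIn M (map \<kappa> (map \<tau> xs))
         (ren_pat \<kappa> (ren_pat \<tau> X)) (ren_raw \<kappa> (sub_raw \<tau> Q)))"
      by - (rule alpha_in_rename[of "map \<tau> as" "map \<tau> xs" ds "ren_pat \<tau> X" "sub_raw \<tau> Q" M],
        use ds inj in \<open>auto simp: as_def distinct_map fn_sub_raw pat.set_map\<close>)
    have eq: "\<kappa> (\<tau> x) = \<rho> x" if "x \<in> ?A \<union> set xs" for x
    proof (cases "x \<in> set xs")
      case True
      have "map (\<kappa> \<circ> \<tau>) as = map \<rho> as" using \<kappa>(2) \<rho>(2) by simp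
      then show ?thesis using True by (simp add: as_def)
    next
      case False
      then have "x \<notin> set cs" using that cs(3) by auto
      then have "x \<notin> set (map \<tau> as) \<union> set ds" using \<tau>x ds(3) that by (auto simp: as_def)
      then show ?thesis using False \<kappa>(3) \<rho>(3) \<tau> by (auto simp: as_def)
    qed
    \<comment> \<open>On the relevant names \<open>\<kappa> \<circ> \<tau>\<close> and
      \<open>\<rho>\<close> agree, so both renamed bodies have the canonical representative
      \<open>sub_raw \<rho> Q\<close>.\<close>
    have "alpha (ren_raw \<kappa> (sub_raw \<tau> Q)) (sub_raw (\<lambda>x. x) (ren_raw \<kappa> (sub_raw \<tau> Q)))"
      by (rule less) (simp add: RIn)
    also have "sub_raw (\<lambda>x. x) (ren_raw \<kappa> (sub_raw \<tau> Q)) = sub_raw \<rho> Q"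
      unfolding sub_raw_ren[OF \<kappa>(1)] sub_raw_comp by (rule sub_raw_cong) (simp add: eq)
    also have "sub_raw \<rho> Q = sub_raw (\<lambda>x. x) (ren_raw \<rho> Q)"
      unfolding sub_raw_ren[OF \<rho>(1)] by (simp add: comp_def)
    finally have "alpha (ren_raw \<kappa> (sub_raw \<tau> Q)) (ren_raw \<rho> Q)"
      using less[of "ren_raw \<rho> Q"] by (auto simp: RIn intro: alpha_trans alpha_sym)
    then have "alpha (RIn M (map \<rho> xs) (ren_pat \<rho> X) (ren_raw \<kappa> (sub_raw \<tau> Q)))
        (RIn M (map \<rho> xs) (ren_pat \<rho> X) (ren_raw \<rho> Q))"
      by (rule alpha_in)
    moreover have "ren_pat \<kappa> (ren_pat \<tau> X) = ren_pat \<rho> X"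
      unfolding pat.map_comp by (rule pat.map_cong0) (simp add: eq)
    moreover have "map \<kappa> (map \<tau> xs) = map \<rho> xs" by (simp add: eq)
    ultimately have "alpha (RIn M (map \<tau> xs) (ren_pat \<tau> X) (sub_raw \<tau> Q))
        (RIn M (map \<rho> xs) (ren_pat \<rho> X) (ren_raw \<rho> Q))"
      using \<kappa>(4) by (simp only:) (rule alpha_trans)
    then show ?thesis
      unfolding RIn sub[unfolded RIn] by (rule alpha_trans[OF \<rho>(4) alpha_sym])
  next
    case (RRes a Q)
    define c where "c = fresh (fn_raw Q - {a})"
    have c: "c \<notin> fn_raw Q - {a}" unfolding c_def by (rule fresh_prop) simp
    have sub: "sub_raw (\<lambda>x. x) P = RRes c (sub_raw ((\<lambda>x. x)(a := c)) Q)"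
      by (simp add: RRes Let_def c_def)
    have "alpha (ren_raw (swp a c) Q) (sub_raw (\<lambda>x. x) (ren_raw (swp a c) Q))"
      by (rule less) (simp add: RRes)
    also have "sub_raw (\<lambda>x. x) (ren_raw (swp a c) Q) = sub_raw ((\<lambda>x. x)(a := c)) Q"
      unfolding sub_raw_ren[OF inj_swp] using c
      by (intro sub_raw_cong) (auto simp: Transposition.transpose_def)
    finally have 1: "alpha (RRes c (ren_raw (swp a c) Q)) (sub_raw (\<lambda>x. x) P)"
      unfolding sub by (rule alpha_res)
    have "alpha P (RRes c (ren_raw (swp a c) Q))"
    proof (cases "c = a")
      case True
      then show ?thesis by (simp add: RRes raw.map_id alpha_refl)
    next
      case False
      then show ?thesis using c unfolding RRes by (intro alpha_ren_res) auto
    qed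
    then show ?thesis using 1 by (rule alpha_trans)
  next
    case (RCase bs)
    have "alpha Q (sub_raw (\<lambda>x. x) Q)" if "(\<phi>, Q) \<in> set bs" for \<phi> Q
    proof (rule less)
      from that have "height Q \<le> (\<Sum>(\<phi>, P) \<leftarrow> bs. height P)"
        by (intro member_le_sum_list) (force, simp)
      then show "height Q < height P" by (simp add: RCase)
    qed
    then show ?thesis
      by (auto simp: RCase cond.map_ident list_all2_conv_all_nth set_conv_nth split_beta
          rel_prod_sel intro!: alpha_case) (metis prod.collapse)
  qed (simp_all add: less trm.map_ident alpha_out alpha_par alpha_bang alpha_refl)
qed

lemma alpha_iff_sub: "alpha P Q \<longleftrightarrow> sub_raw (\<lambda>x. x) P = sub_raw (\<lambda>x. x) Q"
  using sub_raw_alpha_eq alpha_sub_id by (metis alpha_sym alpha_trans)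

section \<open>The encoding of the pi-calculus\<close>

text \<open>The binder list of an encoded input is the tuple of its pattern, so a match returns the
  received tuple itself, as in the pi-calculus.\<close>

fun enc_raw :: "'n praw \<Rightarrow> 'n raw" where
  "enc_raw QNil = RCase []"
| "enc_raw (QIn x ys P) = RIn (Nm x) ys (PTup ys) (enc_raw P)"
| "enc_raw (QOut x ys P) = ROut (Nm x) (Tup ys) (enc_raw P)"
| "enc_raw (QMatch a b P) = RCase [(CEq a b, enc_raw P)]"
| "enc_raw (QRes x P) = RRes x (enc_raw P)"
| "enc_raw (QBang P) = RBang (enc_raw P)"
| "enc_raw (QPar P Q) = RPar (enc_raw P) (enc_raw Q)"
| "enc_raw (QSum P Q) = RCase [(CTop, enc_raw P), (CTop, enc_raw Q)]"

lemma fn_enc_raw[simp]: "fn_raw (enc_raw P) = fn_praw P"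
  by (induction P) auto

lemma noassert_enc_raw[simp]: "noassert_raw (enc_raw P)"
  by (induction P) auto

lemma wf_enc_raw[simp]: "wf_raw (enc_raw P) = wf_praw P"
  by (induction P) (auto simp: can_send_def can_receive_def)

lemma ren_enc_raw: "ren_raw \<pi> (enc_raw P) = enc_raw (ren_praw \<pi> P)"
  by (induction P) auto

lemma sub_enc_raw: "sub_raw \<sigma> (enc_raw P) = enc_raw (sub_praw \<sigma> P)"
  by (induction P arbitrary: \<sigma>) (auto simp: Let_def Un_Diff)

text \<open>A swapping is its own inverse. This pulls membership in the range of the encoding back
  through the renamings of \<open>alpha\<close>.\<close>

lemma enc_raw_swp_iff: "ren_raw (swp a b) R = enc_raw P \<longleftrightarrow> R = enc_raw (ren_praw (swp a b) P)"
  by (metis (no_types) Transposition.transpose_comp_involutory raw.map_comp raw.map_id ren_enc_raw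
      praw.map_comp praw.map_id)

lemma enc_raw_eq_ROut: "enc_raw P = ROut M N R \<longleftrightarrow>
    (\<exists>x ys P'. P = QOut x ys P' \<and> M = Nm x \<and> N = Tup ys \<and> R = enc_raw P')"
  by (cases P) auto

lemma enc_raw_eq_RIn: "enc_raw P = RIn M ys X R \<longleftrightarrow>
    (\<exists>x P'. P = QIn x ys P' \<and> M = Nm x \<and> X = PTup ys \<and> R = enc_raw P')"
  by (cases P) auto

lemma enc_raw_eq_RCase: "enc_raw P = RCase bs \<longleftrightarrow>
    P = QNil \<and> bs = [] \<or> (\<exists>a b P'. P = QMatch a b P' \<and> bs = [(CEq a b, enc_raw P')]) \<or>
    (\<exists>P1 P2. P = QSum P1 P2 \<and> bs = [(CTop, enc_raw P1), (CTop, enc_raw P2)])"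
  by (cases P) auto

lemma enc_raw_eq_RRes: "enc_raw P = RRes a R \<longleftrightarrow> (\<exists>P'. P = QRes a P' \<and> R = enc_raw P')"
  by (cases P) auto

lemma enc_raw_eq_RPar: "enc_raw P = RPar R S \<longleftrightarrow>
    (\<exists>P1 P2. P = QPar P1 P2 \<and> R = enc_raw P1 \<and> S = enc_raw P2)"
  by (cases P) auto

lemma enc_raw_eq_RBang: "enc_raw P = RBang R \<longleftrightarrow> (\<exists>P'. P = QBang P' \<and> R = enc_raw P')"
  by (cases P) auto

lemmas enc_raw_eqs0 = enc_raw_eq_ROut enc_raw_eq_RIn enc_raw_eq_RCase enc_raw_eq_RRes
  enc_raw_eq_RPar enc_raw_eq_RBang
lemmas enc_raw_eqs = enc_raw_eqs0 enc_raw_eqs0[THEN trans[OF eq_commute]]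

lemma enc_raw_inject: "enc_raw P = enc_raw Q \<longleftrightarrow> P = Q"
proof (induction P arbitrary: Q)
  case QNil
  then show ?case by (cases Q) auto
next
  case (QIn x ys P)
  then show ?case by (cases Q) auto
next
  case (QOut x ys P)
  then show ?case by (cases Q) auto
next
  case (QMatch a b P)
  then show ?case by (cases Q) auto
next
  case (QRes a P)
  then show ?case by (cases Q) auto
next
  case (QBang P)
  then show ?case by (cases Q) auto
next
  case (QPar P P')
  then show ?case by (cases Q) auto
next
  case (QSum P P')
  then show ?case by (cases Q) auto
qed

lemma palpha_enc_raw: "palpha P Q \<Longrightarrow> alpha (enc_raw P) (enc_raw Q)"
proof (induction rule: palpha.induct)
  case (palpha_trans P Q R)
  then show ?case by (blast intro: alpha_trans)
next
  case (palpha_ren_res b P a)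
  then show ?case using alpha_ren_res[of b "enc_raw P" a] by (simp add: ren_enc_raw)
next
  case (palpha_ren_in a ys b P x)
  then show ?case
    using alpha_ren_in[of a ys b "PTup ys" "enc_raw P" "Nm x"] by (simp add: ren_enc_raw)
qed (auto intro: alpha.intros)

text \<open>Both directions are needed for the symmetry rule of \<open>alpha\<close>.\<close>

lemma alpha_enc_raw:
  assumes "alpha R S"
  shows "(\<forall>P. R = enc_raw P \<longrightarrow> (\<exists>Q. S = enc_raw Q \<and> palpha P Q)) \<and>
    (\<forall>Q. S = enc_raw Q \<longrightarrow> (\<exists>P. R = enc_raw P \<and> palpha Q P))"
  using assms
proof (induction rule: alpha.induct)
  case (alpha_refl P)
  then show ?case using palpha_refl by blast
next
  case (alpha_sym P Q)
  then show ?case by blast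
next
  case (alpha_trans P Q R)
  show ?case
  proof (intro conjI allI impI)
    fix P' assume "P = enc_raw P'"
    then obtain Q' where "Q = enc_raw Q'" "palpha P' Q'" using alpha_trans.IH(1) by blast
    then show "\<exists>R'. R = enc_raw R' \<and> palpha P' R'" using alpha_trans.IH(2) palpha_trans by blast
  next
    fix R' assume "R = enc_raw R'"
    then obtain Q' where "Q = enc_raw Q'" "palpha R' Q'" using alpha_trans.IH(2) by blast
    then show "\<exists>P'. P = enc_raw P' \<and> palpha R' P'" using alpha_trans.IH(1) palpha_trans by blast
  qed
next
  case (alpha_ren_res b P a)
  have "\<exists>Q. RRes b (ren_raw (swp a b) P) = enc_raw Q \<and> palpha (QRes a P') Q" if "P = enc_raw P'" for P'
    using palpha_ren_res[of b P' a] alpha_ren_res that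
    by (intro exI[of _ "QRes b (ren_praw (swp a b) P')"]) (simp add: ren_enc_raw)
  moreover have "palpha (QRes b Q') (QRes a (ren_praw (swp a b) Q'))"
    if "P = enc_raw (ren_praw (swp a b) Q')" for Q'
    using palpha_ren_res[of b "ren_praw (swp a b) Q'" a] alpha_ren_res that
    by (simp add: praw.map_comp praw.map_id palpha_sym)
  ultimately show ?case
    by (auto simp: enc_raw_eqs enc_raw_swp_iff)
next
  case (alpha_ren_in a xs b X P M)
  have pat: "ren_pat (swp a b) X = PTup (map (swp a b) xs) \<longleftrightarrow> X = PTup xs"
    by (cases X) (auto dest: map_injective)
  show ?case
  proof (intro conjI allI impI)
    fix P' assume "RIn M xs X P = enc_raw P'"
    then obtain x P1 where P': "P' = QIn x xs P1" "M = Nm x" "X = PTup xs" "P = enc_raw P1"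
      by (auto simp: enc_raw_eqs)
    have "palpha P' (QIn x (map (swp a b) xs) (ren_praw (swp a b) P1))"
      unfolding P'(1) using alpha_ren_in P' by (intro palpha_ren_in) auto
    then show "\<exists>Q. RIn M (map (swp a b) xs) (ren_pat (swp a b) X) (ren_raw (swp a b) P) = enc_raw Q
        \<and> palpha P' Q"
      using P' by (intro exI[of _ "QIn x (map (swp a b) xs) (ren_praw (swp a b) P1)"])
        (simp add: ren_enc_raw)
  next
    fix Q' assume "RIn M (map (swp a b) xs) (ren_pat (swp a b) X) (ren_raw (swp a b) P) = enc_raw Q'"
    then obtain x Q1 where Q': "Q' = QIn x (map (swp a b) xs) Q1" "M = Nm x" "X = PTup xs"
      "P = enc_raw (ren_praw (swp a b) Q1)"
      by (auto simp: enc_raw_eqs pat enc_raw_swp_iff)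
    have "palpha (QIn x xs (ren_praw (swp a b) Q1)) Q'"
      using palpha_ren_in[of a xs b "ren_praw (swp a b) Q1" x] alpha_ren_in Q'
      by (simp add: praw.map_comp praw.map_id)
    then show "\<exists>P'. RIn M xs X P = enc_raw P' \<and> palpha Q' P'"
      using Q' by (intro exI[of _ "QIn x xs (ren_praw (swp a b) Q1)"]) (simp add: palpha_sym)
  qed
next
  case (alpha_case bs cs)
  show ?case
  proof (intro conjI allI impI)
    fix P assume "RCase bs = enc_raw P"
    from this[unfolded enc_raw_eqs] show "\<exists>Q. RCase cs = enc_raw Q \<and> palpha P Q"
    proof (elim disjE exE conjE)
      assume "P = QNil" "bs = []"
      then show ?thesis using alpha_case by (auto intro!: exI[of _ QNil] palpha_refl)
    next
      fix a b P' assume P: "P = QMatch a b P'" "bs = [(CEq a b, enc_raw P')]"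
      then obtain Q where "cs = [(CEq a b, enc_raw Q)]" "palpha P' Q"
        using alpha_case by (auto simp: list_all2_Cons1 enc_raw_inject)
      then show ?thesis using P(1) by (intro exI[of _ "QMatch a b Q"]) (simp add: palpha_match)
    next
      fix P1 P2 assume P: "P = QSum P1 P2" "bs = [(CTop, enc_raw P1), (CTop, enc_raw P2)]"
      then obtain Q1 Q2 where "cs = [(CTop, enc_raw Q1), (CTop, enc_raw Q2)]"
        "palpha P1 Q1" "palpha P2 Q2"
        using alpha_case by (auto simp: list_all2_Cons1 enc_raw_inject)
      then show ?thesis using P(1) by (intro exI[of _ "QSum Q1 Q2"]) (simp add: palpha_sum)
    qed
  next
    fix P assume "RCase cs = enc_raw P"
    from this[unfolded enc_raw_eqs] show "\<exists>Q. RCase bs = enc_raw Q \<and> palpha P Q"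
    proof (elim disjE exE conjE)
      assume "P = QNil" "cs = []"
      then show ?thesis using alpha_case by (auto intro!: exI[of _ QNil] palpha_refl)
    next
      fix a b P' assume P: "P = QMatch a b P'" "cs = [(CEq a b, enc_raw P')]"
      then obtain Q where "bs = [(CEq a b, enc_raw Q)]" "palpha P' Q"
        using alpha_case by (auto simp: list_all2_Cons2 enc_raw_inject)
      then show ?thesis using P(1) by (intro exI[of _ "QMatch a b Q"]) (simp add: palpha_match)
    next
      fix P1 P2 assume P: "P = QSum P1 P2" "cs = [(CTop, enc_raw P1), (CTop, enc_raw P2)]"
      then obtain Q1 Q2 where "bs = [(CTop, enc_raw Q1), (CTop, enc_raw Q2)]"
        "palpha P1 Q1" "palpha P2 Q2"
        using alpha_case by (auto simp: list_all2_Cons2 enc_raw_inject)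
      then show ?thesis using P(1) by (intro exI[of _ "QSum Q1 Q2"]) (simp add: palpha_sum)
    qed
  qed
qed (auto simp: enc_raw_eqs enc_raw_inject intro!: palpha_in palpha_out palpha_res palpha_par palpha_bang)

section \<open>The encoding on alpha-classes and its inversion\<close>

lift_definition enc :: "pi \<Rightarrow> agent" is enc_raw
  by (rule palpha_enc_raw)

lemma enc_simps[simp]:
  "enc PNil = Nil0"
  "enc (PIn x ys P) = In (Nm x) ys (PTup ys) (enc P)"
  "enc (POut x ys P) = Out (Nm x) (Tup ys) (enc P)"
  "enc (PMatch a b P) = Case [(CEq a b, enc P)]"
  "enc (PRes x P) = Res x (enc P)"
  "enc (PBang P) = Bang (enc P)"
  "enc (PPar P Q) = Par (enc P) (enc Q)"
  "enc (PSum P Q) = Case [(CTop, enc P), (CTop, enc Q)]"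
  by (transfer; simp add: alpha_refl)+

lemma fn_enc[simp]: "fn (enc P) = fn_pi P"
  by transfer simp

lemma wf_enc[simp]: "wf_agent (enc P) = wf_pi P"
  by transfer simp

lemma swap_enc: "enc (swap_pi a b P) = swap_agent a b (enc P)"
  by transfer (simp add: ren_enc_raw alpha_refl)

lemma sub_enc: "enc (sub_pi \<sigma> P) = sub \<sigma> (enc P)"
  by transfer (simp add: sub_enc_raw alpha_refl)

lemma enc_PRess: "enc (PRess as P) = Ress as (enc P)"
  by (induction as) (simp_all add: PRess_def Ress_def)

text \<open>Since the range of \<open>enc_raw\<close> is closed under alpha-equivalence, every raw
  representative of an encoded process is itself an encoding. This reduces the inversion rules below
  to raw syntax.\<close>

lemma enc_abs_agent:
  assumes "enc P = abs_agent R"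
  obtains Q where "P = abs_pi Q" "R = enc_raw Q"
proof -
  have "alpha (enc_raw (rep_pi P)) R"
    using assms by (metis Quotient3_abs_rep Quotient3_pi agent.abs_eq_iff enc.abs_eq)
  then obtain Q where "R = enc_raw Q" "palpha (rep_pi P) Q" using alpha_enc_raw by blast
  then show ?thesis by (metis Quotient3_abs_rep Quotient3_pi pi.abs_eq_iff that)
qed

lemma agent_abs_cases: obtains R where "A = abs_agent R"
  by (metis Quotient3_abs_rep Quotient3_agent)

lemma enc_eq_In:
  assumes "enc P = In M ys X A"
  obtains x P' where "P = PIn x ys P'" "M = Nm x" "X = PTup ys" "A = enc P'"
proof -
  obtain R where A: "A = abs_agent R" by (rule agent_abs_cases)
  obtain Q where Q: "P = abs_pi Q" "enc_raw Q = RIn M ys X R"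
    using enc_abs_agent[OF assms[unfolded A In.abs_eq]] by metis
  from Q(2) obtain x P' where "Q = QIn x ys P' \<and> M = Nm x \<and> X = PTup ys \<and> R = enc_raw P'"
    by (auto simp: enc_raw_eqs)
  then show thesis using that[of x "abs_pi P'"] by (simp add: A Q(1) enc.abs_eq PIn.abs_eq)
qed

lemma enc_eq_Out:
  assumes "enc P = Out M N A"
  obtains x ys P' where "P = POut x ys P'" "M = Nm x" "N = Tup ys" "A = enc P'"
proof -
  obtain R where A: "A = abs_agent R" by (rule agent_abs_cases)
  obtain Q where Q: "P = abs_pi Q" "enc_raw Q = ROut M N R"
    using enc_abs_agent[OF assms[unfolded A Out.abs_eq]] by metis
  from Q(2) obtain x ys P' where "Q = QOut x ys P' \<and> M = Nm x \<and> N = Tup ys \<and> R = enc_raw P'"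
    by (auto simp: enc_raw_eqs)
  then show thesis using that[of x ys "abs_pi P'"] by (simp add: A Q(1) enc.abs_eq POut.abs_eq)
qed

lemma enc_eq_Res:
  assumes "enc P = Res a A"
  obtains P' where "P = PRes a P'" "A = enc P'"
proof -
  obtain R where A: "A = abs_agent R" by (rule agent_abs_cases)
  obtain Q where Q: "P = abs_pi Q" "enc_raw Q = RRes a R"
    using enc_abs_agent[OF assms[unfolded A Res.abs_eq]] by metis
  from Q(2) obtain P' where "Q = QRes a P' \<and> R = enc_raw P'"
    by (auto simp: enc_raw_eqs)
  then show thesis using that[of "abs_pi P'"] by (simp add: A Q(1) enc.abs_eq PRes.abs_eq)
qed

lemma enc_eq_Bang:
  assumes "enc P = Bang A"
  obtains P' where "P = PBang P'" "A = enc P'"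
proof -
  obtain R where A: "A = abs_agent R" by (rule agent_abs_cases)
  obtain Q where Q: "P = abs_pi Q" "enc_raw Q = RBang R"
    using enc_abs_agent[OF assms[unfolded A Bang.abs_eq]] by metis
  from Q(2) obtain P' where "Q = QBang P' \<and> R = enc_raw P'"
    by (auto simp: enc_raw_eqs)
  then show thesis using that[of "abs_pi P'"] by (simp add: A Q(1) enc.abs_eq PBang.abs_eq)
qed

lemma enc_eq_Par:
  assumes "enc P = Par A B"
  obtains P1 P2 where "P = PPar P1 P2" "A = enc P1" "B = enc P2"
proof -
  obtain R where A: "A = abs_agent R" by (rule agent_abs_cases)
  obtain S where B: "B = abs_agent S" by (rule agent_abs_cases)
  obtain Q where Q: "P = abs_pi Q" "enc_raw Q = RPar R S"
    using enc_abs_agent[OF assms[unfolded A B Par.abs_eq]] by metis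
  from Q(2) obtain P1 P2 where "Q = QPar P1 P2 \<and> R = enc_raw P1 \<and> S = enc_raw P2"
    by (auto simp: enc_raw_eqs)
  then show thesis using that[of "abs_pi P1" "abs_pi P2"]
    by (simp add: A B Q(1) enc.abs_eq PPar.abs_eq)
qed

lemma enc_eq_Case:
  assumes "enc P = Case bs"
  shows "P = PNil \<and> bs = [] \<or> (\<exists>a b P'. P = PMatch a b P' \<and> bs = [(CEq a b, enc P')]) \<or>
    (\<exists>P1 P2. P = PSum P1 P2 \<and> bs = [(CTop, enc P1), (CTop, enc P2)])"
proof -
  \<comment> \<open>Representatives are picked branch by branch, which exhibits
    \<open>Case bs\<close> as the class of a single raw case.\<close>
  let ?rs = "map (map_prod id rep_agent) bs"
  have bs: "bs = map (map_prod id abs_agent) ?rs"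
    using Quotient3_abs_rep[OF Quotient3_agent] by (auto simp: comp_def intro!: map_idI[symmetric])
  have "enc P = abs_agent (RCase ?rs)"
    unfolding assms by (subst (1) bs) (simp only: Case.abs_eq)
  from enc_abs_agent[OF this] obtain Q where Q: "P = abs_pi Q" "RCase ?rs = enc_raw Q" by metis
  from Q(2)[symmetric, unfolded enc_raw_eq_RCase]
  show ?thesis
  proof (elim disjE exE conjE)
    assume "Q = QNil" "?rs = []"
    then show ?thesis by (simp add: Q(1) PNil.abs_eq)
  next
    fix a b Q1 assume q: "Q = QMatch a b Q1" "?rs = [(CEq a b, enc_raw Q1)]"
    have "bs = [(CEq a b, enc (abs_pi Q1))]"
      by (subst bs) (simp only: q(2) enc.abs_eq list.map map_prod_simp id_apply)
    then show ?thesis using q(1) Q(1) PMatch.abs_eq by metis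
  next
    fix Q1 Q2 assume q: "Q = QSum Q1 Q2" "?rs = [(CTop, enc_raw Q1), (CTop, enc_raw Q2)]"
    have "bs = [(CTop, enc (abs_pi Q1)), (CTop, enc (abs_pi Q2))]"
      by (subst bs) (simp only: q(2) enc.abs_eq list.map map_prod_simp id_apply)
    then show ?thesis using q(1) Q(1) PSum.abs_eq by metis
  qed
qed

section \<open>Operational correspondence\<close>

text \<open>An output of the pi-calculus carries a set of bound names, one of PPI a list; it is
  therefore related to every listing without repetitions. Inputs and \<open>\<tau>\<close> have
  exactly one counterpart.\<close>

fun act_rel :: "pi_act \<Rightarrow> name act \<Rightarrow> bool" where
  "act_rel (POutA Y z ys) \<alpha> = (\<exists>as. \<alpha> = OutA (Nm z) as (Tup ys) \<and> distinct as \<and> set as = Y)"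
| "act_rel (PInA x zs) \<alpha> = (\<alpha> = InA (Nm x) (Tup zs))"
| "act_rel PTauA \<alpha> = (\<alpha> = TauA)"

lemma act_rel_names:
  assumes "act_rel \<beta> \<alpha>"
  shows "bn \<alpha> = bn_pi \<beta>" "names_act \<alpha> = names_pi_act \<beta>"
  using assms by (cases \<beta>; auto)+

lemma act_rel_swap: "act_rel \<beta> \<alpha> \<Longrightarrow> act_rel (swap_pi_act a b \<beta>) (ren_act (swp a b) \<alpha>)"
  by (cases \<beta>) (auto simp: distinct_map_inj)

lemma act_rel_OutA: "act_rel \<beta> (OutA M as N) \<longleftrightarrow>
    (\<exists>z ys. \<beta> = POutA (set as) z ys \<and> M = Nm z \<and> N = Tup ys \<and> distinct as)"
  by (cases \<beta>) auto

lemma act_rel_InA: "act_rel \<beta> (InA M N) \<longleftrightarrow> (\<exists>x zs. \<beta> = PInA x zs \<and> M = Nm x \<and> N = Tup zs)"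
  by (cases \<beta>) auto

lemma finite_bn_pi: "pi_trans P \<beta> P' \<Longrightarrow> finite (bn_pi \<beta>)"
  by (induction rule: pi_trans.induct) auto

lemma ex_act_rel: "finite (bn_pi \<beta>) \<Longrightarrow> \<exists>\<alpha>. act_rel \<beta> \<alpha>"
  by (cases \<beta>) (auto dest: finite_distinct_list)

text \<open>A permutation of the new names of a renaming is compensated by the same permutation of
  the old ones. It lets the rule \<open>Alpha\<close> produce any prescribed listing of the new
  bound names; \<open>ds\<close> is \<open>cs\<close> pulled back along the bijection from
  \<open>bs\<close> to \<open>as\<close>.\<close>

lemma nsub_reorder:
  assumes "distinct as" "distinct bs" "length bs = length as" "distinct cs" "set cs = set bs"
  obtains ds where "distinct ds" "set ds = set as" "length cs = length ds" "nsub ds cs = nsub as bs"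
proof
  let ?ds = "map (nsub bs as) cs"
  have inj: "inj_on (nsub bs as) (set bs)" by (rule inj_on_upd) (use assms in auto)
  show "distinct ?ds" using inj assms by (simp add: distinct_map)
  have im: "nsub bs as ` set bs = set as"
    using map_upd[of bs as "\<lambda>x. x"] assms by (metis list.set_map)
  then show s: "set ?ds = set as" using assms by simp
  show "length cs = length ?ds" by simp
  show "nsub ?ds cs = nsub as bs"
  proof
    fix x
    show "nsub ?ds cs x = nsub as bs x"
    proof (cases "x \<in> set as")
      case False
      then show ?thesis using s by (simp add: upd_notin)
    next
      case True
      then obtain i where i: "i < length as" "x = as ! i" by (auto simp: in_set_conv_nth)
      then have "bs ! i \<in> set cs" using assms by simp
      then obtain j where j: "j < length cs" "cs ! j = bs ! i" by (auto simp: in_set_conv_nth)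
      have "?ds ! j = x" using i j assms by (simp add: upd_nth)
      then have "nsub ?ds cs x = bs ! i" using upd_nth[OF \<open>distinct ?ds\<close>, of cs j] j by simp
      then show ?thesis using i assms by (simp add: upd_nth)
    qed
  qed
qed

text \<open>Every related action is matched, not just some: for \<open>POpen\<close> and
  \<open>PAlpha\<close> the target prescribes an order of the bound names, and the hypothesis has to
  deliver a fitting one.\<close>

lemma pi_trans_enc: "pi_trans P \<beta> P' \<Longrightarrow> act_rel \<beta> \<alpha> \<Longrightarrow> psi_trans (enc P) \<alpha> (enc P')"
proof (induction arbitrary: \<alpha> rule: pi_trans.induct)
  case (POut x ys P)
  then show ?case by (auto intro: psi_trans.Out)
next
  case (PIn ys zs x P)
  then show ?case by (auto simp: sub_enc map_upd intro!: psi_trans.In)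
next
  case (PSumL P \<beta> P' Q)
  then show ?case using psi_trans.Case[of CTop "enc P"] by simp
next
  case (PSumR Q \<beta> Q' P)
  then show ?case using psi_trans.Case[of CTop "enc Q"] by simp
next
  case (PMatch P \<beta> P' x)
  then show ?case using psi_trans.Case[of "CEq x x" "enc P"] by simp
next
  case (PParL P \<beta> P' Q)
  then show ?case by (simp add: psi_trans.ParL act_rel_names)
next
  case (PParR Q \<beta> Q' P)
  then show ?case by (simp add: psi_trans.ParR act_rel_names)
next
  case (PScope P \<beta> P' x)
  then show ?case by (simp add: psi_trans.Scope act_rel_names)
next
  case (PRep P \<beta> P')
  then show ?case by (simp add: psi_trans.Rep)
next
  case (PComL P Y x ys P' Q Q' as)
  then show ?case by (auto simp: enc_PRess intro!: psi_trans.ComL)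
next
  case (PComR P x ys P' Q Y Q' as)
  then show ?case by (auto simp: enc_PRess intro!: psi_trans.ComR)
next
  case (POpen P Y z ys P' x)
  then obtain as where as: "\<alpha> = OutA (Nm z) as (Tup ys)" "distinct as" "set as = insert x Y" by auto
  \<comment> \<open>The opened name is taken out of the prescribed list; \<open>Open\<close> inserts
    it again at this position.\<close>
  then obtain as1 as2 where s: "as = as1 @ x # as2" by (metis insertI1 split_list)
  have "psi_trans (enc P) (OutA (Nm z) (as1 @ as2) (Tup ys)) (enc P')"
    by (rule POpen.IH) (use as s POpen.hyps in auto)
  then show ?case unfolding as s using POpen.hyps as s by (auto intro!: psi_trans.Open)
next
  case (PAlpha P Y z ys P' as bs)
  then obtain cs where cs: "\<alpha> = OutA (Nm z) cs (Tup (map (nsub as bs) ys))" "distinct cs"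
    "set cs = set bs" by auto
  obtain ds where ds: "distinct ds" "set ds = set as" "length cs = length ds"
    "nsub ds cs = nsub as bs"
    using nsub_reorder[of as bs cs] PAlpha.hyps cs by metis
  have "psi_trans (enc P) (OutA (Nm z) cs (ren_trm (nsub ds cs) (Tup ys))) (sub (nsub ds cs) (enc P'))"
    by (rule psi_trans.Alpha[OF PAlpha.IH]) (use PAlpha.hyps ds cs in auto)
  then show ?case by (simp add: ds cs sub_enc)
qed

lemma psi_trans_enc:
  "psi_trans A \<alpha> B \<Longrightarrow> A = enc P \<Longrightarrow> \<exists>\<beta> P'. pi_trans P \<beta> P' \<and> B = enc P' \<and> act_rel \<beta> \<alpha>"
proof (induction arbitrary: P rule: psi_trans.induct)
  case (In M K Ls N ys X A)
  obtain x P1 where P: "P = PIn x ys P1" "M = Nm x" "X = PTup ys" "A = enc P1"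
    by (rule enc_eq_In[OF In.prems[symmetric]])
  have K: "K = Nm x" using In.hyps(1) P(2) by (cases K) auto
  have N: "distinct ys" "length Ls = length ys" "N = Tup Ls"
    using In.hyps(2) P(3) by (cases N; auto simp: map_upd)+
  show ?case
    unfolding P K N using pi_trans.PIn[OF N(1,2)] sub_enc act_rel.simps(2) by metis
next
  case (Out M K N A)
  obtain x ys P1 where P: "P = POut x ys P1" "M = Nm x" "N = Tup ys" "A = enc P1"
    by (rule enc_eq_Out[OF Out.prems[symmetric]])
  have K: "K = Nm x" using Out.hyps(1) P(2) by (cases K) auto
  show ?case unfolding P K using pi_trans.POut[of x ys P1] by force
next
  case (ComL A M as N A' B K B')
  obtain P1 P2 where P: "P = PPar P1 P2" "A = enc P1" "B = enc P2"
    by (rule enc_eq_Par[OF ComL.prems[symmetric]])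
  obtain z ys P1' where 1: "pi_trans P1 (POutA (set as) z ys) P1'" "A' = enc P1'" "M = Nm z"
      "N = Tup ys" "distinct as"
    using ComL.IH(1)[OF P(2)] by (auto simp: act_rel_OutA)
  obtain P2' where 2: "pi_trans P2 (PInA z ys) P2'" "B' = enc P2'"
    using ComL.IH(2)[OF P(3)] ComL.hyps(3) 1 by (auto simp: act_rel_InA)
  \<comment> \<open>The pi rule admits any listing of the bound set. Using the list of the psi
    action stacks the restrictions in the same order, so the derivatives are equal under the
    encoding.\<close>
  have "pi_trans P PTauA (PRess as (PPar P1' P2'))"
    unfolding P by (rule pi_trans.PComL[OF 1(1) 2(1)]) (use ComL.hyps P 1 in auto)
  then show ?case using 1 2 by (force simp: enc_PRess)
next
  case (ComR A K N A' B M as B')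
  obtain P1 P2 where P: "P = PPar P1 P2" "A = enc P1" "B = enc P2"
    by (rule enc_eq_Par[OF ComR.prems[symmetric]])
  obtain z ys P2' where 1: "pi_trans P2 (POutA (set as) z ys) P2'" "B' = enc P2'" "M = Nm z"
      "N = Tup ys" "distinct as"
    using ComR.IH(2)[OF P(3)] by (auto simp: act_rel_OutA)
  obtain P1' where 2: "pi_trans P1 (PInA z ys) P1'" "A' = enc P1'"
    using ComR.IH(1)[OF P(2)] ComR.hyps(3) 1 by (auto simp: act_rel_InA)
  have "pi_trans P PTauA (PRess as (PPar P1' P2'))"
    unfolding P by (rule pi_trans.PComR[OF 2(1) 1(1)]) (use ComR.hyps P 1 in auto)
  then show ?case using 1 2 by (force simp: enc_PRess)
next
  case (ParL A \<alpha> A' B)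
  obtain P1 P2 where P: "P = PPar P1 P2" "A = enc P1" "B = enc P2"
    by (rule enc_eq_Par[OF ParL.prems[symmetric]])
  obtain \<beta> P' where 1: "pi_trans P1 \<beta> P'" "A' = enc P'" "act_rel \<beta> \<alpha>"
    using ParL.IH[OF P(2)] by auto
  have "pi_trans P \<beta> (PPar P' P2)"
    unfolding P using 1 ParL.hyps P by (intro pi_trans.PParL) (auto simp: act_rel_names)
  then show ?case using 1 P by (metis enc_simps(7))
next
  case (ParR B \<alpha> B' A)
  obtain P1 P2 where P: "P = PPar P1 P2" "A = enc P1" "B = enc P2"
    by (rule enc_eq_Par[OF ParR.prems[symmetric]])
  obtain \<beta> P' where 1: "pi_trans P2 \<beta> P'" "B' = enc P'" "act_rel \<beta> \<alpha>"
    using ParR.IH[OF P(3)] by auto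
  have "pi_trans P \<beta> (PPar P1 P')"
    unfolding P using 1 ParR.hyps P by (intro pi_trans.PParR) (auto simp: act_rel_names)
  then show ?case using 1 P by (metis enc_simps(7))
next
  case (Case \<phi> A bs \<alpha> A')
  from enc_eq_Case[OF Case.prems[symmetric]] show ?case
  proof (elim disjE exE conjE)
    assume "bs = []"
    then show ?thesis using Case.hyps(1) by simp
  next
    fix a b P1 assume P: "P = PMatch a b P1" "bs = [(CEq a b, enc P1)]"
    then have "a = b" using Case.hyps(1,3) by simp
    then show ?thesis using Case.IH[of P1] Case.hyps(1) P by (auto intro: pi_trans.PMatch)
  next
    fix P1 P2 assume P: "P = PSum P1 P2" "bs = [(CTop, enc P1), (CTop, enc P2)]"
    then consider "A = enc P1" | "A = enc P2" using Case.hyps(1) by auto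
    then show ?thesis
      by cases (use Case.IH P(1) in \<open>blast intro: pi_trans.PSumL pi_trans.PSumR\<close>)+
  qed
next
  case (Rep A \<alpha> A')
  obtain P1 where P: "P = PBang P1" "A = enc P1"
    by (rule enc_eq_Bang[OF Rep.prems[symmetric]])
  then show ?case using Rep.IH[of "PPar P1 (PBang P1)"] by (auto intro: pi_trans.PRep)
next
  case (Scope A \<alpha> A' b)
  obtain P1 where P: "P = PRes b P1" "A = enc P1"
    by (rule enc_eq_Res[OF Scope.prems[symmetric]])
  obtain \<beta> P' where 1: "pi_trans P1 \<beta> P'" "A' = enc P'" "act_rel \<beta> \<alpha>"
    using Scope.IH[OF P(2)] by auto
  have "pi_trans P \<beta> (PRes b P')"
    unfolding P using 1 Scope.hyps by (intro pi_trans.PScope) (auto simp: act_rel_names)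
  then show ?case using 1 by (metis enc_simps(5))
next
  case (Open A M as as' N A' b)
  obtain P1 where P: "P = PRes b P1" "A = enc P1"
    by (rule enc_eq_Res[OF Open.prems[symmetric]])
  obtain z ys P' where 1: "pi_trans P1 (POutA (set (as @ as')) z ys) P'" "A' = enc P'" "M = Nm z"
      "N = Tup ys" "distinct (as @ as')"
    using Open.IH[OF P(2)] by (auto simp: act_rel_OutA)
  have "pi_trans P (POutA (insert b (set (as @ as'))) z ys) P'"
    unfolding P using 1 Open.hyps by (intro pi_trans.POpen) auto
  moreover have "act_rel (POutA (insert b (set (as @ as'))) z ys) (OutA M (as @ b # as') N)"
    using 1 Open.hyps by auto
  ultimately show ?case using 1(2) by blast
next
  case (Alpha A M as N A' bs)
  obtain z ys P' where 1: "pi_trans P (POutA (set as) z ys) P'" "A' = enc P'" "M = Nm z"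
      "N = Tup ys" "distinct as"
    using Alpha.IH[OF Alpha.prems] by (auto simp: act_rel_OutA)
  have "pi_trans P (POutA (set bs) z (map (nsub as bs) ys)) (sub_pi (nsub as bs) P')"
    using 1 Alpha.hyps by (intro pi_trans.PAlpha[OF 1(1)]) auto
  then show ?case using 1 Alpha.hyps by (force simp: sub_enc act_rel_OutA)
qed

section \<open>Well-formedness along transitions, and the contexts of the constructors\<close>

lemma wf_sub_praw: "wf_praw P \<Longrightarrow> wf_praw (sub_praw \<sigma> P)"
  by (induction P arbitrary: \<sigma>) (auto simp: Let_def map_upd freshs_props)

lemma wf_sub_pi: "wf_pi P \<Longrightarrow> wf_pi (sub_pi \<sigma> P)"
  by transfer (rule wf_sub_praw)

lemma wf_pi_simps[simp]:
  "wf_pi PNil"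
  "wf_pi (PIn x ys P) \<longleftrightarrow> distinct ys \<and> wf_pi P"
  "wf_pi (POut x ys P) \<longleftrightarrow> wf_pi P"
  "wf_pi (PMatch a b P) \<longleftrightarrow> wf_pi P"
  "wf_pi (PRes x P) \<longleftrightarrow> wf_pi P"
  "wf_pi (PBang P) \<longleftrightarrow> wf_pi P"
  "wf_pi (PPar P Q) \<longleftrightarrow> wf_pi P \<and> wf_pi Q"
  "wf_pi (PSum P Q) \<longleftrightarrow> wf_pi P \<and> wf_pi Q"
  by (transfer; simp)+

lemma wf_PRess[simp]: "wf_pi (PRess as P) = wf_pi P"
  by (induction as) (simp_all add: PRess_def)

lemma wf_pi_trans: "pi_trans P \<beta> P' \<Longrightarrow> wf_pi P \<Longrightarrow> wf_pi P'"
  by (induction rule: pi_trans.induct) (auto simp: wf_sub_pi)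

fun ctx_of :: "'n pi_constr \<Rightarrow> 'n ctx" where
  "ctx_of KNil = CCase []"
| "ctx_of (KIn x ys) = CIn (Nm x) ys (PTup ys) Hole"
| "ctx_of (KOut x ys) = COut (Nm x) (Tup ys) Hole"
| "ctx_of (KMatch a b) = CCase [(CEq a b, Hole)]"
| "ctx_of (KRes x) = CRes x Hole"
| "ctx_of KBang = CBang Hole"
| "ctx_of KPar = CPar Hole Hole"
| "ctx_of KSum = CCase [(CTop, Hole), (CTop, Hole)]"

lemma enc_build: "length Ps = arity_pi f \<Longrightarrow> enc (build_pi f Ps) = fill (ctx_of f) (map enc Ps)"
  by (cases f; cases Ps; cases "tl Ps") (auto simp: length_Suc_conv)

text \<open>\<open>Nil0\<close> is the encoding of \<open>PNil\<close>, so the filled context is the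
  encoding of a well-formed process.\<close>

lemma context_ctx_of:
  assumes "wf_pi_constr f"
  shows "context_of_arity (arity_pi f) (ctx_of f)"
proof -
  let ?Ps = "replicate (arity_pi f) PNil"
  have "wf_pi (build_pi f ?Ps)" using assms by (cases f) (auto simp: numeral_2_eq_2)
  then have "wf_agent (fill (ctx_of f) (map enc ?Ps))"
    by (simp only: wf_enc flip: enc_build[OF length_replicate])
  moreover have "holes (ctx_of f) = arity_pi f" by (cases f) auto
  ultimately show ?thesis by (simp add: context_of_arity_def map_replicate)
qed

lemma representation_by_enc: "representation_by polyadic_pi enc act_rel"
  unfolding representation_by_def polyadic_pi_def
proof (simp, intro conjI allI impI)
  show "enc (swap_pi a b P) = swap_agent a b (enc P)" for a b P by (rule swap_enc)
  show "act_rel (swap_pi_act a b \<beta>) (ren_act (swp a b) \<alpha>)" if "act_rel \<beta> \<alpha>" for a b \<beta> \<alpha>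
    by (rule act_rel_swap[OF that])
  show "\<exists>C. \<forall>f. wf_pi_constr f \<longrightarrow> context_of_arity (arity_pi f) (C f) \<and>
      (\<forall>a b. C (ren_pi_constr (swp a b) f) = ren_ctx (swp a b) (C f)) \<and>
      (\<forall>Ps. length Ps = arity_pi f \<longrightarrow> set Ps \<subseteq> {P. wf_pi P} \<longrightarrow>
        enc (build_pi f Ps) = fill (C f) (map enc Ps))"
  proof (intro exI[of _ ctx_of] allI impI conjI)
    show "ctx_of (ren_pi_constr (swp a b) f) = ren_ctx (swp a b) (ctx_of f)" for f a b
      by (cases f) auto
  qed (auto simp: context_ctx_of enc_build)
  \<comment> \<open>Transitions bind finitely many names; these can be listed, so a related PPI
    action exists.\<close>
  show "\<exists>\<alpha> Q. psi_trans (enc P) \<alpha> Q \<and> scong (enc P') Q \<and> act_rel \<beta> \<alpha>"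
    if "wf_pi P" "wf_pi P'" "pi_trans P \<beta> P'" for P \<beta> P'
    using that ex_act_rel[OF finite_bn_pi] pi_trans_enc sc_refl wf_enc by metis
  show "\<exists>\<beta> P'. wf_pi P' \<and> pi_trans P \<beta> P' \<and> scong (enc P') Q \<and> act_rel \<beta> \<alpha>"
    if "wf_pi P" "psi_trans (enc P) \<alpha> Q" for P \<alpha> Q
    using that psi_trans_enc[OF that(2) refl] wf_pi_trans sc_refl wf_enc by metis
qed

section \<open>Normal forms of PPI agents\<close>

text \<open>A branch guarded by \<open>CBot\<close> is kept as a deadlocked agent in order to preserve the free
  names, hence the side conditions on them in the transition rules.\<close>

fun guard_raw :: "name cond \<Rightarrow> name raw \<Rightarrow> name raw" where
  "guard_raw CTop P = P"
| "guard_raw CBot P = (let a = fresh (fn_raw P) in RRes a (ROut (Nm a) (Tup []) P))"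
| "guard_raw (CEq a b) P = RCase [(CEq a b, P)]"

text \<open>The two-branch cases in the range of the encoding are those with two \<open>CTop\<close>
  guards, the sums. Each condition therefore moves inside its summand, and the empty case closes the
  chain.\<close>

fun sum_raw :: "(name cond \<times> name raw) list \<Rightarrow> name raw" where
  "sum_raw [] = RCase []"
| "sum_raw ((\<phi>, P) # bs) = RCase [(CTop, guard_raw \<phi> P), (CTop, sum_raw bs)]"

text \<open>Normalisation is defined on all raw agents. Falling back to \<open>xs\<close> on
  ill-formed inputs keeps the set and the number of binders unchanged there too, so that the lemmas
  on free names and substitution hold without well-formedness.\<close>

fun reorder :: "name list \<Rightarrow> name pat \<Rightarrow> name list" where
  "reorder xs (PTup ys) = (if distinct xs \<and> distinct ys \<and> set xs = set ys then ys else xs)"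

fun norm_raw :: "name raw \<Rightarrow> name raw" where
  "norm_raw (ROut M N P) = ROut M N (norm_raw P)"
| "norm_raw (RIn M xs X P) = RIn M (reorder xs X) X (norm_raw P)"
| "norm_raw (RCase bs) = sum_raw (map (\<lambda>(\<phi>, P). (\<phi>, norm_raw P)) bs)"
| "norm_raw (RRes a P) = RRes a (norm_raw P)"
| "norm_raw (RPar P Q) = RPar (norm_raw P) (norm_raw Q)"
| "norm_raw (RBang P) = RBang (norm_raw P)"
| "norm_raw (RAssert \<Psi>) = RCase []"

lemma set_reorder[simp]: "set (reorder xs X) = set xs"
  by (cases X) auto

lemma length_reorder[simp]: "length (reorder xs X) = length xs"
  by (cases X) (auto simp flip: distinct_card)

lemma fn_guard_raw: "fn_raw (guard_raw \<phi> P) = names_cond \<phi> \<union> fn_raw P"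
  by (cases \<phi>) (auto simp: Let_def fresh_prop)

lemma fn_sum_raw: "fn_raw (sum_raw bs) = (\<Union>(\<phi>, P) \<in> set bs. names_cond \<phi> \<union> fn_raw P)"
  by (induction bs rule: sum_raw.induct) (auto simp: fn_guard_raw)

lemma fn_norm_raw[simp]: "fn_raw (norm_raw P) = fn_raw P"
proof (induction P)
  case (RCase bs)
  then have "names_cond \<phi> \<union> fn_raw (norm_raw P) = names_cond \<phi> \<union> fn_raw P" if "(\<phi>, P) \<in> set bs"
    for \<phi> P using that by fastforce
  then show ?case by (simp add: fn_sum_raw split_beta)
qed simp_all

text \<open>The private channel of a \<open>CBot\<close> guard is chosen by the same function
  \<open>fresh\<close> that substitution uses for restrictions, so the two choices coincide and
  equality holds.\<close>

lemma sub_guard_raw: "sub_raw \<sigma> (guard_raw \<phi> P) = guard_raw (ren_cond \<sigma> \<phi>) (sub_raw \<sigma> P)"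
proof (cases \<phi>)
  case CBot
  have f: "fresh (fn_raw P) \<notin> fn_raw P" by (rule fresh_prop) simp
  then have "sub_raw (\<sigma>(fresh (fn_raw P) := c)) P = sub_raw \<sigma> P" for c
    by (intro sub_raw_cong) auto
  then show ?thesis using f by (simp add: CBot Let_def fn_sub_raw)
qed simp_all

lemma sub_sum_raw:
  "sub_raw \<sigma> (sum_raw bs) = sum_raw (map (\<lambda>(\<phi>, P). (ren_cond \<sigma> \<phi>, sub_raw \<sigma> P)) bs)"
  by (induction bs rule: sum_raw.induct) (simp_all add: sub_guard_raw)

lemma alpha_guard_raw: "alpha P Q \<Longrightarrow> alpha (guard_raw \<phi> P) (guard_raw \<phi> Q)"
  by (cases \<phi>) (auto simp: Let_def fn_raw_alpha intro!: alpha_res alpha_out alpha_case)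

lemma alpha_sum_raw: "list_all2 (rel_prod (=) alpha) bs cs \<Longrightarrow> alpha (sum_raw bs) (sum_raw cs)"
  by (induction rule: list_all2_induct) (auto intro!: alpha_refl alpha_case alpha_guard_raw)

text \<open>The result depends on \<open>\<tau>\<close> only off the binders, because
  \<open>upd\<close> overwrites its values on \<open>xs\<close>. The renaming of the binders can be
  any capture-free one, not only that picked by \<open>freshs\<close>.\<close>

lemma sub_RIn_sub:
  assumes "inj_on \<tau> (set xs)" "\<tau> ` set xs \<inter> \<tau> ` (names_pat X \<union> fn_raw P - set xs) = {}"
  shows "sub_raw \<sigma> (RIn M (map \<tau> xs) (ren_pat \<tau> X) (sub_raw \<tau> P)) =
    (let cs = freshs (length xs) (\<sigma> ` \<tau> ` (names_pat X \<union> fn_raw P - set xs));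
         \<kappa> = upd (\<sigma> \<circ> \<tau>) xs cs
     in RIn (ren_trm \<sigma> M) (map \<kappa> xs) (ren_pat \<kappa> X) (sub_raw \<kappa> P))"
proof -
  let ?A = "names_pat X \<union> fn_raw P"
  have A: "names_pat (ren_pat \<tau> X) \<union> fn_raw (sub_raw \<tau> P) - set (map \<tau> xs) = \<tau> ` (?A - set xs)"
    using assms(2) by (auto simp: fn_sub_raw pat.set_map)
  define cs where "cs = freshs (length xs) (\<sigma> ` \<tau> ` (?A - set xs))"
  have len: "length cs = length xs" unfolding cs_def by (simp add: freshs_props)
  let ?\<sigma> = "upd \<sigma> (map \<tau> xs) cs"
  have u: "?\<sigma> (\<tau> x) = upd (\<sigma> \<circ> \<tau>) xs cs x" if "x \<in> ?A \<union> set xs" for x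
  proof (cases "x \<in> set xs")
    case True
    then show ?thesis using assms(1) len by (simp add: upd_map_inj_on)
  next
    case False
    then have "\<tau> x \<notin> set (map \<tau> xs)" using assms(2) that by auto
    then show ?thesis using False by (simp add: upd_notin)
  qed
  have 1: "sub_raw ?\<sigma> (sub_raw \<tau> P) = sub_raw (upd (\<sigma> \<circ> \<tau>) xs cs) P"
    unfolding sub_raw_comp by (rule sub_raw_cong) (simp add: u)
  have 2: "ren_pat ?\<sigma> (ren_pat \<tau> X) = ren_pat (upd (\<sigma> \<circ> \<tau>) xs cs) X"
    unfolding pat.map_comp by (rule pat.map_cong0) (simp add: u)
  have 3: "map ?\<sigma> (map \<tau> xs) = map (upd (\<sigma> \<circ> \<tau>) xs cs) xs" by (simp add: u)
  show ?thesis by (simp only: sub_raw.simps Let_def A length_map 1 2 3 flip: cs_def)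
qed

text \<open>Two capture-free renamings of the binders that agree on the free names lead to the same
  canonical representative.\<close>

lemma alpha_RIn_sub:
  assumes "inj_on \<tau> (set xs)" "\<tau> ` set xs \<inter> \<tau> ` (names_pat X \<union> fn_raw P - set xs) = {}"
    "inj_on \<tau>' (set xs)" "\<tau>' ` set xs \<inter> \<tau>' ` (names_pat X \<union> fn_raw P - set xs) = {}"
    "\<And>x. x \<in> names_pat X \<union> fn_raw P - set xs \<Longrightarrow> \<tau> x = \<tau>' x"
  shows "alpha (RIn M (map \<tau> xs) (ren_pat \<tau> X) (sub_raw \<tau> P))
    (RIn M (map \<tau>' xs) (ren_pat \<tau>' X) (sub_raw \<tau>' P))"
proof -
  let ?A = "names_pat X \<union> fn_raw P"
  define cs where "cs = freshs (length xs) (\<tau>' ` (?A - set xs))"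
  have len: "length cs = length xs" unfolding cs_def by (simp add: freshs_props)
  have A: "\<tau> ` (?A - set xs) = \<tau>' ` (?A - set xs)" using assms(5) by (intro image_cong) auto
  have u: "upd \<tau> xs cs x = upd \<tau>' xs cs x" if "x \<in> ?A \<union> set xs" for x
    using that assms(5) by (intro upd_cong) (auto simp: len)
  have 1: "sub_raw (upd \<tau> xs cs) P = sub_raw (upd \<tau>' xs cs) P" by (rule sub_raw_cong) (simp add: u)
  have 2: "ren_pat (upd \<tau> xs cs) X = ren_pat (upd \<tau>' xs cs) X" by (rule pat.map_cong0) (simp add: u)
  have 3: "map (upd \<tau> xs cs) xs = map (upd \<tau>' xs cs) xs" by (simp add: u)
  show ?thesis
    unfolding alpha_iff_sub sub_RIn_sub[OF assms(1,2)] sub_RIn_sub[OF assms(3,4)]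
    by (simp add: Let_def image_image comp_def A 1 2 3 flip: cs_def)
qed

text \<open>The second premise keeps pattern names outside \<open>xs\<close> from being mapped onto
  binders, so the test in \<open>reorder\<close> has the same outcome before and after the
  renaming.\<close>

lemma reorder_map:
  assumes "inj_on \<tau> (set xs)" "\<tau> ` set xs \<inter> \<tau> ` (names_pat X - set xs) = {}"
  shows "reorder (map \<tau> xs) (ren_pat \<tau> X) = map \<tau> (reorder xs X)"
proof (cases X)
  case (PTup ys)
  have s: "set (map \<tau> xs) = set (map \<tau> ys) \<longleftrightarrow> set xs = set ys"
  proof
    assume e: "set (map \<tau> xs) = set (map \<tau> ys)"
    then have sub: "set ys \<subseteq> set xs" using assms(2) unfolding PTup by fastforce
    show "set xs = set ys"
      using inj_on_image_eq_iff[OF assms(1) subset_refl sub] e by simp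
  qed auto
  have "distinct (map \<tau> ys) \<longleftrightarrow> distinct ys" if "set xs = set ys"
    using assms(1) that by (simp add: distinct_map)
  then show ?thesis using s assms(1) by (auto simp: PTup distinct_map)
qed

text \<open>Inputs are what prevents equality: substituting first assigns the fresh names by
  position in the binder list, normalising first by position in the pattern.\<close>

lemma alpha_norm_sub: "alpha (norm_raw (sub_raw \<sigma> P)) (sub_raw \<sigma> (norm_raw P))"
proof (induction P arbitrary: \<sigma>)
  case (RIn M xs X P)
  let ?A = "names_pat X \<union> fn_raw P"
  define cs where "cs = freshs (length xs) (\<sigma> ` (?A - set xs))"
  have cs: "length cs = length xs" "distinct cs" "set cs \<inter> \<sigma> ` (?A - set xs) = {}"
    unfolding cs_def using freshs_props[of "\<sigma> ` (?A - set xs)"] by auto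
  define zs where "zs = reorder xs X"
  have zs: "set zs = set xs" "length zs = length xs" by (simp_all add: zs_def)
  let ?\<tau> = "upd \<sigma> xs cs" and ?\<tau>' = "upd \<sigma> zs cs"
  have inj: "inj_on ?\<tau> (set xs)" "inj_on ?\<tau>' (set xs)"
    using inj_on_upd[of cs xs \<sigma>] inj_on_upd[of cs zs \<sigma>] cs zs by auto
  have disj: "?\<tau> ` set xs \<inter> ?\<tau> ` (?A - set xs) = {}"
    using upd_in[of _ xs cs \<sigma>] cs by (force simp: upd_notin)
  have disj': "?\<tau>' ` set xs \<inter> ?\<tau>' ` (?A - set xs) = {}"
    using upd_in[of _ zs cs \<sigma>] cs zs by (force simp: upd_notin)
  have "alpha (RIn (ren_trm \<sigma> M) (map ?\<tau> zs) (ren_pat ?\<tau> X) (norm_raw (sub_raw ?\<tau> P)))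
      (RIn (ren_trm \<sigma> M) (map ?\<tau> zs) (ren_pat ?\<tau> X) (sub_raw ?\<tau> (norm_raw P)))"
    by (rule alpha_in) (rule RIn)
  \<comment> \<open>The binder list is \<open>zs\<close> on both sides, but \<open>cs\<close> is
    assigned by position in \<open>xs\<close> on one side and by position in \<open>zs\<close> on
    the other.\<close>
  moreover have "alpha (RIn (ren_trm \<sigma> M) (map ?\<tau> zs) (ren_pat ?\<tau> X) (sub_raw ?\<tau> (norm_raw P)))
      (RIn (ren_trm \<sigma> M) (map ?\<tau>' zs) (ren_pat ?\<tau>' X) (sub_raw ?\<tau>' (norm_raw P)))"
    by (rule alpha_RIn_sub) (use inj disj disj' zs in \<open>auto simp: upd_notin\<close>)
  moreover have "reorder (map ?\<tau> xs) (ren_pat ?\<tau> X) = map ?\<tau> zs"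
    unfolding zs_def by (rule reorder_map) (use inj disj in auto)
  ultimately show ?case
    by (simp add: Let_def flip: cs_def zs_def) (simp add: zs alpha_trans flip: cs_def)
next
  case (RCase bs)
  have "list_all2 (rel_prod (=) alpha)
      (map (\<lambda>(\<phi>, P). (ren_cond \<sigma> \<phi>, norm_raw (sub_raw \<sigma> P))) bs)
      (map (\<lambda>(\<phi>, P). (ren_cond \<sigma> \<phi>, sub_raw \<sigma> (norm_raw P))) bs)"
    using RCase by (auto simp: list.rel_map intro!: list.rel_refl_strong)
  from alpha_sum_raw[OF this] show ?case by (simp add: sub_sum_raw comp_def case_prod_beta')
qed (auto simp: Let_def alpha_refl intro!: alpha_out alpha_res alpha_par alpha_bang)

text \<open>No induction on \<open>alpha\<close> is made: normalisation commutes with the identity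
  substitution up to alpha-equivalence, and that substitution already makes the two agents
  equal.\<close>

lemma alpha_norm_raw: "alpha P Q \<Longrightarrow> alpha (norm_raw P) (norm_raw Q)"
  using alpha_norm_sub[of "\<lambda>x. x" P] alpha_norm_sub[of "\<lambda>x. x" Q] unfolding alpha_iff_sub
  by (simp add: sub_raw_comp comp_def)

text \<open>Sorting enters here: well-formedness makes subjects names and objects tuples, and it
  makes \<open>reorder\<close> return the tuple of the pattern, which is the shape of an encoded
  input.\<close>

lemma norm_raw_enc: "wf_raw P \<Longrightarrow> \<exists>Q. wf_praw Q \<and> norm_raw P = enc_raw Q"
proof (induction P)
  case (ROut M N P)
  then obtain Q where "wf_praw Q" "norm_raw P = enc_raw Q" by auto
  moreover obtain x ys where "M = Nm x" "N = Tup ys"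
    using ROut.prems by (cases M; cases N) (auto simp: can_send_def)
  ultimately show ?case by (intro exI[of _ "QOut x ys Q"]) simp
next
  case (RIn M xs X P)
  then obtain Q where "wf_praw Q" "norm_raw P = enc_raw Q" by auto
  moreover obtain x ys where "M = Nm x" "X = PTup ys"
    using RIn.prems by (cases M; cases X) (auto simp: can_receive_def)
  ultimately show ?case using RIn.prems by (intro exI[of _ "QIn x ys Q"]) simp
next
  case (RCase bs)
  have *: "\<exists>Q. wf_praw Q \<and> sum_raw cs = enc_raw Q"
    if "\<And>\<phi> P. (\<phi>, P) \<in> set cs \<Longrightarrow> \<exists>Q. wf_praw Q \<and> P = enc_raw Q" for cs
    using that
  proof (induction cs)
    case Nil
    show ?case by (intro exI[of _ QNil]) simp
  next
    case (Cons c cs)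
    obtain Q where Q: "wf_praw Q" "sum_raw cs = enc_raw Q" using Cons by (meson list.set_intros(2))
    obtain \<phi> P where c: "c = (\<phi>, P)" by (cases c)
    then obtain R where R: "wf_praw R" "P = enc_raw R" using Cons.prems by (meson list.set_intros(1))
    obtain S where "wf_praw S" "guard_raw \<phi> P = enc_raw S"
    proof (cases \<phi>)
      case CTop
      then show thesis using R that by simp
    next
      case CBot
      then show thesis using that[of "QRes _ (QOut _ [] R)"] R by (simp add: Let_def)
    next
      case (CEq a b)
      then show thesis using that[of "QMatch a b R"] R by simp
    qed
    then show ?case using Q by (intro exI[of _ "QSum S Q"]) (simp add: c)
  qed
  show ?case unfolding norm_raw.simps by (rule *) (use RCase in fastforce)
next
  case (RRes a P)
  then obtain Q where "wf_praw Q" "norm_raw P = enc_raw Q" by auto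
  then show ?case by (intro exI[of _ "QRes a Q"]) simp
next
  case (RPar P P')
  then obtain Q Q' where "wf_praw Q" "norm_raw P = enc_raw Q" "wf_praw Q'" "norm_raw P' = enc_raw Q'"
    by auto
  then show ?case by (intro exI[of _ "QPar Q Q'"]) simp
next
  case (RBang P)
  then obtain Q where "wf_praw Q" "norm_raw P = enc_raw Q" by auto
  then show ?case by (intro exI[of _ "QBang Q"]) simp
next
  case (RAssert \<Psi>)
  show ?case by (intro exI[of _ QNil]) simp
qed

section \<open>Distinctness and injectivity of the agent constructors\<close>

lemma agent_cases:
  obtains (Out) M N P where "A = Out M N P" | (In) M xs X P where "A = In M xs X P"
  | (Case) bs where "A = Case bs" | (Res) a P where "A = Res a P"
  | (Par) P Q where "A = Par P Q" | (Bang) P where "A = Bang P" | (Assert) \<Psi> where "A = Assert \<Psi>"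
proof -
  obtain R where A: "A = abs_agent R" by (rule agent_abs_cases)
  show thesis
  proof (cases R)
    case (RCase bs)
    have "A = Case (map (map_prod id abs_agent) bs)" by (simp only: A RCase Case.abs_eq)
    then show thesis by (rule that(3))
  qed (use that in \<open>auto simp: A simp flip: Out.abs_eq In.abs_eq Res.abs_eq Par.abs_eq Bang.abs_eq
    Assert.abs_eq\<close>)
qed

fun head_raw :: "name raw \<Rightarrow> nat" where
  "head_raw (ROut M N P) = 0"
| "head_raw (RIn M xs X P) = 1"
| "head_raw (RCase bs) = 2"
| "head_raw (RRes a P) = 3"
| "head_raw (RPar P Q) = 4"
| "head_raw (RBang P) = 5"
| "head_raw (RAssert \<Psi>) = 6"

lift_definition head :: "agent \<Rightarrow> nat" is head_raw
proof -
  show "alpha P Q \<Longrightarrow> head_raw P = head_raw Q" for P Q by (induction rule: alpha.induct) auto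
qed

lemma head_simps[simp]:
  "head (Out M N P) = 0" "head (In M xs X P) = 1" "head (Case bs) = 2" "head (Res a P) = 3"
  "head (Par P Q) = 4" "head (Bang P) = 5" "head (Assert \<Psi>) = 6"
  by (transfer; simp)+

lemma agent_distinct[simp]:
  "In M xs X P \<noteq> Out M' N' P'" "Case bs \<noteq> Out M' N' P'" "Res a P \<noteq> Out M' N' P'"
  "Par P Q \<noteq> Out M' N' P'" "Bang P \<noteq> Out M' N' P'"
  "Out M N P \<noteq> Case cs" "In M xs X P \<noteq> Case cs" "Res a P \<noteq> Case cs"
  "Par P Q \<noteq> Case cs" "Bang P \<noteq> Case cs"
  "Out M N P \<noteq> Res b P'" "In M xs X P \<noteq> Res b P'" "Case bs \<noteq> Res b P'"
  "Par P Q \<noteq> Res b P'" "Bang P \<noteq> Res b P'"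
  by (rule notI, drule arg_cong[where f = head], simp)+

lemma Out_inject: "Out M N A = Out M' N' A' \<longleftrightarrow> M = M' \<and> N = N' \<and> A = A'"
  by transfer (auto simp: alpha_iff_sub trm.map_ident)

lemma Par_inject: "Par A B = Par A' B' \<longleftrightarrow> A = A' \<and> B = B'"
  by transfer (simp add: alpha_iff_sub)

lemma Bang_inject: "Bang A = Bang A' \<longleftrightarrow> A = A'"
  by transfer (simp add: alpha_iff_sub)

lemma Case_abs: "Case bs = abs_agent (RCase (map (map_prod id rep_agent) bs))"
  using Case.abs_eq[of "map (map_prod id rep_agent) bs"] Quotient3_abs_rep[OF Quotient3_agent]
  by (simp add: comp_def prod.map_comp prod.map_ident)

lemma sub_Out: "sub \<sigma> (Out M N P) = Out (ren_trm \<sigma> M) (ren_trm \<sigma> N) (sub \<sigma> P)"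
  by transfer (simp add: alpha_refl)

lemma Case_inject: "Case bs = Case cs \<longleftrightarrow> bs = cs"
proof -
  have *: "alpha (RCase bs) (RCase cs) \<longleftrightarrow> list_all2 (rel_prod (=) alpha) bs cs" for bs cs
    by (auto simp: alpha_iff_sub list_eq_iff_nth_eq list_all2_conv_all_nth rel_prod_sel split_beta
        cond.map_ident)
  show ?thesis
    unfolding Case_abs agent.abs_eq_iff *
    by (auto simp: list_eq_iff_nth_eq list_all2_conv_all_nth rel_prod_sel prod_eq_iff
        Quotient3_rel_rep[OF Quotient3_agent])
qed

lemma fn_simps[simp]:
  "fn (Out M N P) = names_trm M \<union> names_trm N \<union> fn P"
  "fn (In M xs X P) = names_trm M \<union> (names_pat X \<union> fn P - set xs)"
  "fn (Res a P) = fn P - {a}"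
  "fn (Par P Q) = fn P \<union> fn Q"
  "fn (Bang P) = fn P"
  by (transfer; simp)+

text \<open>For equal binders, the canonical representatives share a binder \<open>c\<close>, and
  substituting \<open>a\<close> back for \<open>c\<close> recovers the two bodies. Different binders
  reduce to this case by renaming one of them.\<close>

lemma Res_eq_Res:
  "Res a A = Res b B \<longleftrightarrow> a \<notin> fn B - {b} \<and> A = sub ((\<lambda>x. x)(b := a)) B"
proof -
  have *: "Res b B = Res a (sub ((\<lambda>x. x)(b := a)) B)" if "a \<notin> fn B - {b}" for a b B
    using that
  proof transfer
    fix a b B assume a: "a \<notin> fn_raw B - {b}"
    let ?\<sigma> = "(\<lambda>x. x)(b := a)"
    have f: "fn_raw (sub_raw ?\<sigma> B) - {a} = fn_raw B - {b}" using a by (auto simp: fn_sub_raw)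
    have "sub_raw ((\<lambda>x. x)(a := c)) (sub_raw ?\<sigma> B) = sub_raw ((\<lambda>x. x)(b := c)) B" for c
      unfolding sub_raw_comp using a by (intro sub_raw_cong) auto
    then show "alpha (RRes b B) (RRes a (sub_raw ?\<sigma> B))"
      unfolding alpha_iff_sub by (simp add: Let_def f image_ident)
  qed
  have inj: "A = A'" if "Res a A = Res a A'" for A A'
    using that
  proof transfer
    fix a A A' assume e: "alpha (RRes a A) (RRes a A')"
    define c where "c = fresh (fn_raw A - {a})"
    have "fn_raw A - {a} = fn_raw A' - {a}" using fn_raw_alpha[OF e] by simp
    then have s: "sub_raw ((\<lambda>x. x)(a := c)) A = sub_raw ((\<lambda>x. x)(a := c)) A'"
      and c': "c \<notin> fn_raw A' - {a}" and c: "c \<notin> fn_raw A - {a}"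
      using e fresh_prop[of "fn_raw A - {a}"]
      by (auto simp: alpha_iff_sub Let_def image_ident c_def)
    have "sub_raw ((\<lambda>x. x)(c := a)) (sub_raw ((\<lambda>x. x)(a := c)) B) = sub_raw (\<lambda>x. x) B"
      if "c \<notin> fn_raw B - {a}" for B
      unfolding sub_raw_comp using that by (intro sub_raw_cong) auto
    then show "alpha A A'" unfolding alpha_iff_sub using s c c' by metis
  qed
  show ?thesis
  proof
    assume e: "Res a A = Res b B"
    have "fn A - {a} = fn B - {b}" using arg_cong[OF e, of fn] by simp
    then have a: "a \<notin> fn B - {b}" by auto
    then show "a \<notin> fn B - {b} \<and> A = sub ((\<lambda>x. x)(b := a)) B" using *[OF a] inj e by metis
  next
    assume "a \<notin> fn B - {b} \<and> A = sub ((\<lambda>x. x)(b := a)) B"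
    then show "Res a A = Res b B" using * by metis
  qed
qed

text \<open>Both inputs have the same canonical representative, in which the bound names are some fresh \<open>cs\<close>;
  receiving \<open>Ls\<close> amounts to substituting \<open>Ls\<close> for \<open>cs\<close> there.\<close>

lemma In_eq_In:
  assumes "In M ys X A = In M' zs X' B" "Ls \<in> matches N ys X"
  shows "M' = M \<and> Ls \<in> matches N zs X' \<and> sub (nsub zs Ls) B = sub (nsub ys Ls) A"
proof -
  obtain vs as where X: "X = PTup vs" "N = Tup as" using assms(2) by (cases X; cases N) auto
  have m: "distinct ys" "length Ls = length ys" "set ys = set vs" "map (nsub ys Ls) vs = as"
    using assms(2) X by auto
  obtain R where A: "A = abs_agent R" by (rule agent_abs_cases)
  obtain S where B: "B = abs_agent S" by (rule agent_abs_cases)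
  obtain ws where X': "X' = PTup ws" by (cases X')
  have al: "alpha (RIn M ys (PTup vs) R) (RIn M' zs (PTup ws) S)"
    using assms(1) by (simp add: A B X X' In.abs_eq agent.abs_eq_iff)
  let ?A = "set vs \<union> fn_raw R - set ys" and ?B = "set ws \<union> fn_raw S - set zs"
  define cs where "cs = freshs (length ys) ?A"
  define ds where "ds = freshs (length zs) ?B"
  have cs: "length cs = length ys" "distinct cs" "set cs \<inter> ?A = {}"
    unfolding cs_def using freshs_props[of ?A] by auto
  have ds: "length ds = length zs" "distinct ds" "set ds \<inter> ?B = {}"
    unfolding ds_def using freshs_props[of ?B] by auto
  have e: "M' = M" "map (nsub ys cs) ys = map (nsub zs ds) zs"
    "map (nsub ys cs) vs = map (nsub zs ds) ws"
    "sub_raw (nsub ys cs) R = sub_raw (nsub zs ds) S"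
    using al unfolding alpha_iff_sub
    by (auto simp: Let_def image_ident trm.map_ident simp flip: cs_def ds_def)
  have len: "length zs = length ys" using arg_cong[OF e(2), of length] by simp
  have c: "map (nsub zs ds) zs = cs" using e(2) map_upd[OF m(1) cs(1)] by simp
  then have dz: "distinct zs" using cs(2) by (metis distinct_map)
  then have dc: "ds = cs" using c map_upd[OF dz ds(1)] by simp
  have k: "nsub cs Ls (nsub ys cs x) = nsub ys Ls x" if "x \<in> set vs \<union> fn_raw R" for x
  proof (cases "x \<in> set ys")
    case True
    then obtain i where "i < length ys" "x = ys ! i" by (auto simp: in_set_conv_nth)
    then show ?thesis using m cs by (simp add: upd_nth)
  next
    case False
    then have "x \<notin> set cs" using that cs(3) by auto
    then show ?thesis using False by (simp add: upd_notin)
  qed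
  have l: "nsub cs Ls (nsub zs cs x) = nsub zs Ls x" if "x \<in> set ws \<union> fn_raw S" for x
  proof (cases "x \<in> set zs")
    case True
    then obtain i where "i < length zs" "x = zs ! i" by (auto simp: in_set_conv_nth)
    then show ?thesis using m cs dz len by (simp add: upd_nth)
  next
    case False
    then have "x \<notin> set cs" using that ds(3) dc by auto
    then show ?thesis using False by (simp add: upd_notin)
  qed
  have "map (nsub zs Ls) ws = map (nsub cs Ls) (map (nsub zs cs) ws)" by (simp add: l)
  also have "map (nsub zs cs) ws = map (nsub ys cs) vs" using e(3) dc by simp
  also have "map (nsub cs Ls) \<dots> = map (nsub ys Ls) vs" by (simp add: k)
  also have "\<dots> = as" by (rule m(4))
  finally have n: "map (nsub zs Ls) ws = as" .
  have i1: "nsub zs cs ` set ws = set cs"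
    using arg_cong[OF e(3), of set] arg_cong[OF c, of set] e(2) m(3) dc c by (metis list.set_map)
  \<comment> \<open>Nothing is assumed about the second input, so that it binds its pattern names is
    recovered from the canonical form: all renamed pattern names lie in \<open>cs\<close>, whereas
    one outside \<open>zs\<close> would be left unchanged and avoid \<open>cs\<close>.\<close>
  have sub: "set ws \<subseteq> set zs"
  proof
    fix w assume w: "w \<in> set ws"
    show "w \<in> set zs"
    proof (rule ccontr)
      assume "w \<notin> set zs"
      then have "nsub zs cs w = w" "w \<notin> set cs" using w ds(3) dc by (auto simp: upd_notin)
      then show False using i1 w by (metis image_eqI)
    qed
  qed
  have "nsub zs cs ` set zs = set cs" using c dc by (metis list.set_map)
  then have "set zs = set ws"
    using inj_on_image_eq_iff[OF inj_on_upd[of cs zs "\<lambda>x. x"] subset_refl sub] i1 cs(2) ds(1) dc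
    by simp
  then have "Ls \<in> matches N zs X'" using n dz len m(2) by (simp add: X X')
  moreover have "sub_raw (nsub zs Ls) S = sub_raw (nsub ys Ls) R"
  proof -
    have "sub_raw (nsub cs Ls) (sub_raw (nsub ys cs) R) = sub_raw (nsub ys Ls) R"
      unfolding sub_raw_comp by (rule sub_raw_cong) (simp add: k)
    moreover have "sub_raw (nsub cs Ls) (sub_raw (nsub zs cs) S) = sub_raw (nsub zs Ls) S"
      unfolding sub_raw_comp by (rule sub_raw_cong) (simp add: l)
    ultimately show ?thesis using e(4) dc by simp
  qed
  ultimately show ?thesis using e(1) by (simp add: A B sub.abs_eq)
qed

section \<open>Normal forms on alpha-classes and their inversion\<close>

lift_definition Guard :: "name cond \<Rightarrow> agent \<Rightarrow> agent" is guard_raw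
  by (rule alpha_guard_raw)
lift_definition GSum :: "(name cond \<times> agent) list \<Rightarrow> agent" is sum_raw
  by (rule alpha_sum_raw)
lift_definition norm :: "agent \<Rightarrow> agent" is norm_raw
  by (rule alpha_norm_raw)

lemma Guard_simps:
  "Guard CTop P = P"
  "Guard (CEq a b) P = Case [(CEq a b, P)]"
  by (transfer; simp add: alpha_refl)+

lemma Guard_CBot: "\<exists>a. Guard CBot P = Res a (Out (Nm a) (Tup []) P)"
  by transfer (auto simp: Let_def intro: alpha_refl)

lemma GSum_simps:
  "GSum [] = Case []"
  "GSum ((\<phi>, P) # bs) = Case [(CTop, Guard \<phi> P), (CTop, GSum bs)]"
  by (transfer; simp add: alpha_refl)+

lemma norm_simps:
  "norm (Out M N P) = Out M N (norm P)"
  "norm (In M xs X P) = In M (reorder xs X) X (norm P)"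
  "norm (Res a P) = Res a (norm P)"
  "norm (Par P Q) = Par (norm P) (norm Q)"
  "norm (Bang P) = Bang (norm P)"
  "norm (Assert \<Psi>) = Case []"
  by (transfer; simp add: alpha_refl)+

lemma norm_Case_GSum: "norm (Case bs) = GSum (map (map_prod id norm) bs)"
proof transfer
  fix bs
  have *: "(\<lambda>(\<phi>, P). (\<phi>, norm_raw P)) = map_prod id norm_raw" by auto
  show "alpha (norm_raw (RCase bs)) (sum_raw (map (map_prod id norm_raw) bs))"
    unfolding norm_raw.simps * by (rule alpha_refl)
qed

lemma norm_Case:
  "norm (Case []) = Case []"
  "norm (Case ((\<phi>, P) # bs)) = Case [(CTop, Guard \<phi> (norm P)), (CTop, norm (Case bs))]"
  by (simp_all add: norm_Case_GSum GSum_simps)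

lemma norm_sub: "norm (sub \<sigma> P) = sub \<sigma> (norm P)"
  by transfer (rule alpha_norm_sub)

lemma fn_norm[simp]: "fn (norm P) = fn P"
  by transfer simp

lemma norm_Ress: "norm (Ress as P) = Ress as (norm P)"
  by (induction as) (simp_all add: Ress_def norm_simps)

text \<open>The code 6 belongs to assertions and 2 to cases: turning assertions into the empty case
  is the only change of outermost constructor.\<close>

lemma head_norm: "head (norm A) = (if head A = 6 then 2 else head A)"
proof (cases A rule: agent_cases)
  case (Case bs)
  then show ?thesis by (cases bs) (auto simp: norm_Case)
qed (simp_all add: norm_simps)

lemma head_norm_eq: "norm A = B \<Longrightarrow> (if head A = 6 then 2 else head A) = head B"
  using head_norm by metis

lemma norm_eq_Out:
  assumes "norm P = Out M N A" obtains P' where "P = Out M N P'" "A = norm P'"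
  using assms head_norm_eq[OF assms]
  by (cases P rule: agent_cases) (auto simp: norm_simps Out_inject)

lemma norm_eq_In:
  assumes "norm P = In M ys X A"
  obtains M' xs X' P' where "P = In M' xs X' P'" "In M' (reorder xs X') X' (norm P') = In M ys X A"
  using assms head_norm_eq[OF assms]
  by (cases P rule: agent_cases) (auto simp: norm_simps)

lemma norm_eq_Par:
  assumes "norm P = Par A B"
  obtains P1 P2 where "P = Par P1 P2" "A = norm P1" "B = norm P2"
  using assms head_norm_eq[OF assms]
  by (cases P rule: agent_cases) (auto simp: norm_simps Par_inject)

lemma norm_eq_Bang:
  assumes "norm P = Bang A" obtains P' where "P = Bang P'" "A = norm P'"
  using assms head_norm_eq[OF assms]
  by (cases P rule: agent_cases) (auto simp: norm_simps Bang_inject)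

text \<open>The binder of \<open>P\<close> may differ from \<open>a\<close>. Since \<open>a\<close>
  is admissible for \<open>P\<close> as well, \<open>P\<close> is presented with this binder, and
  normalisation commutes with the renaming of the body.\<close>

lemma norm_eq_Res:
  assumes "norm P = Res a A" obtains P' where "P = Res a P'" "A = norm P'"
proof -
  obtain b P1 where P: "P = Res b P1"
    using head_norm_eq[OF assms] by (cases P rule: agent_cases) auto
  then have "Res a A = Res b (norm P1)" using assms by (simp add: norm_simps)
  then have a: "a \<notin> fn P1 - {b}" and A: "A = sub ((\<lambda>x. x)(b := a)) (norm P1)"
    by (simp_all add: Res_eq_Res)
  have "Res a (sub ((\<lambda>x. x)(b := a)) P1) = P" unfolding P using a by (simp add: Res_eq_Res)
  then show thesis using that[of "sub ((\<lambda>x. x)(b := a)) P1"] A by (simp add: norm_sub)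
qed

text \<open>Nonemptiness of \<open>bs\<close> rules out the empty case and assertions, both of which
  normalise to \<open>Case []\<close>.\<close>

lemma norm_eq_Case:
  assumes "norm P = Case bs" "bs \<noteq> []"
  obtains \<phi> Q cs where "P = Case ((\<phi>, Q) # cs)"
    "bs = [(CTop, Guard \<phi> (norm Q)), (CTop, norm (Case cs))]"
proof (cases P rule: agent_cases)
  case (Case ds)
  then obtain \<phi> Q cs where "ds = (\<phi>, Q) # cs"
    using assms by (cases ds) (auto simp: norm_Case Case_inject)
  then show thesis using that assms(1) Case by (simp add: norm_Case Case_inject)
qed (use assms head_norm_eq[OF assms(1)] in \<open>auto simp: norm_simps Case_inject\<close>)

section \<open>An agent and its normal form have the same transitions\<close>

text \<open>A match is determined by its substitution; \<open>Ls'\<close> lists the values of that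
  substitution in the order \<open>zs\<close>.\<close>

lemma matches_reorder:
  assumes "Ls \<in> matches N xs X" "distinct zs" "set zs = set xs"
  obtains Ls' where "Ls' \<in> matches N zs X" "nsub zs Ls' = nsub xs Ls"
proof -
  obtain ys as where X: "X = PTup ys" "N = Tup as" using assms(1) by (cases X; cases N) auto
  let ?Ls = "map (nsub xs Ls) zs"
  have "nsub zs ?Ls x = nsub xs Ls x" for x
  proof (cases "x \<in> set zs")
    case True
    then obtain i where "i < length zs" "x = zs ! i" by (auto simp: in_set_conv_nth)
    then show ?thesis using assms(2) by (simp add: upd_nth)
  next
    case False
    then show ?thesis using assms(3) by (simp add: upd_notin)
  qed
  then have e: "nsub zs ?Ls = nsub xs Ls" by auto
  show thesis by (rule that[of ?Ls]) (use assms in \<open>auto simp: e X\<close>)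
qed

lemma distinct_reorder[simp]: "distinct (reorder xs X) = distinct xs"
  by (cases X) auto

lemma psi_trans_norm: "psi_trans P \<alpha> P' \<Longrightarrow> psi_trans (norm P) \<alpha> (norm P')"
proof (induction rule: psi_trans.induct)
  case (In M K Ls N ys X P)
  have "distinct ys" using In.hyps(2) by (cases X; cases N) auto
  then obtain Ls' where "Ls' \<in> matches N (reorder ys X) X" "nsub (reorder ys X) Ls' = nsub ys Ls"
    using matches_reorder[OF In.hyps(2)] by (metis distinct_reorder set_reorder)
  then show ?case using psi_trans.In[OF In.hyps(1)] by (metis norm_simps(2) norm_sub)
next
  case (Case \<phi> P bs \<alpha> P')
  \<comment> \<open>An entailed condition is \<open>CTop\<close> or an equation between equal names;
    in both cases the guard inherits the transition.\<close>
  have "psi_trans (Guard \<phi> (norm P)) \<alpha> (norm P')"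
    using Case.IH Case.hyps(3) by (cases \<phi>) (auto simp: Guard_simps intro: psi_trans.Case)
  with Case.hyps(1) show ?case
  proof (induction bs)
    case (Cons b bs)
    obtain \<psi> Q where b: "b = (\<psi>, Q)" by (cases b)
    show ?case
    proof (cases "b = (\<phi>, P)")
      case True
      then show ?thesis using Cons.prems(2)
        by (auto simp: norm_Case intro!: psi_trans.Case[of CTop "Guard \<phi> (norm P)"])
    next
      case False
      then show ?thesis using Cons
        by (auto simp: b norm_Case intro!: psi_trans.Case[of CTop "norm (Case bs)"])
    qed
  qed simp
next
  case (ComL P M as N P' Q K Q')
  then show ?case using psi_trans.ComL[OF ComL.IH] by (simp add: norm_simps norm_Ress)
next
  case (ComR P K N P' Q M as Q')
  then show ?case using psi_trans.ComR[OF ComR.IH] by (simp add: norm_simps norm_Ress)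
next
  case (Alpha P M as N P' bs)
  then show ?case using psi_trans.Alpha[OF Alpha.IH] by (simp add: norm_sub)
qed (auto simp: norm_simps psi_trans.ParL psi_trans.ParR
    intro: psi_trans.Out psi_trans.Rep psi_trans.Scope psi_trans.Open)

text \<open>Equivalent channels are equal names, so the subject is \<open>M\<close> itself;
  \<open>Alpha\<close> could only rename an empty list of bound names.\<close>

lemma psi_trans_Out: "psi_trans A \<alpha> B \<Longrightarrow> A = Out M N P \<Longrightarrow> \<alpha> = OutA M [] N"
proof (induction rule: psi_trans.induct)
  case (In M' K Ls N' ys X P')
  then show ?case by simp
next
  case (Out M' K N' P')
  then show ?case by (cases M'; cases K) (auto simp: Out_inject)
next
  case (Alpha P M as N P' bs)
  moreover have "nsub [] [] = (\<lambda>x. x)" by (simp add: upd_def fun_eq_iff)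
  ultimately show ?case by (simp add: trm.map_ident)
qed auto

text \<open>The restricted name is the subject of the only action of the body. \<open>Scope\<close>
  requires it to be absent from the action and \<open>Open\<close> requires it to differ from the
  subject.\<close>

lemma psi_trans_dead: "psi_trans A \<alpha> B \<Longrightarrow> A \<noteq> Res a (Out (Nm a) (Tup []) P)"
proof (induction rule: psi_trans.induct)
  case (Scope Q \<alpha> Q' b)
  show ?case
  proof
    assume "Res b Q = Res a (Out (Nm a) (Tup []) P)"
    then obtain P' where "Q = Out (Nm b) (Tup []) P'"
      unfolding Res_eq_Res by (auto simp: sub_Out)
    then show False using psi_trans_Out[OF Scope.hyps(1)] Scope.hyps(2) by auto
  qed
next
  case (Open Q M as as' N Q' b)
  show ?case
  proof
    assume "Res b Q = Res a (Out (Nm a) (Tup []) P)"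
    then obtain P' where "Q = Out (Nm b) (Tup []) P'"
      unfolding Res_eq_Res by (auto simp: sub_Out)
    then show False using psi_trans_Out[OF Open.hyps(1)] Open.hyps(2) by auto
  qed
qed auto

text \<open>Lifts transitions from the tail of a branch list to the whole list. An induction is
  needed because a derivation may end with \<open>Alpha\<close> instead of
  \<open>Case\<close>.\<close>

lemma psi_trans_Case_mono:
  "psi_trans A \<alpha> B \<Longrightarrow> A = Case bs \<Longrightarrow> set bs \<subseteq> set cs \<Longrightarrow> psi_trans (Case cs) \<alpha> B"
proof (induction rule: psi_trans.induct)
  case (Case \<phi> P bs' \<alpha> P')
  then show ?case by (auto simp: Case_inject intro: psi_trans.Case)
next
  case (Alpha P M as N P' bs)
  then show ?case by (blast intro: psi_trans.Alpha)
qed auto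

text \<open>The summand of an equation branch, \<open>Case [(CEq a b, norm P)]\<close>, is a
  component of a normal form but not one itself. The second conjunct carries the induction through
  it.\<close>

lemma norm_psi_trans:
  assumes "psi_trans A \<alpha> B"
  shows "(\<forall>P. A = norm P \<longrightarrow> (\<exists>P'. psi_trans P \<alpha> P' \<and> B = norm P')) \<and>
    (\<forall>a b P. A = Case [(CEq a b, norm P)] \<longrightarrow> a = b \<and> (\<exists>P'. psi_trans P \<alpha> P' \<and> B = norm P'))"
  using assms
proof (induction rule: psi_trans.induct)
  case (In M K Ls N ys X A)
  have "\<exists>P'. psi_trans P (InA K N) P' \<and> sub (nsub ys Ls) A = norm P'" if h: "In M ys X A = norm P" for P
  proof -
    obtain M' xs X' P' where P: "P = In M' xs X' P'"
      "In M' (reorder xs X') X' (norm P') = In M ys X A"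
      by (rule norm_eq_In[OF h[symmetric]])
    let ?zs = "reorder xs X'"
    have 1: "M' = M" "Ls \<in> matches N ?zs X'" "sub (nsub ?zs Ls) (norm P') = sub (nsub ys Ls) A"
      using In_eq_In[OF P(2)[symmetric] In.hyps(2)] by auto
    have "distinct ?zs" using 1(2) by (cases X'; cases N) auto
    then obtain Ls' where "Ls' \<in> matches N xs X'" "nsub xs Ls' = nsub ?zs Ls"
      using matches_reorder[OF 1(2)] by (metis distinct_reorder set_reorder)
    then show ?thesis
      using psi_trans.In[OF In.hyps(1)] 1 P(1) by (metis norm_sub)
  qed
  then show ?case by auto
next
  case (Out M K N A)
  have "\<exists>P'. psi_trans P (OutA K [] N) P' \<and> A = norm P'" if h: "Out M N A = norm P" for P
    using norm_eq_Out[OF h[symmetric]] psi_trans.Out[OF Out.hyps] by metis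
  then show ?case by auto
next
  case (ComL A M as N A' B K B')
  have "\<exists>P'. psi_trans P TauA P' \<and> Ress as (Par A' B') = norm P'" if h: "Par A B = norm P" for P
  proof -
    obtain P1 P2 where P: "P = Par P1 P2" "A = norm P1" "B = norm P2"
      by (rule norm_eq_Par[OF h[symmetric]])
    then obtain P1' P2' where "psi_trans P1 (OutA M as N) P1'" "A' = norm P1'"
      "psi_trans P2 (InA K N) P2'" "B' = norm P2'"
      using ComL.IH by blast
    then show ?thesis using ComL.hyps P psi_trans.ComL[of P1 M as N P1' P2 K P2']
      by (intro exI[of _ "Ress as (Par P1' P2')"]) (simp add: norm_Ress norm_simps)
  qed
  then show ?case by auto
next
  case (ComR A K N A' B M as B')
  have "\<exists>P'. psi_trans P TauA P' \<and> Ress as (Par A' B') = norm P'" if h: "Par A B = norm P" for P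
  proof -
    obtain P1 P2 where P: "P = Par P1 P2" "A = norm P1" "B = norm P2"
      by (rule norm_eq_Par[OF h[symmetric]])
    then obtain P1' P2' where "psi_trans P2 (OutA M as N) P2'" "A' = norm P1'"
      "psi_trans P1 (InA K N) P1'" "B' = norm P2'"
      using ComR.IH by blast
    then show ?thesis using ComR.hyps P psi_trans.ComR[of P1 K N P1' P2 M as P2']
      by (intro exI[of _ "Ress as (Par P1' P2')"]) (simp add: norm_Ress norm_simps)
  qed
  then show ?case by auto
next
  case (ParL A \<alpha> A' B)
  have "\<exists>P'. psi_trans P \<alpha> P' \<and> Par A' B = norm P'" if h: "Par A B = norm P" for P
  proof -
    obtain P1 P2 where P: "P = Par P1 P2" "A = norm P1" "B = norm P2"
      by (rule norm_eq_Par[OF h[symmetric]])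
    then obtain P1' where "psi_trans P1 \<alpha> P1'" "A' = norm P1'" using ParL.IH by blast
    then show ?thesis using ParL.hyps P
      by (intro exI[of _ "Par P1' P2"]) (simp add: psi_trans.ParL norm_simps)
  qed
  then show ?case by auto
next
  case (ParR B \<alpha> B' A)
  have "\<exists>P'. psi_trans P \<alpha> P' \<and> Par A B' = norm P'" if h: "Par A B = norm P" for P
  proof -
    obtain P1 P2 where P: "P = Par P1 P2" "A = norm P1" "B = norm P2"
      by (rule norm_eq_Par[OF h[symmetric]])
    then obtain P2' where "psi_trans P2 \<alpha> P2'" "B' = norm P2'" using ParR.IH by blast
    then show ?thesis using ParR.hyps P
      by (intro exI[of _ "Par P1 P2'"]) (simp add: psi_trans.ParR norm_simps)
  qed
  then show ?case by auto
next
  case (Case \<phi> A bs \<alpha> A')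
  have "\<exists>P'. psi_trans P \<alpha> P' \<and> A' = norm P'" if h: "Case bs = norm P" for P
  proof -
    have "bs \<noteq> []" using Case.hyps(1) by auto
    then obtain \<psi> Q cs where P: "P = Case ((\<psi>, Q) # cs)"
      and bs: "bs = [(CTop, Guard \<psi> (norm Q)), (CTop, norm (Case cs))]"
      by (rule norm_eq_Case[OF h[symmetric]])
    then consider "A = Guard \<psi> (norm Q)" | "A = norm (Case cs)" using Case.hyps(1) by auto
    then show ?thesis
    proof cases
      case 1
      \<comment> \<open>A guard that can move certifies its condition: that of \<open>CBot\<close>
        is dead, and that of an equation is handled by the second conjunct of the
        hypothesis.\<close>
      have "entails One \<psi> \<and> (\<exists>P'. psi_trans Q \<alpha> P' \<and> A' = norm P')"
      proof (cases \<psi>)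
        case CBot
        then show ?thesis using Guard_CBot[of "norm Q"] psi_trans_dead[OF Case.hyps(2)] 1 by metis
      qed (use Case.IH 1 in \<open>auto simp: Guard_simps\<close>)
      then show ?thesis unfolding P using psi_trans.Case[of \<psi> Q "(\<psi>, Q) # cs"] by auto
    next
      case 2
      then obtain P' where "psi_trans (Case cs) \<alpha> P'" "A' = norm P'" using Case.IH by blast
      then show ?thesis unfolding P using psi_trans_Case_mono[OF _ refl] by (metis set_subset_Cons)
    qed
  qed
  moreover have "a = b \<and> (\<exists>P'. psi_trans P \<alpha> P' \<and> A' = norm P')"
    if "Case bs = Case [(CEq a b, norm P)]" for a b P
    using that Case.hyps(1,3) Case.IH by (simp add: Case_inject)
  ultimately show ?case by blast
next
  case (Rep A \<alpha> A')
  have "\<exists>P'. psi_trans P \<alpha> P' \<and> A' = norm P'" if h: "Bang A = norm P" for P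
  proof -
    obtain P1 where P: "P = Bang P1" "A = norm P1" by (rule norm_eq_Bang[OF h[symmetric]])
    then have "Par A (Bang A) = norm (Par P1 (Bang P1))" by (simp add: norm_simps)
    then obtain P' where "psi_trans (Par P1 (Bang P1)) \<alpha> P'" "A' = norm P'" using Rep.IH by blast
    then show ?thesis unfolding P(1) by (blast intro: psi_trans.Rep)
  qed
  then show ?case by auto
next
  case (Scope A \<alpha> A' b)
  have "\<exists>P'. psi_trans P \<alpha> P' \<and> Res b A' = norm P'" if h: "Res b A = norm P" for P
  proof -
    obtain P1 where P: "P = Res b P1" "A = norm P1" by (rule norm_eq_Res[OF h[symmetric]])
    then obtain P' where "psi_trans P1 \<alpha> P'" "A' = norm P'" using Scope.IH by blast
    then show ?thesis unfolding P(1) using Scope.hyps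
      by (intro exI[of _ "Res b P'"]) (simp add: psi_trans.Scope norm_simps)
  qed
  then show ?case by auto
next
  case (Open A M as as' N A' b)
  have "\<exists>P'. psi_trans P (OutA M (as @ b # as') N) P' \<and> A' = norm P'" if h: "Res b A = norm P" for P
  proof -
    obtain P1 where P: "P = Res b P1" "A = norm P1" by (rule norm_eq_Res[OF h[symmetric]])
    then obtain P' where "psi_trans P1 (OutA M (as @ as') N) P'" "A' = norm P'"
      using Open.IH by blast
    then show ?thesis unfolding P(1) using Open.hyps psi_trans.Open by blast
  qed
  then show ?case by auto
next
  case (Alpha A M as N A' bs)
  have *: "\<exists>Q. psi_trans P (OutA M bs (ren_trm (nsub as bs) N)) Q \<and> sub (nsub as bs) A' = norm Q"
    if "psi_trans P (OutA M as N) P'" "A' = norm P'" for P P'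
    using psi_trans.Alpha[OF that(1)] Alpha.hyps that(2)
    by (intro exI[of _ "sub (nsub as bs) P'"]) (simp add: norm_sub)
  then show ?case using Alpha.IH by blast
qed

section \<open>Completeness\<close>

lemma noassert_sub[simp]: "noassert_raw (sub_raw \<sigma> P) = noassert_raw P"
  by (induction P arbitrary: \<sigma>) (fastforce simp: Let_def split_beta)+

lemma wf_sub_raw: "wf_raw P \<Longrightarrow> wf_raw (sub_raw \<sigma> P)"
proof (induction P arbitrary: \<sigma>)
  case (RIn M xs X P)
  define cs where "cs = freshs (length xs) (\<sigma> ` (names_pat X \<union> fn_raw P - set xs))"
  have cs: "length cs = length xs" "distinct cs"
    unfolding cs_def using freshs_props[of "\<sigma> ` (names_pat X \<union> fn_raw P - set xs)"] by auto
  have inj: "inj_on (upd \<sigma> xs cs) (set xs)" by (rule inj_on_upd[OF cs(2,1)])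
  moreover have "wf_pat (ren_pat (upd \<sigma> xs cs) X)"
    using inj RIn.prems by (cases X) (simp add: distinct_map)
  ultimately show ?case using RIn
    unfolding sub_raw.simps Let_def cs_def[symmetric] by (simp add: distinct_map pat.set_map)
qed (auto simp: Let_def)

lemma wf_sub: "wf_agent P \<Longrightarrow> wf_agent (sub \<sigma> P)"
  by transfer (rule wf_sub_raw)

lemma wf_Case: "wf_agent (Case bs) \<Longrightarrow> (\<phi>, P) \<in> set bs \<Longrightarrow> wf_agent P"
proof -
  assume wf: "wf_agent (Case bs)" and P: "(\<phi>, P) \<in> set bs"
  have "wf_raw (RCase (map (map_prod id rep_agent) bs))"
    using wf unfolding Case_abs wf_agent.abs_eq .
  then have "wf_raw (rep_agent P)" using P by force
  then show "wf_agent P" by (metis Quotient3_abs_rep Quotient3_agent wf_agent.abs_eq)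
qed

lemma wf_simps:
  "wf_agent (Out M N P) \<Longrightarrow> wf_agent P"
  "wf_agent (In M xs X P) \<Longrightarrow> wf_agent P"
  "wf_agent (Res a P) = wf_agent P"
  "wf_agent (Par P Q) \<longleftrightarrow> wf_agent P \<and> wf_agent Q"
  "wf_agent (Bang P) \<Longrightarrow> wf_agent P"
  by (transfer; simp)+

lemma wf_Ress: "wf_agent (Ress as P) = wf_agent P"
  by (induction as) (simp_all add: Ress_def wf_simps(3))

lemma wf_psi_trans: "psi_trans P \<alpha> P' \<Longrightarrow> wf_agent P \<Longrightarrow> wf_agent P'"
  by (induction rule: psi_trans.induct)
    (auto simp: wf_simps(3,4) wf_Ress dest: wf_simps(1,2,5) wf_Case intro: wf_sub)

lemma norm_enc:
  assumes "wf_agent P" obtains Q where "wf_pi Q" "norm P = enc Q"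
proof -
  have "\<exists>Q. wf_pi Q \<and> norm P = enc Q"
    using assms by transfer (use norm_raw_enc alpha_refl in metis)
  then show thesis using that by blast
qed

text \<open>The graph of \<open>norm\<close> on well-formed agents, made symmetric, is a
  bisimulation: both simulations keep the action and lead back into the graph, and transitions
  preserve well-formedness.\<close>

lemma bisimilar_norm:
  assumes "wf_agent P" shows "bisimilar P (norm P)"
proof -
  let ?R = "\<lambda>P Q. wf_agent P \<and> wf_agent Q \<and> (Q = norm P \<or> P = norm Q)"
  have wf: "wf_agent (norm P)" if "wf_agent P" for P using norm_enc[OF that] by (metis wf_enc)
  have "bisimulation ?R"
    unfolding bisimulation_def
  proof (intro allI impI conjI)
    show "entails (frame P) \<phi> = entails (frame Q) \<phi>" for P Q \<phi> by (metis assertion.exhaust)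
    show "\<exists>Q'. psi_trans Q \<alpha> Q' \<and> ?R P' Q'" if R: "?R P Q" and t: "psi_trans P \<alpha> P'" for P Q \<alpha> P'
    proof -
      have "\<exists>Q'. psi_trans Q \<alpha> Q' \<and> (Q' = norm P' \<or> P' = norm Q')"
        using R psi_trans_norm[OF t] norm_psi_trans[OF t] by blast
      then show ?thesis using R t wf_psi_trans by blast
    qed
  qed auto
  then show ?thesis unfolding bisimilar_def using assms wf by blast
qed

lemma norm_sub_seq: "norm (sub_seq \<sigma>s P) = sub_seq \<sigma>s (norm P)"
  by (induction \<sigma>s arbitrary: P) (auto simp: sub_seq_def norm_sub)

lemma wf_sub_seq: "wf_agent P \<Longrightarrow> wf_agent (sub_seq \<sigma>s P)"
  by (induction \<sigma>s arbitrary: P) (auto simp: sub_seq_def wf_sub)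

lemma bisim_cong_norm: "wf_agent P \<Longrightarrow> bisim_cong P (norm P)"
  unfolding bisim_cong_def norm_sub_seq[symmetric] by (simp add: bisimilar_norm wf_sub_seq)

theorem theorem4p10:
  shows "PPI_completely_represents polyadic_pi"
proof -
  have "\<exists>Q \<in> procs polyadic_pi. bisim_cong P (enc Q)" if "wf_agent P" for P
    using norm_enc[OF that] bisim_cong_norm[OF that] by (force simp: polyadic_pi_def)
  then show ?thesis unfolding PPI_completely_represents_def using representation_by_enc by blast
qed

end
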